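(* Let $\mathbf u^0\in H^s$ for some $s\ge3$, with $\mathbf u^0$ divergence-free and mean-free, and let $r\in(\frac56,1]$. For each $\alpha>0$ let $\mathbf u_{\alpha,r}$ be the solution of the fractional Euler--Voigt equations $$(I+\alpha^{2r}A^r)\frac{d}{dt}\mathbf u_{\alpha,r}+B(\mathbf u_{\alpha,r},\mathbf u_{\alpha,r})=\mathbf 0,\qquad\mathbf u_{\alpha,r}(0)=\mathbf u^0 .$$ Suppose there exists a finite time $T^{**}>0$ such that $$\sup_{t\in[0,T^{**})}\limsup_{\alpha\to0}\alpha^{2r}\|A^{r/2}\mathbf u_{\alpha,r}(t)\|_{L^2}^2>0 .$$ Then the Euler equations $\partial_t\mathbf u+B(\mathbf u,\mathbf u)=\mathbf 0$ with initial data $\mathbf u(0)=\mathbf u^0$ develop a singularity in the interval $[0,T^{**}]$.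
   Context: All functions are $\mathbb R^3$-valued on the three-dimensional torus $\mathbb T^3=\mathbb R^3/\mathbb Z^3$, divergence-free and mean-free. $H$ (resp. $V^r$) is the closure in $L^2$ (resp. $H^r$) of the smooth divergence-free mean-free fields on $\mathbb T^3$. $P_\sigma:L^2\to H$ is the Leray--Helmholtz projection, $B(\mathbf u,\mathbf v)=P_\sigma((\mathbf u\cdot\nabla)\mathbf v)$, which for $r>\frac56$ extends to a continuous bilinear map $V^r\times V^r\to(V^r)'$, and $A=-P_\sigma\triangle$ is the Stokes operator with domain $H^2(\mathbb T^3)\cap H$. $A$ is positive self-adjoint on $H$ with orthonormal eigenbasis $A\boldsymbol\varphi_k=\lambda_k\boldsymbol\varphi_k$, and $A^s\sum_ku_k\boldsymbol\varphi_k=\sum_k\lambda_k^su_k\boldsymbol\varphi_k$; on divergence-free mean-free fields $\|\mathbf u\|_{H^s}^2$ is equivalent to $\|A^{s/2}\mathbf u\|_{L^2}^2$. A solution of the fractional Euler--Voigt equations on $[0,T]$ is $\mathbf u\in C([0,T],V^r)\cap L^2(0,T;V^{\frac{1+r}2})$ with $\mathbf u(t)+\alpha^{2r}A^r\mathbf u(t)-\mathbf u^0-\alpha^{2r}A^r\mathbf u^0=-\int_0^tB(\mathbf u(\tau),\mathbf u(\tau))\,d\tau$ in $(V^r)'$ for all $t\in[0,T]$; here $\mathbf u_{\alpha,r}$ is the unique such solution, defined for all times. The Euler equations "develop a singularity in $[0,T^{**}]$" means that there is no regular solution on $[0,T^{**}]$, i.e. no solution $\mathbf u\in C([0,T^{**}],H^s)\cap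 C^1([0,T^{**}],H^{s-1})$ with initial data $\mathbf u^0$ (equivalently, by Beale--Kato--Majda, $\|\nabla\times\mathbf u\|_{L^1([0,t];L^\infty)}$ becomes unbounded for $t\in[0,T^{**}]$). *)

theory Defs
  imports "HOL-Analysis.Analysis"
begin

section \<open>Functions on the three-dimensional torus\<close>

text \<open>Functions on the torus are functions on \<open>real^3\<close> that are periodic with respect to the
  integer lattice, with the unit cube as fundamental domain. Elements of \<open>L\<^sup>2\<close> and of Sobolev
  spaces are represented by functions; equality of such elements is equality almost everywhere.\<close>

type_synonym field = "real^3 \<Rightarrow> real^3"

definition lattice_vec :: "int^3 \<Rightarrow> real^3" where
  "lattice_vec k = (\<chi> i. of_int (k $ i))"

definition periodic :: "(real^3 \<Rightarrow> 'b) \<Rightarrow> bool" where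
  "periodic f \<longleftrightarrow> (\<forall>x k. f (x + lattice_vec k) = f x)"

definition torus :: "(real^3) measure" where
  "torus = lebesgue_on (cbox 0 1)"

definition L2 :: "(real^3 \<Rightarrow> 'b::euclidean_space) set" where
  "L2 = {f. periodic f \<and> f \<in> borel_measurable torus \<and> integrable torus (\<lambda>x. (norm (f x))\<^sup>2)}"

definition l2inner :: "field \<Rightarrow> field \<Rightarrow> real" where
  "l2inner f g = (\<integral>x. f x \<bullet> g x \<partial>torus)"

definition l2norm :: "field \<Rightarrow> real" where
  "l2norm f = sqrt (\<integral>x. (norm (f x))\<^sup>2 \<partial>torus)"

definition pd :: "3 \<Rightarrow> (real^3 \<Rightarrow> 'b::euclidean_space) \<Rightarrow> real^3 \<Rightarrow> 'b" where
  "pd i f x = frechet_derivative f (at x) (axis i 1)"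

primrec Ck :: "nat \<Rightarrow> (real^3 \<Rightarrow> 'b::euclidean_space) \<Rightarrow> bool" where
  "Ck 0 f \<longleftrightarrow> continuous_on UNIV f"
| "Ck (Suc n) f \<longleftrightarrow> (\<forall>x. f differentiable (at x)) \<and> (\<forall>i. Ck n (pd i f))"

definition smooth_periodic :: "(real^3 \<Rightarrow> 'b::euclidean_space) \<Rightarrow> bool" where
  "smooth_periodic f \<longleftrightarrow> periodic f \<and> (\<forall>n. Ck n f)"

text \<open>The weak partial derivative, meaningful for \<open>f\<close> in \<open>L2\<close> having a square integrable weak
  derivative; it is then determined up to null sets.\<close>

definition wderiv :: "3 \<Rightarrow> (real^3 \<Rightarrow> 'b::euclidean_space) \<Rightarrow> real^3 \<Rightarrow> 'b" where
  "wderiv i f = (SOME g. g \<in> L2 \<and>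
     (\<forall>\<psi> :: real^3 \<Rightarrow> real. smooth_periodic \<psi> \<longrightarrow>
        (\<integral>x. \<psi> x *\<^sub>R g x \<partial>torus) = - (\<integral>x. pd i \<psi> x *\<^sub>R f x \<partial>torus)))"

definition mean_free :: "field \<Rightarrow> bool" where
  "mean_free f \<longleftrightarrow> (\<integral>x. f x \<partial>torus) = 0"

text \<open>Divergence-free in the sense of distributions.\<close>

definition div_free :: "field \<Rightarrow> bool" where
  "div_free f \<longleftrightarrow> (\<forall>\<psi> :: real^3 \<Rightarrow> real. smooth_periodic \<psi> \<longrightarrow>
      (\<integral>x. (\<Sum>i\<in>UNIV. f x $ i * pd i \<psi> x) \<partial>torus) = 0)"

definition smooth_sol :: "field set" where
  "smooth_sol = {f. smooth_periodic f \<and> (\<forall>x. (\<Sum>i\<in>UNIV. pd i f x $ i) = 0) \<and> mean_free f}"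

section \<open>Sobolev spaces and the spaces \<open>H\<close> and \<open>V\<^sup>r\<close>\<close>

definition fourier :: "field \<Rightarrow> int^3 \<Rightarrow> complex^3" where
  "fourier f k = (\<chi> i. \<integral>x. complex_of_real (f x $ i) * cis (- 2 * pi * (lattice_vec k \<bullet> x)) \<partial>torus)"

text \<open>The usual Bessel potential weight, the symbol of \<open>(I - \<Delta>)\<^sup>s\<close>. Only orders \<open>s \<ge> 0\<close> are used.\<close>

definition sobolev_term :: "real \<Rightarrow> field \<Rightarrow> int^3 \<Rightarrow> real" where
  "sobolev_term s f k = (1 + (2 * pi * norm (lattice_vec k))\<^sup>2) powr s * (norm (fourier f k))\<^sup>2"

definition Sobolev :: "real \<Rightarrow> field set" where
  "Sobolev s = {f. f \<in> L2 \<and> sobolev_term s f summable_on UNIV}"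

definition hsnorm :: "real \<Rightarrow> field \<Rightarrow> real" where
  "hsnorm s f = sqrt (\<Sum>\<^sub>\<infinity>k. sobolev_term s f k)"

definition Hspace :: "field set" where
  "Hspace = {u. u \<in> L2 \<and> (\<forall>e>0. \<exists>\<phi>\<in>smooth_sol. l2norm (\<lambda>x. u x - \<phi> x) < e)}"

definition Vspace :: "real \<Rightarrow> field set" where
  "Vspace r = {u. u \<in> Sobolev r \<and> (\<forall>e>0. \<exists>\<phi>\<in>smooth_sol. hsnorm r (\<lambda>x. u x - \<phi> x) < e)}"

section \<open>Leray projection, convection term and Stokes operator\<close>

text \<open>The orthogonal projection of \<open>L2\<close> onto \<open>Hspace\<close>.\<close>

definition leray :: "field \<Rightarrow> field" where
  "leray f = (SOME h. h \<in> Hspace \<and> (\<forall>w\<in>Hspace. l2inner (\<lambda>x. f x - h x) w = 0))"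

definition convect :: "field \<Rightarrow> field \<Rightarrow> field" where
  "convect u v = leray (\<lambda>x. \<Sum>j\<in>UNIV. (u x $ j) *\<^sub>R wderiv j v x)"

definition laplacian :: "field \<Rightarrow> field" where
  "laplacian u = (\<lambda>x. \<Sum>j\<in>UNIV. wderiv j (wderiv j u) x)"

definition stokes :: "field \<Rightarrow> field" where
  "stokes u = (\<lambda>x. - leray (laplacian u) x)"

definition stokes_eigenbasis :: "(nat \<Rightarrow> field) \<Rightarrow> (nat \<Rightarrow> real) \<Rightarrow> bool" where
  "stokes_eigenbasis \<phi> lam \<longleftrightarrow>
     (\<forall>k. \<phi> k \<in> Sobolev 2 \<inter> Hspace) \<and>
     (\<forall>k. 0 < lam k \<and> (AE x in torus. stokes (\<phi> k) x = lam k *\<^sub>R \<phi> k x)) \<and>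
     (\<forall>j k. l2inner (\<phi> j) (\<phi> k) = (if j = k then 1 else 0)) \<and>
     (\<forall>u\<in>Hspace. (\<lambda>n. l2norm (\<lambda>x. u x - (\<Sum>k<n. l2inner u (\<phi> k) *\<^sub>R \<phi> k x))) \<longlonglongrightarrow> 0)"

text \<open>\<open>A\<^sup>s u\<close> as an element of \<open>Hspace\<close>, the \<open>L2\<close>-sum of \<open>\<lambda>\<^sub>k\<^sup>s u\<^sub>k \<phi>\<^sub>k\<close>.\<close>

definition stokes_pow :: "(nat \<Rightarrow> field) \<Rightarrow> (nat \<Rightarrow> real) \<Rightarrow> real \<Rightarrow> field \<Rightarrow> field" where
  "stokes_pow \<phi> lam s u = (SOME v. v \<in> Hspace \<and>
     (\<lambda>n. l2norm (\<lambda>x. v x - (\<Sum>k<n. (lam k powr s * l2inner u (\<phi> k)) *\<^sub>R \<phi> k x))) \<longlonglongrightarrow> 0)"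

text \<open>For \<open>u\<close> in \<open>V\<^sup>r\<close> the series \<open>A\<^sup>r u = \<Sum>\<^sub>k \<lambda>\<^sub>k\<^sup>r u\<^sub>k \<phi>\<^sub>k\<close> converges in general only in the dual of
  \<open>V\<^sup>r\<close>; this is its value on the test field \<open>w\<close> in \<open>V\<^sup>r\<close>.\<close>

definition stokes_pow_dual ::
  "(nat \<Rightarrow> field) \<Rightarrow> (nat \<Rightarrow> real) \<Rightarrow> real \<Rightarrow> field \<Rightarrow> field \<Rightarrow> real" where
  "stokes_pow_dual \<phi> lam r u w = (\<Sum>k. lam k powr r * l2inner u (\<phi> k) * l2inner (\<phi> k) w)"

definition linear_on_V :: "real \<Rightarrow> (field \<Rightarrow> real) \<Rightarrow> bool" where
  "linear_on_V r l \<longleftrightarrow> (\<forall>u\<in>Vspace r. \<forall>v\<in>Vspace r. \<forall>a c.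
     l (\<lambda>x. a *\<^sub>R u x + c *\<^sub>R v x) = a * l u + c * l v)"

text \<open>\<open>b\<close> is a continuous bilinear map from \<open>V\<^sup>r \<times> V\<^sup>r\<close> to the dual of \<open>V\<^sup>r\<close> (with \<open>b u v w\<close> the
  value of the functional \<open>b u v\<close> at \<open>w\<close>) that coincides with \<open>B\<close> on smooth fields, the pivot
  space being \<open>L2\<close>. For \<open>r > 5/6\<close> there is exactly one such map, by density.\<close>

definition convection_extension :: "real \<Rightarrow> (field \<Rightarrow> field \<Rightarrow> field \<Rightarrow> real) \<Rightarrow> bool" where
  "convection_extension r b \<longleftrightarrow>
     (\<forall>u\<in>Vspace r. \<forall>v\<in>Vspace r. linear_on_V r (b u v)) \<and>
     (\<forall>u\<in>Vspace r. \<forall>w\<in>Vspace r. linear_on_V r (\<lambda>v. b u v w)) \<and>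
     (\<forall>v\<in>Vspace r. \<forall>w\<in>Vspace r. linear_on_V r (\<lambda>u. b u v w)) \<and>
     (\<exists>C. \<forall>u\<in>Vspace r. \<forall>v\<in>Vspace r. \<forall>w\<in>Vspace r.
        \<bar>b u v w\<bar> \<le> C * hsnorm r u * hsnorm r v * hsnorm r w) \<and>
     (\<forall>u\<in>smooth_sol. \<forall>v\<in>smooth_sol. \<forall>w\<in>Vspace r. b u v w = l2inner (convect u v) w)"

section \<open>Time-dependent fields and solutions\<close>

definition continuous_into :: "field set \<Rightarrow> (field \<Rightarrow> real) \<Rightarrow> real \<Rightarrow> (real \<Rightarrow> field) \<Rightarrow> bool" where
  "continuous_into X N T u \<longleftrightarrow> (\<forall>t\<in>{0..T}. u t \<in> X \<and>
     ((\<lambda>\<tau>. N (\<lambda>x. u \<tau> x - u t x)) \<longlongrightarrow> 0) (at t within {0..T}))"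

text \<open>The Bochner space \<open>L\<^sup>2(0,T;V\<^sup>q)\<close>; the second clause is strong measurability.\<close>

definition bochner_L2_V :: "real \<Rightarrow> real \<Rightarrow> (real \<Rightarrow> field) \<Rightarrow> bool" where
  "bochner_L2_V T q u \<longleftrightarrow>
     (AE t in lebesgue_on {0..T}. u t \<in> Vspace q) \<and>
     (\<exists>S :: nat \<Rightarrow> real \<Rightarrow> field.
        (\<forall>n. simple_function (lebesgue_on {0..T}) (S n) \<and> (\<forall>t\<in>{0..T}. S n t \<in> Vspace q)) \<and>
        (AE t in lebesgue_on {0..T}. (\<lambda>n. hsnorm q (\<lambda>x. u t x - S n t x)) \<longlonglongrightarrow> 0)) \<and>
     integrable (lebesgue_on {0..T}) (\<lambda>t. (hsnorm q (u t))\<^sup>2)"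

text \<open>The equation holds in the dual of \<open>V\<^sup>r\<close>, i.e. tested with every \<open>w\<close> in \<open>V\<^sup>r\<close>. The integrand
  \<open>B(u,u)\<close> is continuous in time with values in that dual, so the value of its integral at \<open>w\<close> is
  the integral of its values at \<open>w\<close>.\<close>

definition euler_voigt_solution ::
  "(nat \<Rightarrow> field) \<Rightarrow> (nat \<Rightarrow> real) \<Rightarrow> real \<Rightarrow> real \<Rightarrow> field \<Rightarrow> real \<Rightarrow> (real \<Rightarrow> field) \<Rightarrow> bool" where
  "euler_voigt_solution \<phi> lam \<alpha> r u0 T u \<longleftrightarrow>
     continuous_into (Vspace r) (hsnorm r) T u \<and>
     bochner_L2_V T ((1 + r) / 2) u \<and>
     (\<exists>b. convection_extension r b \<and>
       (\<forall>t\<in>{0..T}. \<forall>w\<in>Vspace r.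
          l2inner (u t) w + \<alpha> powr (2 * r) * stokes_pow_dual \<phi> lam r (u t) w
          - l2inner u0 w - \<alpha> powr (2 * r) * stokes_pow_dual \<phi> lam r u0 w
          = - integral {0..t} (\<lambda>\<tau>. b (u \<tau>) (u \<tau>) w)))"

definition Sobolev_sol :: "real \<Rightarrow> field set" where
  "Sobolev_sol s = {u \<in> Sobolev s. div_free u \<and> mean_free u}"

definition euler_regular_solution :: "real \<Rightarrow> field \<Rightarrow> real \<Rightarrow> (real \<Rightarrow> field) \<Rightarrow> bool" where
  "euler_regular_solution s u0 T u \<longleftrightarrow>
     continuous_into (Sobolev_sol s) (hsnorm s) T u \<and>
     (\<exists>u'. continuous_into (Sobolev_sol (s - 1)) (hsnorm (s - 1)) T u' \<and>
        (\<forall>t\<in>{0..T}.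
           ((\<lambda>\<tau>. hsnorm (s - 1) (\<lambda>x. (1 / (\<tau> - t)) *\<^sub>R (u \<tau> x - u t x) - u' t x)) \<longlongrightarrow> 0)
             (at t within {0..T})) \<and>
        (\<forall>t\<in>{0..T}. AE x in torus. u' t x + convect (u t) (u t) x = 0)) \<and>
     (AE x in torus. u 0 x = u0 x)"

definition euler_develops_singularity :: "real \<Rightarrow> field \<Rightarrow> real \<Rightarrow> bool" where
  "euler_develops_singularity s u0 T \<longleftrightarrow> \<not> (\<exists>u. euler_regular_solution s u0 T u)"

end

(* Let v be a regular Euler solution, u the Voigt solution, a = alpha^(2r) and Q(f,g) = <A^r f, g>.
   The relative energy D = |u - v|^2 + a Q(u,u) differs by 2 a Q(u,v) from
   F = L(u,u) + |v|^2 - 2 L(u,v), where L = <.,.> + a Q is conserved along u and |v|^2 is conserved.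
   Testing the Voigt equation with v and the Euler equation with u leaves
   F' = -2 b(u - v, v, u - v) - 2 a Q(u, v'), and since |b(w, v, w)| is bounded by |w|^2 times the
   sup norm of the gradient of v, Young and Gronwall give D <= C a with C independent of alpha.
   Hence a |A^(r/2) u|^2 -> 0 on the whole interval, contradicting the hypothesis.

   Everything linear is read off Fourier coefficients: L2 fields are determined by them
   (Stone-Weierstrass on the three-fold product of circles), and an eigenfield of the Stokes operator
   only has frequencies k with |2 pi k|^2 equal to its eigenvalue, so that powers of A are Fourier
   multipliers whatever eigenbasis is given. *)

theory Submission
  imports Defs
begin

subsection \<open>Integration by parts on the torus\<close>

text \<open>A Voigt solution is only continuous into V^r and is known through its equation tested
  with one fixed field, so \<open>u\<close> has no time derivative that could be paired with
  anything; only the scalar functions t -> L(u t, w) have one. This is also why the estimate runs on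
  F rather than on D: Q(u, v) without its L2 companion has no derivative at hand, and the missing 2
  a Q(u, v) is absorbed at each time by Young's inequality. The form b is given only abstractly, as
  a continuous extension from smooth fields, and existentially for each alpha. Its cancellations and
  the stretching bound are therefore proved for Fourier truncations, where b is an explicit
  integral, and carried to the limit in the V^r norm; the resulting constants depend on the Euler
  solution, not on b or alpha.\<close>

lemma space_torus [simp]: "space torus = cbox 0 1"
  by (simp add: torus_def)

lemma measure_torus [simp]: "measure torus (cbox 0 1) = 1"
proof -
  have "measure lborel (cbox 0 (1::real^3)) = 1"
    by (simp add: content_cbox_if_cart interval_eq_empty_cart)
  then show ?thesis
    by (simp add: torus_def measure_restrict_space)
qed

lemma emeasure_torus_finite: "emeasure torus (space torus) \<noteq> \<infinity>"
  using emeasure_lborel_cbox_finite[of 0 "1 :: real^3"]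
  by (simp add: torus_def emeasure_restrict_space)

interpretation torus: finite_measure torus
  by standard (rule emeasure_torus_finite)

lemma continuous_integrable_torus:
  fixes f :: "real^3 \<Rightarrow> 'b::euclidean_space"
  shows "continuous_on UNIV f \<Longrightarrow> integrable torus f"
  unfolding torus_def by (rule continuous_imp_integrable) (auto intro: continuous_on_subset)

lemma torus_integral_eq:
  fixes f :: "real^3 \<Rightarrow> 'b::euclidean_space"
  shows "integrable torus f \<Longrightarrow> (\<integral>x. f x \<partial>torus) = integral (cbox 0 1) f"
  unfolding torus_def by (rule lebesgue_integral_eq_integral) auto

lemma periodic_axis:
  fixes f :: "real^3 \<Rightarrow> 'b" and i :: 3
  assumes "periodic f"
  shows "f (x + axis i 1) = f x"
proof -
  have "lattice_vec (axis i 1) = axis i 1"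
    by (auto simp: lattice_vec_def axis_def vec_eq_iff)
  then show ?thesis
    using assms unfolding periodic_def by metis
qed

text \<open>Slabs stretched along one axis; special values of a and b describe all pieces that arise
  when a translated unit cube is cut by a coordinate plane.\<close>

lemma mem_cbox_axis:
  fixes y :: "real^3" and i :: 3
  shows "y \<in> cbox (a *\<^sub>R axis i 1) (1 + b *\<^sub>R axis i 1) \<longleftrightarrow>
    a \<le> y $ i \<and> y $ i \<le> 1 + b \<and> (\<forall>j. j \<noteq> i \<longrightarrow> 0 \<le> y $ j \<and> y $ j \<le> 1)"
  (is "?l \<longleftrightarrow> ?r")
proof -
  have "?l \<longleftrightarrow> (\<forall>j. a * (if j = i then 1 else 0) \<le> y $ j \<and> y $ j \<le> 1 + b * (if j = i then 1 else 0))"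
    by (auto simp: mem_box_cart axis_def)
  also have "\<dots> \<longleftrightarrow> (\<forall>j. if j = i then a \<le> y $ j \<and> y $ j \<le> 1 + b else 0 \<le> y $ j \<and> y $ j \<le> 1)"
    by (intro arg_cong[where f = All] ext) simp
  also have "\<dots> \<longleftrightarrow> ?r"
    by auto
  finally show ?thesis .
qed

text \<open>The shifted cube is cut at x_i = 1 and the protruding slab is moved back by one period;
  the two pieces are those of the unit cube cut at x_i = h. For h in [0, 1] a single cut is
  enough.\<close>

lemma torus_integral_shift:
  fixes f :: "real^3 \<Rightarrow> 'b::euclidean_space" and i :: 3
  assumes per: "periodic f" and cont: "continuous_on UNIV f" and h: "0 \<le> h" "h \<le> 1"
  shows "(\<integral>x. f (x + h *\<^sub>R axis i 1) \<partial>torus) = (\<integral>x. f x \<partial>torus)"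
proof -
  let ?e = "axis i 1 :: real^3"
  have contS: "continuous_on S f" for S
    using cont by (rule continuous_on_subset) auto
  have int: "f integrable_on cbox a b" for a b
    by (intro integrable_continuous contS)
  have eB: "?e \<in> Basis" by (simp add: axis_in_Basis_iff)
  have ax: "x \<bullet> ?e = x $ i" for x :: "real^3"
    by (simp add: inner_axis)
  have c2: "continuous_on UNIV (\<lambda>x. f (x + h *\<^sub>R ?e))"
    by (rule continuous_on_compose2[OF cont]) (auto intro!: continuous_intros)
  note mem = mem_cbox_axis[of _ 0 i "h - 1"] mem_cbox_axis[of _ h i 0] mem_cbox_axis[of _ h i h]
    mem_cbox_axis[of _ 1 i h] mem_cbox_axis[of _ 0 i 0]
  have "(\<integral>x. f (x + h *\<^sub>R ?e) \<partial>torus) = integral (cbox 0 1) (\<lambda>x. f (x + h *\<^sub>R ?e))"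
    by (intro torus_integral_eq continuous_integrable_torus c2)
  also have "\<dots> = integral (cbox (h *\<^sub>R ?e) (1 + h *\<^sub>R ?e)) f"
    using integral_shift_cbox[of "h *\<^sub>R ?e" "h *\<^sub>R ?e" "1 + h *\<^sub>R ?e" f] by simp
  also have "\<dots> = integral (cbox (h *\<^sub>R ?e) (1 + h *\<^sub>R ?e) \<inter> {x. x \<bullet> ?e \<le> 1}) f
      + integral (cbox (h *\<^sub>R ?e) (1 + h *\<^sub>R ?e) \<inter> {x. x \<bullet> ?e \<ge> 1}) f"
    by (rule integral_split[OF int eB])
  also have "cbox (h *\<^sub>R ?e) (1 + h *\<^sub>R ?e) \<inter> {x. x \<bullet> ?e \<le> 1} = cbox (h *\<^sub>R ?e) (1 + 0 *\<^sub>R ?e)"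
    using h by (intro set_eqI, simp only: ax Int_iff mem_Collect_eq mem) auto
  also have "cbox (h *\<^sub>R ?e) (1 + h *\<^sub>R ?e) \<inter> {x. x \<bullet> ?e \<ge> 1} = cbox (1 *\<^sub>R ?e) (1 + h *\<^sub>R ?e)"
    using h by (intro set_eqI, simp only: ax Int_iff mem_Collect_eq mem) auto
  also have "integral (cbox (1 *\<^sub>R ?e) (1 + h *\<^sub>R ?e)) f = integral (cbox (0 *\<^sub>R ?e) (1 + (h - 1) *\<^sub>R ?e)) f"
    using integral_shift_cbox[of ?e ?e "1 + h *\<^sub>R ?e" f] periodic_axis[OF per]
    by (simp add: scaleR_diff_left algebra_simps)
  finally have 1: "(\<integral>x. f (x + h *\<^sub>R ?e) \<partial>torus) = integral (cbox (h *\<^sub>R ?e) (1 + 0 *\<^sub>R ?e)) f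
      + integral (cbox (0 *\<^sub>R ?e) (1 + (h - 1) *\<^sub>R ?e)) f" .
  have "(\<integral>x. f x \<partial>torus) = integral (cbox (0 *\<^sub>R ?e) (1 + 0 *\<^sub>R ?e)) f"
    by (simp add: torus_integral_eq continuous_integrable_torus cont)
  also have "\<dots> = integral (cbox (0 *\<^sub>R ?e) (1 + 0 *\<^sub>R ?e) \<inter> {x. x \<bullet> ?e \<le> h}) f
      + integral (cbox (0 *\<^sub>R ?e) (1 + 0 *\<^sub>R ?e) \<inter> {x. x \<bullet> ?e \<ge> h}) f"
    by (rule integral_split[OF int eB])
  finally have 2: "(\<integral>x. f x \<partial>torus) = \<dots>" .
  have 3: "cbox (0 *\<^sub>R ?e) (1 + 0 *\<^sub>R ?e) \<inter> {x. x \<bullet> ?e \<le> h} = cbox (0 *\<^sub>R ?e) (1 + (h - 1) *\<^sub>R ?e)"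
    using h by (intro set_eqI, simp only: ax Int_iff mem_Collect_eq mem) auto
  have 4: "cbox (0 *\<^sub>R ?e) (1 + 0 *\<^sub>R ?e) \<inter> {x. x \<bullet> ?e \<ge> h} = cbox (h *\<^sub>R ?e) (1 + 0 *\<^sub>R ?e)"
    using h by (intro set_eqI, simp only: ax Int_iff mem_Collect_eq mem) auto
  show ?thesis
    by (rule trans[OF 1 trans[OF _ 2[symmetric]]], subst 3, subst 4, rule add.commute)
qed

lemma pd_eqI: "(f has_derivative f') (at x) \<Longrightarrow> pd i f x = f' (axis i 1)"
  unfolding pd_def by (rule fun_cong[OF frechet_derivative_at[symmetric]])

lemma pd_line_deriv:
  fixes f :: "real^3 \<Rightarrow> real"
  assumes "f differentiable (at (x + t *\<^sub>R axis i 1))"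
  shows "((\<lambda>t. f (x + t *\<^sub>R axis i 1)) has_real_derivative pd i f (x + t *\<^sub>R axis i 1)) (at t)"
proof -
  let ?e = "axis i 1 :: real^3"
  let ?D = "frechet_derivative f (at (x + t *\<^sub>R ?e))"
  have D: "(f has_derivative ?D) (at (x + t *\<^sub>R ?e))"
    using assms by (simp add: frechet_derivative_works)
  have "((\<lambda>t. f (x + t *\<^sub>R ?e)) has_derivative (\<lambda>s. ?D (s *\<^sub>R ?e))) (at t)"
    by (rule has_derivative_compose[where f = "\<lambda>t. x + t *\<^sub>R ?e" and g = f and g' = ?D])
      (use D in \<open>auto intro!: derivative_eq_intros\<close>)
  moreover have "(\<lambda>s. ?D (s *\<^sub>R ?e)) = (*) (pd i f (x + t *\<^sub>R ?e))"
    using linear_scale[OF has_derivative_linear[OF D]] by (auto simp: pd_def fun_eq_iff)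
  ultimately show ?thesis
    by (simp add: has_field_derivative_def)
qed

text \<open>Difference quotients along the axis integrate to 0 by translation invariance, and they
  converge boundedly to the derivative.\<close>

lemma torus_integral_pd:
  fixes f :: "real^3 \<Rightarrow> real"
  assumes per: "periodic f" and diff: "\<And>x. f differentiable (at x)"
    and cont: "continuous_on UNIV (pd i f)"
  shows "(\<integral>x. pd i f x \<partial>torus) = 0"
proof -
  let ?e = "axis i 1 :: real^3"
  define h where "h n = 1 / real (Suc n)" for n
  have h: "0 < h n" "h n \<le> 1" for n by (auto simp: h_def)
  define q where "q n x = (f (x + h n *\<^sub>R ?e) - f x) / h n" for n x
  have cf: "continuous_on UNIV f"
    using diff by (auto intro!: continuous_at_imp_continuous_on differentiable_imp_continuous_within)
  have cs: "continuous_on UNIV (\<lambda>x. f (x + t *\<^sub>R ?e))" for t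
    by (rule continuous_on_compose2[OF cf]) (auto intro!: continuous_intros)
  have cq: "continuous_on UNIV (q n)" for n
    unfolding q_def using h[of n] by (auto intro!: continuous_intros cs cf)
  have int0: "(\<integral>x. q n x \<partial>torus) = 0" for n
    unfolding q_def using torus_integral_shift[OF per cf, of "h n" i] h[of n]
    by (simp add: continuous_integrable_torus cs cf less_imp_le)
  \<comment> \<open>The intermediate point of the mean value theorem may leave the unit cube in
    direction i, so the bound is taken on a box that is one unit longer.\<close>
  have "bounded (pd i f ` cbox 0 (1 + ?e))"
    by (intro compact_imp_bounded compact_continuous_image)
      (auto intro: continuous_on_subset[OF cont])
  then obtain M where M: "\<And>x. x \<in> cbox 0 (1 + ?e) \<Longrightarrow> \<bar>pd i f x\<bar> \<le> M"
    unfolding bounded_iff by auto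
  have bound: "\<bar>q n x\<bar> \<le> M" if x: "x \<in> cbox 0 1" for n x
  proof -
    obtain z where z: "0 < z" "z < h n"
      "f (x + h n *\<^sub>R ?e) - f (x + 0 *\<^sub>R ?e) = (h n - 0) * pd i f (x + z *\<^sub>R ?e)"
      using MVT2[of 0 "h n" "\<lambda>t. f (x + t *\<^sub>R ?e)" "\<lambda>t. pd i f (x + t *\<^sub>R ?e)"]
        pd_line_deriv diff h[of n] by blast
    have "x + z *\<^sub>R ?e \<in> cbox 0 (1 + ?e)"
      using x z(1) less_le_trans[OF z(2) h(2)[of n]] mem_cbox_axis[of _ 0 i 1] mem_cbox_axis[of _ 0 i 0]
      by (auto simp: add_mono axis_def)
    then show ?thesis
      using z(3) h(1)[of n] M unfolding q_def by simp
  qed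
  have lim: "(\<lambda>n. q n x) \<longlonglongrightarrow> pd i f x" for x
  proof -
    have d: "((\<lambda>t. (f (x + (0 + t) *\<^sub>R ?e) - f (x + 0 *\<^sub>R ?e)) / t) \<longlongrightarrow> pd i f (x + 0 *\<^sub>R ?e)) (at 0)"
      using pd_line_deriv[of f x 0 i] diff unfolding DERIV_def by blast
    have "filterlim h (at 0) sequentially"
      unfolding filterlim_at h_def using LIMSEQ_Suc[OF lim_1_over_n[where 'a = real]]
      by auto
    from filterlim_compose[OF d this] show ?thesis
      by (simp add: q_def)
  qed
  have "(\<lambda>n. \<integral>x. q n x \<partial>torus) \<longlonglongrightarrow> (\<integral>x. pd i f x \<partial>torus)"
  proof (rule integral_dominated_convergence[where w = "\<lambda>_. M"])
    show "pd i f \<in> borel_measurable torus"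
      using continuous_integrable_torus[OF cont] by auto
    show "q n \<in> borel_measurable torus" for n
      using continuous_integrable_torus[OF cq] by auto
  qed (use bound lim in \<open>auto intro!: AE_I2\<close>)
  then show ?thesis
    using int0 by (simp add: LIMSEQ_const_iff)
qed

lemma pd_mult:
  fixes f g :: "real^3 \<Rightarrow> real"
  assumes "f differentiable (at x)" "g differentiable (at x)"
  shows "pd i (\<lambda>x. f x * g x) x = f x * pd i g x + pd i f x * g x"
proof -
  have "((\<lambda>x. f x * g x) has_derivative (\<lambda>h. f x * frechet_derivative g (at x) h
      + frechet_derivative f (at x) h * g x)) (at x)"
    using assms by (intro has_derivative_mult) (simp_all add: frechet_derivative_works[symmetric])
  then show ?thesis
    by (simp add: pd_eqI pd_def[of i f] pd_def[of i g])
qed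

lemma Ck_Suc_imp_continuous:
  assumes "Ck (Suc n) f"
  shows "continuous_on UNIV f"
proof -
  have "f differentiable (at x)" for x
    using assms by simp
  then show ?thesis
    by (intro continuous_at_imp_continuous_on ballI differentiable_imp_continuous_within)
qed

lemma Ck_1D:
  assumes "Ck 1 f"
  shows "f differentiable (at x)" "continuous_on UNIV (pd i f)" "continuous_on UNIV f"
  using assms Ck_Suc_imp_continuous[of 0 f] by simp_all

lemma Ck_1_mult:
  fixes f g :: "real^3 \<Rightarrow> real"
  assumes "Ck 1 f" "Ck 1 g"
  shows "Ck 1 (\<lambda>x. f x * g x)"
proof -
  have "pd i (\<lambda>x. f x * g x) = (\<lambda>x. f x * pd i g x + pd i f x * g x)" for i
    by (rule ext, rule pd_mult; rule Ck_1D; fact)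
  moreover have "(\<lambda>x. f x * g x) differentiable (at x)" for x
    using assms by (intro differentiable_mult Ck_1D)
  ultimately show ?thesis
    by (simp only: One_nat_def Ck.simps simp_thms)
      (intro conjI allI continuous_on_add continuous_on_mult Ck_1D assms)
qed

lemma periodic_mult: "periodic f \<Longrightarrow> periodic g \<Longrightarrow> periodic (\<lambda>x. f x * g x)"
  by (simp add: periodic_def)

lemma torus_integral_by_parts:
  fixes f g :: "real^3 \<Rightarrow> real"
  assumes "periodic f" "periodic g" "Ck 1 f" "Ck 1 g"
  shows "(\<integral>x. f x * pd i g x \<partial>torus) = - (\<integral>x. pd i f x * g x \<partial>torus)"
proof -
  have "(\<integral>x. pd i (\<lambda>x. f x * g x) x \<partial>torus) = 0"
    using Ck_1_mult[OF assms(3,4)] by (intro torus_integral_pd periodic_mult assms Ck_1D)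
  moreover have "(\<integral>x. pd i (\<lambda>x. f x * g x) x \<partial>torus)
      = (\<integral>x. f x * pd i g x \<partial>torus) + (\<integral>x. pd i f x * g x \<partial>torus)"
  proof -
    have "integrable torus (\<lambda>x. f x * pd i g x)" "integrable torus (\<lambda>x. pd i f x * g x)"
      by (intro continuous_integrable_torus continuous_on_mult Ck_1D assms)+
    then show ?thesis
      by (simp only: pd_mult[OF Ck_1D(1)[OF assms(3)] Ck_1D(1)[OF assms(4)]] Bochner_Integration.integral_add)
  qed
  ultimately show ?thesis by simp
qed

subsection \<open>Exponentials\<close>

definition expo :: "int^3 \<Rightarrow> real^3 \<Rightarrow> complex" where
  "expo k x = cis (2 * pi * (lattice_vec k \<bullet> x))"

lemma lattice_vec_simps [simp]:
  "lattice_vec 0 = 0" "lattice_vec (a + b) = lattice_vec a + lattice_vec b"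
  "lattice_vec (- a) = - lattice_vec a" "lattice_vec (a - b) = lattice_vec a - lattice_vec b"
  by (auto simp: lattice_vec_def vec_eq_iff)

lemma lattice_vec_nth [simp]: "lattice_vec k $ i = of_int (k $ i)"
  by (simp add: lattice_vec_def)

lemma norm_expo [simp]: "norm (expo k x) = 1"
  by (simp add: expo_def)

lemma expo_0 [simp]: "expo 0 x = 1"
  by (simp add: expo_def)

lemma expo_add: "expo (j + k) x = expo j x * expo k x"
  by (simp add: expo_def cis_mult algebra_simps inner_add_left)

lemma expo_minus: "expo (- k) x = cnj (expo k x)"
  by (simp add: expo_def cis_cnj)

lemma expo_diff: "expo (j - k) x = expo j x * cnj (expo k x)"
  using expo_add[of j "- k" x] by (simp add: expo_minus)

lemma periodic_expo: "periodic (expo k)"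
proof -
  have "expo k (x + lattice_vec m) = expo k x" for x m
  proof -
    have "lattice_vec k \<bullet> lattice_vec m = real_of_int (\<Sum>i\<in>UNIV. k $ i * m $ i)"
      by (simp add: inner_vec_def)
    then have "expo k (x + lattice_vec m) = expo k x * cis (2 * pi * real_of_int (\<Sum>i\<in>UNIV. k $ i * m $ i))"
      by (simp add: expo_def cis_mult inner_add_right algebra_simps)
    also have "cis (2 * pi * real_of_int (\<Sum>i\<in>UNIV. k $ i * m $ i)) = 1"
      by (rule cis_multiple_2pi) (rule Ints_of_int)
    finally show ?thesis by simp
  qed
  then show ?thesis by (simp add: periodic_def)
qed

lemma continuous_expo [continuous_intros]: "continuous_on S (expo k)"
  unfolding expo_def by (intro continuous_intros)

lemma expo_measurable [measurable]: "expo k \<in> borel_measurable torus"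
  using continuous_integrable_torus[OF continuous_expo] by auto

text \<open>A half-period shift in a coordinate where k is nonzero changes the sign of the
  exponential but not its integral.\<close>

lemma expo_integral: "(\<integral>x. expo k x \<partial>torus) = (if k = 0 then 1 else 0)"
proof (cases "k = 0")
  case False
  then obtain i where i: "k $ i \<noteq> 0" by (auto simp: vec_eq_iff)
  \<comment> \<open>This sign makes the half period a shift in [0, 1], as
    \<open>torus_integral_shift\<close> requires; the other sign follows by conjugation.\<close>
  define m where "m = (if k $ i > 0 then k else - k)"
  have m: "m $ i > 0" using i by (auto simp: m_def)
  let ?h = "1 / (2 * real_of_int (m $ i))"
  have "expo m (x + ?h *\<^sub>R axis i 1) = - expo m x" for x
  proof -
    have "lattice_vec m \<bullet> (?h *\<^sub>R axis i 1) = 1/2"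
      using m by (simp add: inner_axis)
    then have "2 * pi * (lattice_vec m \<bullet> (x + ?h *\<^sub>R axis i 1)) = 2 * pi * (lattice_vec m \<bullet> x) + pi"
      by (simp only: inner_add_right) (simp add: algebra_simps)
    then have "expo m (x + ?h *\<^sub>R axis i 1) = cis (2 * pi * (lattice_vec m \<bullet> x)) * cis pi"
      by (simp only: expo_def cis_mult)
    then show ?thesis by (simp add: expo_def)
  qed
  moreover have "(\<integral>x. expo m (x + ?h *\<^sub>R axis i 1) \<partial>torus) = (\<integral>x. expo m x \<partial>torus)"
    using m by (intro torus_integral_shift periodic_expo continuous_expo) auto
  ultimately have m0: "(\<integral>x. expo m x \<partial>torus) = 0"
    by simp
  have "(\<integral>x. expo (- m) x \<partial>torus) = cnj (\<integral>x. expo m x \<partial>torus)"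
    by (simp add: expo_minus)
  with m0 show ?thesis
    using False by (auto simp: m_def split: if_splits)
qed simp

subsection \<open>Uniqueness of Fourier coefficients\<close>

lemma integrable_mult_expo:
  fixes h :: "real^3 \<Rightarrow> real"
  assumes "integrable torus h"
  shows "integrable torus (\<lambda>x. complex_of_real (h x) * expo k x)"
proof (rule Bochner_Integration.integrable_bound[OF assms])
  have [measurable]: "h \<in> borel_measurable torus" using assms by auto
  show "(\<lambda>x. complex_of_real (h x) * expo k x) \<in> borel_measurable torus" by measurable
qed (simp add: norm_mult)

text \<open>On the cube itself exponentials do not separate opposite faces. Through this map they
  become polynomials on a compact set whose points are separated by coordinates, where
  Stone-Weierstrass applies.\<close>

definition circles :: "real^3 \<Rightarrow> complex^3" where
  "circles x = (\<chi> i. cis (2 * pi * x $ i))"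

lemma circles_nth: "circles x $ i = expo (axis i 1) x"
proof -
  have "lattice_vec (axis i 1) = axis i 1"
    by (auto simp: lattice_vec_def axis_def vec_eq_iff)
  then show ?thesis
    by (simp add: circles_def expo_def inner_axis')
qed

lemma continuous_circles: "continuous_on S circles"
  unfolding circles_def by (intro continuous_intros)

lemma inj_on_circles: "inj_on circles (box 0 1)"
proof (rule inj_onI)
  fix x y :: "real^3" assume xy: "x \<in> box 0 1" "y \<in> box 0 1" "circles x = circles y"
  show "x = y"
  proof (rule vec_eq_iff[THEN iffD2], intro allI)
    fix i
    have "cis (2 * pi * x $ i) = cis (2 * pi * y $ i)"
      using xy(3) by (simp add: circles_def vec_eq_iff)
    then have "cis (2 * pi * x $ i) * cis (- (2 * pi * y $ i)) = 1"
      by (simp add: cis_mult)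
    then have "cos (2 * pi * (x $ i - y $ i)) = 1"
      by (simp add: cis_mult complex_eq_iff algebra_simps)
    then obtain n :: int where "2 * pi * (x $ i - y $ i) = real_of_int n * 2 * pi"
      unfolding cos_one_2pi_int by blast
    then have n: "x $ i - y $ i = n"
      by simp
    moreover have "\<bar>x $ i - y $ i\<bar> < 1"
      using xy(1,2) unfolding mem_box_cart zero_index one_index by (smt (verit, best))
    ultimately have "n = 0"
      by linarith
    then show "x $ i = y $ i" using n by simp
  qed
qed

text \<open>Real polynomials in the real and imaginary parts of the coordinates, since the form of
  Stone-Weierstrass used here concerns real-valued functions.\<close>

inductive_set circle_polys :: "(complex^3 \<Rightarrow> real) set" where
  const: "(\<lambda>z. c) \<in> circle_polys"
| re: "(\<lambda>z. Re (z $ i)) \<in> circle_polys"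
| im: "(\<lambda>z. Im (z $ i)) \<in> circle_polys"
| add: "p \<in> circle_polys \<Longrightarrow> q \<in> circle_polys \<Longrightarrow> (\<lambda>z. p z + q z) \<in> circle_polys"
| mult: "p \<in> circle_polys \<Longrightarrow> q \<in> circle_polys \<Longrightarrow> (\<lambda>z. p z * q z) \<in> circle_polys"

lemma continuous_circle_polys: "p \<in> circle_polys \<Longrightarrow> continuous_on S p"
  by (induction rule: circle_polys.induct) (auto intro!: continuous_intros)

text \<open>Vanishing of all Fourier coefficients, stated for integrable scalar functions so that
  the class is stable under multiplication by bounded factors.\<close>

definition annihilates_expo :: "(real^3 \<Rightarrow> real) \<Rightarrow> bool" where
  "annihilates_expo h \<longleftrightarrow> integrable torus h \<and> (\<forall>k. (\<integral>x. complex_of_real (h x) * expo k x \<partial>torus) = 0)"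

text \<open>The hypothesis \<open>eq\<close> is the shape of multiplication by a cosine or sine: it
  shifts the frequency by m and by -m.\<close>

lemma annihilates_expo_linear_comb:
  assumes f: "annihilates_expo h" and g: "integrable torus g"
    and eq: "\<And>k x. complex_of_real (g x) * expo k x
      = a * (complex_of_real (h x) * expo (k + m) x) + b * (complex_of_real (h x) * expo (k - m) x)"
  shows "annihilates_expo g"
proof -
  have i: "integrable torus (\<lambda>x. complex_of_real (h x) * expo k x)" for k
    using f by (intro integrable_mult_expo) (simp add: annihilates_expo_def)
  have z: "(\<integral>x. complex_of_real (h x) * expo k x \<partial>torus) = 0" for k
    using f by (simp add: annihilates_expo_def)
  have "(\<integral>x. complex_of_real (g x) * expo k x \<partial>torus) = 0" for k
    unfolding eq by (subst Bochner_Integration.integral_add) (auto simp: z intro!: i)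
  then show ?thesis using g by (simp add: annihilates_expo_def)
qed

text \<open>For the coordinate functions Euler's formulas supply the coefficients 1/2, 1/2 and -i/2,
  i/2. In the product case the hypothesis for q is applied to h times p, which is why
  \<open>h\<close> is arbitrary in the induction.\<close>

lemma annihilates_expo_mult:
  assumes "p \<in> circle_polys" "annihilates_expo h"
  shows "annihilates_expo (\<lambda>x. h x * p (circles x))"
  using assms
proof (induction arbitrary: h rule: circle_polys.induct)
  case (const c)
  then show ?case
    by (rule_tac annihilates_expo_linear_comb[of h _ "of_real c" 0 0])
      (auto simp: annihilates_expo_def)
next
  case (re i)
  then have [measurable]: "h \<in> borel_measurable torus" and h: "integrable torus h"
    by (auto simp: annihilates_expo_def)
  have "integrable torus (\<lambda>x. h x * Re (circles x $ i))"
  proof (rule Bochner_Integration.integrable_bound[OF h])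
    have "\<bar>Re (expo (axis i 1) x)\<bar> \<le> 1" for x
      using abs_Re_le_cmod[of "expo (axis i 1) x"] by simp
    then show "AE x in torus. norm (h x * Re (circles x $ i)) \<le> norm (h x)"
      by (auto simp: circles_nth abs_mult intro!: mult_left_le)
  qed (simp add: circles_nth)
  then show ?case
    using re by (rule_tac annihilates_expo_linear_comb[of h _ "1/2" "axis i 1" "1/2"])
      (auto simp: circles_nth expo_add expo_diff complex_eq_iff algebra_simps add_divide_distrib diff_divide_distrib)
next
  case (im i)
  then have [measurable]: "h \<in> borel_measurable torus" and h: "integrable torus h"
    by (auto simp: annihilates_expo_def)
  have "integrable torus (\<lambda>x. h x * Im (circles x $ i))"
  proof (rule Bochner_Integration.integrable_bound[OF h])
    have "\<bar>Im (expo (axis i 1) x)\<bar> \<le> 1" for x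
      using abs_Im_le_cmod[of "expo (axis i 1) x"] by simp
    then show "AE x in torus. norm (h x * Im (circles x $ i)) \<le> norm (h x)"
      by (auto simp: circles_nth abs_mult intro!: mult_left_le)
  qed (simp add: circles_nth)
  then show ?case
    using im by (rule_tac annihilates_expo_linear_comb[of h _ "- \<i>/2" "axis i 1" "\<i>/2"])
      (auto simp: circles_nth expo_add expo_diff complex_eq_iff algebra_simps add_divide_distrib diff_divide_distrib)
next
  case (add p q)
  have "annihilates_expo (\<lambda>x. h x * p (circles x))" "annihilates_expo (\<lambda>x. h x * q (circles x))"
    using add by auto
  then show ?case
    by (auto simp: annihilates_expo_def distrib_left distrib_right integrable_mult_expo simp del: of_real_mult)
next
  case (mult p q)
  show ?case
    using mult.IH(2)[OF mult.IH(1)[OF mult.prems]] by (simp add: mult.assoc)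
qed

text \<open>Replacing G by a polynomial that is uniformly e-close on the image of the cube costs at
  most e times the L1 norm of h, and the polynomial contributes nothing.\<close>

lemma annihilates_expo_continuous:
  assumes h: "annihilates_expo h" and G: "continuous_on UNIV G"
  shows "(\<integral>x. h x * G (circles x) \<partial>torus) = 0"
proof -
  define K where "K = circles ` cbox 0 1"
  interpret PR: function_ring_on circle_polys K
  proof
    show "compact K"
      unfolding K_def by (intro compact_continuous_image continuous_circles) auto
    fix x y :: "complex^3" assume "x \<in> K" "y \<in> K" "x \<noteq> y"
    then obtain i where "x $ i \<noteq> y $ i" by (auto simp: vec_eq_iff)
    then have "Re (x $ i) \<noteq> Re (y $ i) \<or> Im (x $ i) \<noteq> Im (y $ i)"
      by (simp add: complex_eq_iff)
    then show "\<exists>f\<in>circle_polys. f x \<noteq> f y"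
    proof
      assume "Re (x $ i) \<noteq> Re (y $ i)"
      then show ?thesis by (rule bexI[OF _ circle_polys.re])
    next
      assume "Im (x $ i) \<noteq> Im (y $ i)"
      then show ?thesis by (rule bexI[OF _ circle_polys.im])
    qed
  qed (erule continuous_circle_polys, erule (1) circle_polys.add, erule (1) circle_polys.mult,
      rule circle_polys.const)
  have hi: "integrable torus h" and [measurable]: "h \<in> borel_measurable torus"
    using h by (auto simp: annihilates_expo_def)
  have cont: "continuous_on UNIV (\<lambda>x. g (circles x))" if "continuous_on UNIV g" for g :: "complex^3 \<Rightarrow> real"
    by (rule continuous_on_compose2[OF that continuous_circles]) auto
  have meas: "(\<lambda>x. g (circles x)) \<in> borel_measurable torus" if "continuous_on UNIV g" for g :: "complex^3 \<Rightarrow> real"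
    using continuous_integrable_torus[OF cont[OF that]] by auto
  have ih: "integrable torus (\<lambda>x. h x * g (circles x))" if g: "continuous_on UNIV g" for g :: "complex^3 \<Rightarrow> real"
  proof -
    have "compact (g ` K)"
      by (intro compact_continuous_image PR.compact continuous_on_subset[OF g]) auto
    then obtain B where B: "\<And>z. z \<in> K \<Longrightarrow> \<bar>g z\<bar> \<le> B"
      unfolding bounded_iff using compact_imp_bounded by (metis bounded_iff imageI real_norm_def)
    show ?thesis
    proof (rule Bochner_Integration.integrable_bound)
      show "integrable torus (\<lambda>x. B * \<bar>h x\<bar>)" using hi by auto
      show "(\<lambda>x. h x * g (circles x)) \<in> borel_measurable torus"
        using meas[OF g] by measurable
      show "AE x in torus. norm (h x * g (circles x)) \<le> norm (B * \<bar>h x\<bar>)"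
      proof (rule AE_I2)
        fix x assume "x \<in> space torus"
        then have "circles x \<in> K" by (auto simp: K_def)
        then have "\<bar>g (circles x)\<bar> \<le> \<bar>B\<bar>" using B by fastforce
        then show "norm (h x * g (circles x)) \<le> norm (B * \<bar>h x\<bar>)"
          by (simp add: abs_mult mult.commute[of "\<bar>h x\<bar>"] mult_right_mono)
      qed
    qed
  qed
  have "\<bar>\<integral>x. h x * G (circles x) \<partial>torus\<bar> \<le> e * (1 + (\<integral>x. \<bar>h x\<bar> \<partial>torus))" if "e > 0" for e
  proof -
    obtain p where p: "p \<in> circle_polys" "\<And>z. z \<in> K \<Longrightarrow> \<bar>G z - p z\<bar> < e"
      using PR.Stone_Weierstrass_basic[of G e] \<open>e > 0\<close> continuous_on_subset[OF G] by auto
    have cp: "continuous_on UNIV p" using p(1) by (rule continuous_circle_polys)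
    have "(\<integral>x. complex_of_real (h x * p (circles x)) * expo 0 x \<partial>torus) = 0"
      using annihilates_expo_mult[OF p(1) h] unfolding annihilates_expo_def by blast
    then have "(\<integral>x. h x * p (circles x) \<partial>torus) = 0"
      by (simp del: of_real_mult)
    then have "(\<integral>x. h x * G (circles x) \<partial>torus) = (\<integral>x. h x * G (circles x) - h x * p (circles x) \<partial>torus)"
      by (simp add: ih[OF G] ih[OF cp])
    also have "\<bar>\<dots>\<bar> \<le> (\<integral>x. \<bar>h x * G (circles x) - h x * p (circles x)\<bar> \<partial>torus)"
      by (rule integral_abs_bound)
    also have "\<dots> \<le> (\<integral>x. e * \<bar>h x\<bar> \<partial>torus)"
    proof (rule integral_mono)
      show "integrable torus (\<lambda>x. \<bar>h x * G (circles x) - h x * p (circles x)\<bar>)"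
        using ih[OF G] ih[OF cp] by auto
      show "integrable torus (\<lambda>x. e * \<bar>h x\<bar>)" using hi by auto
      fix x assume "x \<in> space torus"
      then have "\<bar>G (circles x) - p (circles x)\<bar> \<le> e"
        using p(2)[of "circles x"] by (auto simp: K_def)
      then show "\<bar>h x * G (circles x) - h x * p (circles x)\<bar> \<le> e * \<bar>h x\<bar>"
        by (simp add: right_diff_distrib[symmetric] abs_mult mult.commute[of "\<bar>h x\<bar>"] mult_right_mono)
    qed
    also have "\<dots> \<le> e * (1 + (\<integral>x. \<bar>h x\<bar> \<partial>torus))"
      using \<open>e > 0\<close> by (simp add: distrib_left)
    finally show ?thesis .
  qed note bound = this
  show ?thesis
  proof (rule ccontr)
    let ?I = "\<integral>x. h x * G (circles x) \<partial>torus"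
    \<comment> \<open>The summand 1 keeps M positive; the choice of e below turns the bound into |I|
      <= |I| / 2.\<close>
    define M where "M = 1 + (\<integral>x. \<bar>h x\<bar> \<partial>torus)"
    assume I: "?I \<noteq> 0"
    have M: "M \<ge> 1" by (simp add: M_def)
    then have "\<bar>?I\<bar> / (2 * M) > 0" using I by auto
    from bound[OF this] have "\<bar>?I\<bar> \<le> \<bar>?I\<bar> / (2 * M) * M" by (simp add: M_def)
    then show False using I M by simp
  qed
qed

section \<open>From continuous test functions to null sets\<close>

lemma AE_torus_box: "AE x in torus. x \<in> box 0 1"
proof -
  have "negligible (cbox 0 1 - box (0::real^3) 1)"
    by (rule negligible_frontier_interval)
  then have "cbox 0 1 - box (0::real^3) 1 \<in> null_sets lebesgue"
    by (simp add: negligible_iff_null_sets)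
  then have "AE x in lebesgue. x \<notin> cbox 0 1 - box (0::real^3) 1"
    by (rule AE_not_in)
  then show ?thesis
    unfolding torus_def by (subst AE_restrict_space_iff) auto
qed

text \<open>The indicator of a compact set inside the open cube is almost everywhere a bounded limit
  of continuous functions composed with \<open>circles\<close>.\<close>

lemma annihilates_expo_compact:
  assumes h: "annihilates_expo h" and F: "compact F" "F \<subseteq> box 0 1"
  shows "(\<integral>x. h x * indicator F x \<partial>torus) = 0"
proof (cases "F = {}")
  case False
  define C where "C = circles ` F"
  have C: "compact C" "C \<noteq> {}"
    using F False by (auto simp: C_def intro!: compact_continuous_image continuous_circles)
  have hi: "integrable torus h" and [measurable]: "h \<in> borel_measurable torus"
    using h by (auto simp: annihilates_expo_def)
  \<comment> \<open>Continuous cut-offs on the circle side that decrease to the indicator of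
    C.\<close>
  define G where "G n z = max 0 (1 - real n * infdist z C)" for n z
  have G: "continuous_on UNIV (G n)" for n
    unfolding G_def by (intro continuous_intros)
  have Gc: "continuous_on UNIV (\<lambda>x. G n (circles x))" for n
    by (rule continuous_on_compose2[OF G continuous_circles]) auto
  have [measurable]: "(\<lambda>x. G n (circles x)) \<in> borel_measurable torus" for n
    using continuous_integrable_torus[OF Gc] by auto
  have G01: "0 \<le> G n z" "G n z \<le> 1" for n z
    unfolding G_def by (auto simp: infdist_nonneg)
  have Glim: "(\<lambda>n. G n z) \<longlonglongrightarrow> indicator C z" for z
  proof (cases "z \<in> C")
    case True
    then show ?thesis by (simp add: G_def)
  next
    case False
    then have d: "infdist z C > 0"
      using C by (metis compact_imp_closed in_closed_iff_infdist_zero infdist_nonneg less_eq_real_def)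
    obtain N :: nat where N: "real N > 1 / infdist z C"
      using reals_Archimedean2 by blast
    have "G n z = 0" if "n \<ge> N" for n
    proof -
      have "real n > 1 / infdist z C" using N that by (meson less_le_trans of_nat_mono)
      then have "real n * infdist z C > 1" using d by (simp add: field_simps)
      then show ?thesis by (simp add: G_def)
    qed
    then have "eventually (\<lambda>n. G n z = indicator C z) sequentially"
      using False by (auto simp: eventually_sequentially)
    then show ?thesis by (rule tendsto_eventually)
  qed
  have "F \<in> sets lebesgue" using F by (simp add: lmeasurable_compact fmeasurableD)
  then have "F \<in> sets torus"
    unfolding torus_def using F(2) box_subset_cbox by (subst sets_restrict_space_iff) auto
  then have [measurable]: "indicator F \<in> borel_measurable torus"
    by (rule borel_measurable_indicator)
  have "(\<lambda>n. \<integral>x. h x * G n (circles x) \<partial>torus) \<longlonglongrightarrow> (\<integral>x. h x * indicator F x \<partial>torus)"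
  proof (rule integral_dominated_convergence[where w = "\<lambda>x. \<bar>h x\<bar>"])
    show "AE x in torus. (\<lambda>n. h x * G n (circles x)) \<longlonglongrightarrow> h x * indicator F x"
      using AE_torus_box
    proof eventually_elim
      case (elim x)
      \<comment> \<open>Off the boundary of the cube \<open>circles\<close> is injective, so no
        point outside F is mapped into C.\<close>
      have "circles x \<in> C \<longleftrightarrow> x \<in> F"
        unfolding C_def using inj_on_image_mem_iff[OF inj_on_circles] elim F by blast
      then have "indicator F x = (indicator C (circles x) :: real)"
        by (auto simp: indicator_def)
      then show ?case by (auto intro!: tendsto_intros Glim)
    qed
    show "AE x in torus. norm (h x * G n (circles x)) \<le> \<bar>h x\<bar>" for n
      using G01[of n] by (auto simp: abs_mult intro!: AE_I2 mult_left_le)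
  qed (use hi in auto)
  then show ?thesis
    using annihilates_expo_continuous[OF h G] by (simp add: LIMSEQ_const_iff)
qed simp

text \<open>On a compact part of the set where h is positive the integral of h vanishes, so that
  part is null; inner regularity then makes the whole set null.\<close>

lemma annihilates_expo_AE_nonpos:
  assumes h: "annihilates_expo h"
  shows "AE x in torus. h x \<le> 0"
proof -
  have hi: "integrable torus h" and hm [measurable]: "h \<in> borel_measurable torus"
    using h by (auto simp: annihilates_expo_def)
  define A where "A = {x \<in> box 0 1. h x > 0}"
  have "{x \<in> space torus. h x > 0} \<in> sets torus" by measurable
  then have "{x \<in> cbox 0 1. h x > 0} \<in> sets lebesgue"
    by (simp add: torus_def sets_restrict_space_iff)
  moreover have "A = {x \<in> cbox 0 1. h x > 0} \<inter> box 0 1"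
    unfolding A_def using box_subset_cbox by auto
  ultimately have A: "A \<in> sets lebesgue"
    by (simp add: sets.Int)
  have "emeasure lebesgue A \<le> 0"
  proof (rule ennreal_le_epsilon)
    fix e :: real assume "e > 0"
    then obtain F where F: "closed F" "F \<subseteq> A" "A - F \<in> lmeasurable" "emeasure lebesgue (A - F) < ennreal e"
      using sets_lebesgue_inner_closed[OF A] by metis
    have Fb: "F \<subseteq> box 0 1" using F(2) by (auto simp: A_def)
    then have cF: "compact F"
      using F(1) bounded_subset[OF bounded_box] compact_eq_bounded_closed by blast
    then have Fl: "F \<in> sets lebesgue" by (simp add: lmeasurable_compact fmeasurableD)
    then have Ft: "F \<in> sets torus"
      unfolding torus_def using Fb box_subset_cbox by (subst sets_restrict_space_iff) auto
    then have [measurable]: "indicator F \<in> borel_measurable torus"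
      by (rule borel_measurable_indicator)
    have "integrable torus (\<lambda>x. h x * indicator F x)"
      using hi by (rule Bochner_Integration.integrable_bound) (auto split: split_indicator)
    moreover have "AE x in torus. 0 \<le> h x * indicator F x"
      using F(2) by (auto simp: indicator_def A_def intro!: AE_I2)
    ultimately have "AE x in torus. h x * indicator F x = 0"
      using annihilates_expo_compact[OF h cF Fb] integral_nonneg_eq_0_iff_AE by blast
    then have "AE x in torus. x \<notin> F"
      by eventually_elim (use F(2) in \<open>auto simp: indicator_def A_def split: if_splits\<close>)
    then have "AE x in lebesgue. x \<in> cbox 0 1 \<longrightarrow> x \<notin> F"
      unfolding torus_def by (subst (asm) AE_restrict_space_iff) auto
    then have "AE x in lebesgue. x \<notin> F"
      by eventually_elim (use Fb box_subset_cbox in blast)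
    then have "emeasure lebesgue F = 0"
      using Fl by (simp add: AE_iff_measurable[of F])
    moreover have "emeasure lebesgue A \<le> emeasure lebesgue (A - F) + emeasure lebesgue F"
    proof -
      have "A = (A - F) \<union> F" using F(2) by blast
      then show ?thesis
        using emeasure_subadditive[of "A - F" lebesgue F] A Fl by (metis sets.Diff)
    qed
    ultimately show "emeasure lebesgue A \<le> 0 + ennreal e"
      using F(4) by simp
  qed
  then have "AE x in lebesgue. x \<notin> A"
    using A by (simp add: AE_iff_measurable[of A])
  then have "AE x in torus. x \<notin> A"
    unfolding torus_def by (subst AE_restrict_space_iff) auto
  with AE_torus_box show ?thesis
    by eventually_elim (auto simp: A_def)
qed

lemma annihilates_expo_AE_0:
  assumes h: "annihilates_expo h"
  shows "AE x in torus. h x = 0"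
proof -
  have "annihilates_expo (\<lambda>x. - h x)"
    using h unfolding annihilates_expo_def of_real_minus mult_minus_left by simp
  from annihilates_expo_AE_nonpos[OF h] annihilates_expo_AE_nonpos[OF this]
  show ?thesis by eventually_elim auto
qed

subsection \<open>The space of square integrable fields\<close>

text \<open>The discriminant argument behind Cauchy-Schwarz, isolated because it serves
  \<open>l2inner\<close>, the weighted forms and the comparison of L1 with L2 alike.\<close>

lemma quadratic_form_nonneg:
  fixes A B C :: real
  assumes A: "A \<ge> 0" and C: "C \<ge> 0" and q: "\<And>t. A + 2 * t * B + t\<^sup>2 * C \<ge> 0"
  shows "\<bar>B\<bar> \<le> sqrt A * sqrt C"
proof -
  have "B\<^sup>2 \<le> A * C"
  proof (cases "C = 0")
    case True
    show ?thesis
    proof (cases "B = 0")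
      case False
      \<comment> \<open>With C = 0 the polynomial is affine in t, and this t would give it the value
        -1.\<close>
      have "A + 2 * (- (A + 1) / (2 * B)) * B + (- (A + 1) / (2 * B))\<^sup>2 * C = - 1"
        using False True by (simp add: field_simps)
      with q[of "- (A + 1) / (2 * B)"] show ?thesis by simp
    qed (use True in simp)
  next
    case False
    with C have C0: "C > 0" by simp
    have "A + 2 * (- B / C) * B + (- B / C)\<^sup>2 * C = A - B\<^sup>2 / C"
      using False by (simp add: power2_eq_square field_simps)
    with q[of "- B / C"] have "B\<^sup>2 / C \<le> A" by simp
    then show ?thesis using C0 by (simp add: field_simps)
  qed
  then have "sqrt (B\<^sup>2) \<le> sqrt (A * C)" by (rule real_sqrt_le_mono)
  then show ?thesis by (simp add: real_sqrt_mult)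
qed

lemma L2_measurable [measurable_dest]: "f \<in> L2 \<Longrightarrow> f \<in> borel_measurable torus"
  by (simp add: L2_def)

lemma L2_sq_integrable: "f \<in> L2 \<Longrightarrow> integrable torus (\<lambda>x. (norm (f x))\<^sup>2)"
  by (simp add: L2_def)

lemma L2_periodic: "f \<in> L2 \<Longrightarrow> periodic f"
  by (simp add: L2_def)

lemma L2_inner_integrable:
  fixes f g :: field
  assumes "f \<in> L2" "g \<in> L2"
  shows "integrable torus (\<lambda>x. f x \<bullet> g x)"
proof (rule Bochner_Integration.integrable_bound)
  show "integrable torus (\<lambda>x. (norm (f x))\<^sup>2 + (norm (g x))\<^sup>2)"
    using assms by (intro Bochner_Integration.integrable_add L2_sq_integrable)
  show "(\<lambda>x. f x \<bullet> g x) \<in> borel_measurable torus"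
    using assms[THEN L2_measurable] by measurable
  have "\<bar>f x \<bullet> g x\<bar> \<le> (norm (f x))\<^sup>2 + (norm (g x))\<^sup>2" for x
  proof -
    have "\<bar>f x \<bullet> g x\<bar> \<le> norm (f x) * norm (g x)" by (rule Cauchy_Schwarz_ineq2)
    also have "\<dots> \<le> (norm (f x))\<^sup>2 + (norm (g x))\<^sup>2"
      using sum_squares_bound[of "norm (f x)" "norm (g x)"]
        mult_nonneg_nonneg[OF norm_ge_zero[of "f x"] norm_ge_zero[of "g x"]] by linarith
    finally show ?thesis .
  qed
  then show "AE x in torus. norm (f x \<bullet> g x) \<le> norm ((norm (f x))\<^sup>2 + (norm (g x))\<^sup>2)"
    by (intro AE_I2) simp
qed

lemma L2_lincomb:
  fixes f g :: field
  assumes "f \<in> L2" "g \<in> L2"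
  shows "(\<lambda>x. a *\<^sub>R f x + c *\<^sub>R g x) \<in> L2"
proof -
  have "periodic (\<lambda>x. a *\<^sub>R f x + c *\<^sub>R g x)"
    using assms[THEN L2_periodic] by (simp add: periodic_def)
  moreover have "(\<lambda>x. a *\<^sub>R f x + c *\<^sub>R g x) \<in> borel_measurable torus"
    using assms[THEN L2_measurable] by measurable
  moreover have "integrable torus (\<lambda>x. (norm (a *\<^sub>R f x + c *\<^sub>R g x))\<^sup>2)"
  proof -
    have "(norm (a *\<^sub>R f x + c *\<^sub>R g x))\<^sup>2 = a\<^sup>2 * (f x \<bullet> f x) + 2 * a * c * (f x \<bullet> g x) + c\<^sup>2 * (g x \<bullet> g x)" for x
      by (simp only: power2_norm_eq_inner)
        (simp add: inner_add_left inner_add_right inner_commute algebra_simps power2_eq_square)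
    then show ?thesis
      using assms by (auto intro!: Bochner_Integration.integrable_add integrable_mult_right L2_inner_integrable)
  qed
  ultimately show ?thesis by (simp add: L2_def)
qed

lemma L2_diff: "(f :: field) \<in> L2 \<Longrightarrow> g \<in> L2 \<Longrightarrow> (\<lambda>x. f x - g x) \<in> L2"
  using L2_lincomb[of f g 1 "-1"] by simp

lemma L2_add: "(f :: field) \<in> L2 \<Longrightarrow> g \<in> L2 \<Longrightarrow> (\<lambda>x. f x + g x) \<in> L2"
  using L2_lincomb[of f g 1 1] by simp

lemma L2_scale: "(f :: field) \<in> L2 \<Longrightarrow> (\<lambda>x. a *\<^sub>R f x) \<in> L2"
  using L2_lincomb[of f f a 0] by simp

lemma continuous_periodic_L2:
  fixes f :: "real^3 \<Rightarrow> 'b::euclidean_space"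
  assumes "continuous_on UNIV f" "periodic f"
  shows "f \<in> L2"
  using assms continuous_integrable_torus[OF assms(1)]
  unfolding L2_def by (auto intro!: continuous_integrable_torus continuous_intros)

lemma L2_zero: "(\<lambda>_. 0) \<in> L2"
  by (rule continuous_periodic_L2) (auto simp: periodic_def)

lemma L2_sum: "(\<And>i. i \<in> I \<Longrightarrow> (f i :: field) \<in> L2) \<Longrightarrow> (\<lambda>x. \<Sum>i\<in>I. f i x) \<in> L2"
proof (induction I rule: infinite_finite_induct)
  case (insert i I)
  then show ?case using L2_add[of "f i" "\<lambda>x. \<Sum>i\<in>I. f i x"] by simp
qed (simp_all add: L2_zero)

lemma l2inner_commute: "l2inner f g = l2inner g f"
  by (simp add: l2inner_def inner_commute)

lemma l2inner_lincomb_left: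
  assumes "f \<in> L2" "g \<in> L2" "h \<in> L2"
  shows "l2inner (\<lambda>x. a *\<^sub>R f x + c *\<^sub>R g x) h = a * l2inner f h + c * l2inner g h"
  unfolding l2inner_def
  by (simp add: inner_add_left L2_inner_integrable assms)

lemma l2inner_diff_left:
  assumes "f \<in> L2" "g \<in> L2" "h \<in> L2"
  shows "l2inner (\<lambda>x. f x - g x) h = l2inner f h - l2inner g h"
  using l2inner_lincomb_left[OF assms, of 1 "-1"] by simp

lemma l2inner_diff_right:
  assumes "f \<in> L2" "g \<in> L2" "h \<in> L2"
  shows "l2inner h (\<lambda>x. f x - g x) = l2inner h f - l2inner h g"
  using l2inner_diff_left[OF assms] by (simp add: l2inner_commute)

lemma l2norm_sq: "(l2norm f)\<^sup>2 = l2inner f f"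
  unfolding l2norm_def l2inner_def by (simp add: power2_norm_eq_inner)

lemma l2inner_self_nonneg: "0 \<le> l2inner f f"
  by (metis l2norm_sq zero_le_power2)

lemma l2norm_nonneg [simp]: "0 \<le> l2norm f"
  unfolding l2norm_def by simp

lemma l2norm_eq: "l2norm f = sqrt (l2inner f f)"
  by (metis l2norm_nonneg l2norm_sq real_sqrt_unique)

lemma l2inner_quadratic:
  assumes "f \<in> L2" "g \<in> L2"
  shows "l2inner (\<lambda>x. a *\<^sub>R f x + c *\<^sub>R g x) (\<lambda>x. a *\<^sub>R f x + c *\<^sub>R g x)
    = a\<^sup>2 * l2inner f f + 2 * a * c * l2inner f g + c\<^sup>2 * l2inner g g"
proof -
  let ?q = "\<lambda>x. a *\<^sub>R f x + c *\<^sub>R g x"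
  have "l2inner ?q ?q = a * l2inner ?q f + c * l2inner ?q g"
    using l2inner_lincomb_left[OF assms L2_lincomb[OF assms, of a c], of a c]
    by (simp only: l2inner_commute[of f ?q] l2inner_commute[of g ?q])
  also have "l2inner ?q f = a * l2inner f f + c * l2inner f g"
    using l2inner_lincomb_left[OF assms assms(1), of a c] by (simp only: l2inner_commute[of g f])
  also have "l2inner ?q g = a * l2inner f g + c * l2inner g g"
    by (rule l2inner_lincomb_left[OF assms assms(2)])
  finally show ?thesis
    by (simp add: algebra_simps power2_eq_square)
qed

lemma l2inner_Cauchy_Schwarz:
  assumes "f \<in> L2" "g \<in> L2"
  shows "\<bar>l2inner f g\<bar> \<le> l2norm f * l2norm g"
  unfolding l2norm_eq
proof (rule quadratic_form_nonneg)
  show "0 \<le> l2inner f f + 2 * t * l2inner f g + t\<^sup>2 * l2inner g g" for t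
    using l2inner_quadratic[OF assms, of 1 t] l2inner_self_nonneg[of "\<lambda>x. 1 *\<^sub>R f x + t *\<^sub>R g x"] by simp
qed (rule l2inner_self_nonneg)+

lemma l2norm_triangle:
  assumes "f \<in> L2" "g \<in> L2"
  shows "l2norm (\<lambda>x. f x + g x) \<le> l2norm f + l2norm g"
proof (rule power2_le_imp_le)
  have "(l2norm (\<lambda>x. f x + g x))\<^sup>2 = (l2norm f)\<^sup>2 + 2 * l2inner f g + (l2norm g)\<^sup>2"
    using l2inner_quadratic[OF assms, of 1 1] by (simp add: l2norm_sq)
  also have "\<dots> \<le> (l2norm f)\<^sup>2 + 2 * (l2norm f * l2norm g) + (l2norm g)\<^sup>2"
    using l2inner_Cauchy_Schwarz[OF assms] by simp
  also have "\<dots> = (l2norm f + l2norm g)\<^sup>2"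
    by (simp add: power2_sum)
  finally show "(l2norm (\<lambda>x. f x + g x))\<^sup>2 \<le> (l2norm f + l2norm g)\<^sup>2" .
qed simp

lemma l2norm_minus_commute: "l2norm (\<lambda>x. f x - g x) = l2norm (\<lambda>x. g x - f x)"
  unfolding l2norm_def by (simp add: norm_minus_commute)

lemma l2norm_triangle_diff:
  assumes "f \<in> L2" "g \<in> L2" "h \<in> L2"
  shows "l2norm (\<lambda>x. f x - h x) \<le> l2norm (\<lambda>x. f x - g x) + l2norm (\<lambda>x. g x - h x)"
  using l2norm_triangle[of "\<lambda>x. f x - g x" "\<lambda>x. g x - h x"] assms by (simp add: L2_diff)

lemma l2norm_cong_AE:
  assumes "f \<in> L2" "g \<in> L2" "AE x in torus. f x = g x"
  shows "l2norm f = l2norm g"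
proof -
  have "AE x in torus. (norm (f x))\<^sup>2 = (norm (g x))\<^sup>2"
    using assms(3) by eventually_elim simp
  then have "(\<integral>x. (norm (f x))\<^sup>2 \<partial>torus) = (\<integral>x. (norm (g x))\<^sup>2 \<partial>torus)"
    using assms(1,2)[THEN L2_sq_integrable]
    by (intro integral_cong_AE borel_measurable_integrable)
  then show ?thesis by (simp add: l2norm_def)
qed

lemma l2inner_cong_AE:
  assumes "f \<in> L2" "g \<in> L2" "h \<in> L2" "AE x in torus. f x = g x"
  shows "l2inner f h = l2inner g h"
proof -
  have "AE x in torus. f x \<bullet> h x = g x \<bullet> h x"
    using assms(4) by eventually_elim simp
  then show ?thesis
    unfolding l2inner_def using assms(1,2) assms(3)
    by (intro integral_cong_AE borel_measurable_integrable L2_inner_integrable)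
qed

lemma l2norm_eq_0_AE:
  assumes "f \<in> L2" "l2norm f = 0"
  shows "AE x in torus. f x = 0"
proof -
  have "(\<integral>x. (norm (f x))\<^sup>2 \<partial>torus) = 0"
    using assms(2) by (simp add: l2norm_def)
  then have "AE x in torus. (norm (f x))\<^sup>2 = 0"
    using integral_nonneg_eq_0_iff_AE[OF L2_sq_integrable[OF assms(1)]] by simp
  then show ?thesis by eventually_elim simp
qed

lemma L2_integrable:
  fixes f :: field
  assumes "f \<in> L2"
  shows "integrable torus f"
proof (rule Bochner_Integration.integrable_bound)
  show "integrable torus (\<lambda>x. 1 + (norm (f x))\<^sup>2)"
    using L2_sq_integrable[OF assms] by simp
  have "norm (f x) \<le> 1 + (norm (f x))\<^sup>2" for x
    using sum_squares_bound[of 1 "norm (f x)"] norm_ge_zero[of "f x"] by (simp del: norm_ge_zero)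
  then show "AE x in torus. norm (f x) \<le> norm (1 + (norm (f x))\<^sup>2)"
    by (intro AE_I2) simp
qed (use assms in \<open>rule L2_measurable\<close>)

text \<open>Cauchy-Schwarz against the constant 1, the torus having measure 1.\<close>

lemma L1_le_l2norm:
  fixes f :: field
  assumes "f \<in> L2"
  shows "(\<integral>x. norm (f x) \<partial>torus) \<le> l2norm f"
proof -
  have i: "integrable torus (\<lambda>x. norm (f x))" using L2_integrable[OF assms] by simp
  note j = L2_sq_integrable[OF assms]
  have "\<bar>\<integral>x. norm (f x) \<partial>torus\<bar> \<le> sqrt (\<integral>x. (norm (f x))\<^sup>2 \<partial>torus) * sqrt 1"
  proof (rule quadratic_form_nonneg)
    fix t :: real
    have "0 \<le> (\<integral>x. (norm (f x) + t)\<^sup>2 \<partial>torus)" by simp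
    also have "\<dots> = (\<integral>x. (norm (f x))\<^sup>2 + (2 * t * norm (f x) + t\<^sup>2) \<partial>torus)"
      by (intro Bochner_Integration.integral_cong) (auto simp: power2_sum)
    also have "\<dots> = (\<integral>x. (norm (f x))\<^sup>2 \<partial>torus) + ((\<integral>x. 2 * t * norm (f x) \<partial>torus) + (\<integral>x. t\<^sup>2 \<partial>torus))"
      using i j by simp
    also have "\<dots> = (\<integral>x. (norm (f x))\<^sup>2 \<partial>torus) + 2 * t * (\<integral>x. norm (f x) \<partial>torus) + t\<^sup>2 * 1"
      using i by simp
    finally show "0 \<le> (\<integral>x. (norm (f x))\<^sup>2 \<partial>torus) + 2 * t * (\<integral>x. norm (f x) \<partial>torus) + t\<^sup>2 * 1" .
  qed simp_all
  then show ?thesis by (simp add: l2norm_def)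
qed

text \<open>Cauchy in L2 implies Cauchy in L1, which yields an almost everywhere convergent
  subsequence; Fatou's lemma then gives convergence in L2.\<close>

lemma L2_complete:
  fixes F :: "nat \<Rightarrow> field"
  assumes F: "\<And>n. F n \<in> L2"
    and cauchy: "\<And>e. e > 0 \<Longrightarrow> \<exists>N. \<forall>m\<ge>N. \<forall>n\<ge>N. l2norm (\<lambda>x. F m x - F n x) < e"
  shows "\<exists>f\<in>L2. (\<lambda>n. l2norm (\<lambda>x. F n x - f x)) \<longlonglongrightarrow> 0"
proof -
  have Fm [measurable]: "F n \<in> borel_measurable torus" for n using F by (rule L2_measurable)
  obtain r where r: "strict_mono r" "AE x in torus. Cauchy (\<lambda>i. F (r i) x)"
  proof (rule cauchy_L1_AE_cauchy_subseq)
    show "integrable torus (F n)" for n using F by (rule L2_integrable)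
    fix e :: real assume "e > 0"
    then obtain N where "\<forall>m\<ge>N. \<forall>n\<ge>N. l2norm (\<lambda>x. F m x - F n x) < e"
      using cauchy by blast
    then show "\<exists>N. \<forall>i\<ge>N. \<forall>j\<ge>N. (\<integral>x. norm (F i x - F j x) \<partial>torus) < e"
      using L1_le_l2norm[OF L2_diff[OF F F]] by (meson le_less_trans)
  qed
  \<comment> \<open>Taking \<open>lim\<close> at every point, also where the sequence diverges,
    makes f exactly periodic and not just almost everywhere.\<close>
  define f where "f x = lim (\<lambda>i. F (r i) x)" for x
  have fm [measurable]: "f \<in> borel_measurable torus"
    unfolding f_def by (rule borel_measurable_lim_metric) (rule Fm)
  have fp: "periodic f"
    using F[THEN L2_periodic] by (simp add: periodic_def f_def)
  have lim: "AE x in torus. (\<lambda>i. F (r i) x) \<longlonglongrightarrow> f x"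
    using r(2) by eventually_elim (simp add: f_def Cauchy_convergent convergent_LIMSEQ_iff[symmetric])
  \<comment> \<open>Fatou along the subsequence: F n stays e-close to all late F (r i), hence to
    their limit.\<close>
  have key: "(\<lambda>x. F n x - f x) \<in> L2 \<and> l2norm (\<lambda>x. F n x - f x) \<le> e"
    if e: "e > 0" and n: "n \<ge> N" and N: "\<forall>m\<ge>N. \<forall>n\<ge>N. l2norm (\<lambda>x. F m x - F n x) < e" for e n N
  proof -
    have "(\<integral>\<^sup>+x. ennreal ((norm (F n x - f x))\<^sup>2) \<partial>torus)
        = (\<integral>\<^sup>+x. liminf (\<lambda>i. ennreal ((norm (F n x - F (r i) x))\<^sup>2)) \<partial>torus)"
    proof (rule nn_integral_cong_AE)
      show "AE x in torus. ennreal ((norm (F n x - f x))\<^sup>2)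
          = liminf (\<lambda>i. ennreal ((norm (F n x - F (r i) x))\<^sup>2))"
        using lim
      proof eventually_elim
        case (elim x)
        have "(\<lambda>i. ennreal ((norm (F n x - F (r i) x))\<^sup>2)) \<longlonglongrightarrow> ennreal ((norm (F n x - f x))\<^sup>2)"
          by (intro tendsto_intros tendsto_ennrealI elim)
        from lim_imp_Liminf[OF _ this] show ?case by simp
      qed
    qed
    also have "\<dots> \<le> liminf (\<lambda>i. \<integral>\<^sup>+x. ennreal ((norm (F n x - F (r i) x))\<^sup>2) \<partial>torus)"
      by (rule nn_integral_liminf) measurable
    also have "\<dots> \<le> limsup (\<lambda>i. \<integral>\<^sup>+x. ennreal ((norm (F n x - F (r i) x))\<^sup>2) \<partial>torus)"
      by (rule Liminf_le_Limsup) simp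
    also have "\<dots> \<le> ennreal (e\<^sup>2)"
    proof (rule Limsup_bounded)
      show "eventually (\<lambda>i. (\<integral>\<^sup>+x. ennreal ((norm (F n x - F (r i) x))\<^sup>2) \<partial>torus) \<le> ennreal (e\<^sup>2)) sequentially"
        unfolding eventually_sequentially
      proof (intro exI[of _ N] allI impI)
        fix i assume "i \<ge> N"
        then have "r i \<ge> N" using seq_suble[OF r(1), of i] by simp
        then have l: "l2norm (\<lambda>x. F n x - F (r i) x) < e" using N n by blast
        have "(\<integral>\<^sup>+x. ennreal ((norm (F n x - F (r i) x))\<^sup>2) \<partial>torus)
            = ennreal (\<integral>x. (norm (F n x - F (r i) x))\<^sup>2 \<partial>torus)"
          using L2_sq_integrable[OF L2_diff[OF F F]] by (intro nn_integral_eq_integral) simp_all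
        also have "(\<integral>x. (norm (F n x - F (r i) x))\<^sup>2 \<partial>torus) = (l2norm (\<lambda>x. F n x - F (r i) x))\<^sup>2"
          by (simp add: l2norm_def)
        also have "ennreal \<dots> \<le> ennreal (e\<^sup>2)"
          using l by (intro ennreal_leI power_mono) simp_all
        finally show "(\<integral>\<^sup>+x. ennreal ((norm (F n x - F (r i) x))\<^sup>2) \<partial>torus) \<le> ennreal (e\<^sup>2)" .
      qed
    qed
    finally have nn: "(\<integral>\<^sup>+x. ennreal ((norm (F n x - f x))\<^sup>2) \<partial>torus) \<le> ennreal (e\<^sup>2)" .
    have int: "integrable torus (\<lambda>x. (norm (F n x - f x))\<^sup>2)"
      using nn by (intro integrableI_bounded) (auto simp: order.strict_trans1 top.not_eq_extremum)
    then have "(\<lambda>x. F n x - f x) \<in> L2"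
      using L2_periodic[OF F[of n]] fp by (simp add: L2_def periodic_def)
    moreover have "ennreal (\<integral>x. (norm (F n x - f x))\<^sup>2 \<partial>torus) \<le> ennreal (e\<^sup>2)"
      using nn int by (subst nn_integral_eq_integral[symmetric]) simp_all
    then have "l2norm (\<lambda>x. F n x - f x) \<le> e"
      unfolding l2norm_def using e by (intro real_le_lsqrt) (simp_all add: ennreal_le_iff)
    ultimately show ?thesis ..
  qed
  obtain N where N: "\<forall>m\<ge>N. \<forall>n\<ge>N. l2norm (\<lambda>x. F m x - F n x) < 1"
    using cauchy[of 1] by auto
  \<comment> \<open>So far only differences F n - f are known to be square integrable; f is
    recovered from one of them.\<close>
  have "(\<lambda>x. F N x - (F N x - f x)) \<in> L2"
    by (rule L2_diff[OF F]) (use key[OF _ _ N] in simp)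
  then have fL: "f \<in> L2" by simp
  have "(\<lambda>n. l2norm (\<lambda>x. F n x - f x)) \<longlonglongrightarrow> 0"
  proof (rule LIMSEQ_I)
    fix e :: real assume "e > 0"
    then obtain N where N: "\<forall>m\<ge>N. \<forall>n\<ge>N. l2norm (\<lambda>x. F m x - F n x) < e / 2"
      using cauchy[of "e / 2"] by auto
    have "norm (l2norm (\<lambda>x. F n x - f x) - 0) < e" if "n \<ge> N" for n
      using key[OF _ that N] \<open>e > 0\<close> by simp
    then show "\<exists>N. \<forall>n\<ge>N. norm (l2norm (\<lambda>x. F n x - f x) - 0) < e" by blast
  qed
  with fL show ?thesis by blast
qed

subsection \<open>Fourier coefficients and Parseval's identity\<close>

lemma L2_nth_integrable:
  fixes f :: field
  assumes "f \<in> L2"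
  shows "integrable torus (\<lambda>x. f x $ i)"
proof -
  have "integrable torus (\<lambda>x. f x \<bullet> axis i 1)"
    using L2_integrable[OF assms] by (intro integrable_inner_left) simp
  then show ?thesis by (simp add: inner_axis)
qed

lemma fourier_nth: "fourier f k $ i = (\<integral>x. complex_of_real (f x $ i) * expo (- k) x \<partial>torus)"
  by (simp add: fourier_def expo_def)

lemma integrable_fourier:
  fixes f :: field
  assumes "f \<in> L2"
  shows "integrable torus (\<lambda>x. complex_of_real (f x $ i) * expo k x)"
  by (rule integrable_mult_expo[OF L2_nth_integrable[OF assms]])

lemma cnj_fourier_nth: "(\<integral>x. complex_of_real (f x $ i) * expo k x \<partial>torus) = cnj (fourier f k $ i)"
proof -
  have "cnj (fourier f k $ i) = (\<integral>x. cnj (complex_of_real (f x $ i) * expo (- k) x) \<partial>torus)"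
    unfolding fourier_nth by (rule Bochner_Integration.integral_cnj[symmetric])
  then show ?thesis by (simp add: expo_minus)
qed

text \<open>The symmetry that characterizes coefficients of real-valued fields.\<close>

definition hermitian :: "(int^3 \<Rightarrow> complex^3) \<Rightarrow> bool" where
  "hermitian c \<longleftrightarrow> (\<forall>k i. c (- k) $ i = cnj (c k $ i))"

lemma hermitian_fourier: "hermitian (fourier f)"
  unfolding hermitian_def by (simp only: fourier_nth[of f "- k" for k] minus_minus cnj_fourier_nth simp_thms)

lemma fourier_lincomb:
  assumes "f \<in> L2" "g \<in> L2"
  shows "fourier (\<lambda>x. a *\<^sub>R f x + c *\<^sub>R g x) k = a *\<^sub>R fourier f k + c *\<^sub>R fourier g k"
proof (rule vec_eq_iff[THEN iffD2], intro allI)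
  fix i
  have "fourier (\<lambda>x. a *\<^sub>R f x + c *\<^sub>R g x) k $ i
      = (\<integral>x. complex_of_real a * (complex_of_real (f x $ i) * expo (- k) x)
          + complex_of_real c * (complex_of_real (g x $ i) * expo (- k) x) \<partial>torus)"
    unfolding fourier_nth by (intro Bochner_Integration.integral_cong) (simp_all add: algebra_simps)
  also have "\<dots> = complex_of_real a * fourier f k $ i + complex_of_real c * fourier g k $ i"
    unfolding fourier_nth using assms by (simp add: integrable_fourier)
  finally show "fourier (\<lambda>x. a *\<^sub>R f x + c *\<^sub>R g x) k $ i = (a *\<^sub>R fourier f k + c *\<^sub>R fourier g k) $ i"
    by (simp only: vector_add_component vector_scaleR_component scaleR_conv_of_real[where 'a = complex])
qed

lemma fourier_diff:
  assumes "f \<in> L2" "g \<in> L2"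
  shows "fourier (\<lambda>x. f x - g x) k = fourier f k - fourier g k"
  using fourier_lincomb[OF assms, of 1 "-1"] by simp

text \<open>The factor 3 merely counts components; the bound serves as continuity of each
  coefficient in L2.\<close>

lemma norm_fourier_le:
  assumes "f \<in> L2"
  shows "norm (fourier f k) \<le> 3 * l2norm f"
proof -
  have "norm (fourier f k $ i) \<le> l2norm f" for i
  proof -
    have "norm (fourier f k $ i) \<le> (\<integral>x. norm (complex_of_real (f x $ i) * expo (- k) x) \<partial>torus)"
      unfolding fourier_nth by (rule integral_norm_bound)
    also have "\<dots> = (\<integral>x. \<bar>f x $ i\<bar> \<partial>torus)"
      by (simp add: norm_mult)
    also have "\<dots> \<le> (\<integral>x. norm (f x) \<partial>torus)"
      by (intro integral_mono integrable_abs integrable_norm L2_nth_integrable[OF assms]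
          L2_integrable[OF assms] component_le_norm_cart)
    also have "\<dots> \<le> l2norm f"
      by (rule L1_le_l2norm[OF assms])
    finally show ?thesis .
  qed
  then have "(\<Sum>i\<in>UNIV. norm (fourier f k $ i)) \<le> (\<Sum>i\<in>(UNIV :: 3 set). l2norm f)"
    by (intro sum_mono)
  moreover have "norm (fourier f k) \<le> (\<Sum>i\<in>UNIV. norm (fourier f k $ i))"
    unfolding norm_vec_def by (rule L2_set_le_sum) simp
  ultimately show ?thesis by simp
qed

lemma L2_eqI_fourier:
  assumes "f \<in> L2" "g \<in> L2" "\<And>k. fourier f k = fourier g k"
  shows "AE x in torus. f x = g x"
proof -
  have d: "(\<lambda>x. f x - g x) \<in> L2" using assms(1,2) by (rule L2_diff)
  have "annihilates_expo (\<lambda>x. (f x - g x) $ i)" for i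
    unfolding annihilates_expo_def cnj_fourier_nth[of "\<lambda>x. f x - g x"]
    using L2_nth_integrable[OF d] assms by (simp add: fourier_diff)
  then have "AE x in torus. \<forall>i\<in>UNIV. (f x - g x) $ i = 0"
    by (intro AE_finite_allI annihilates_expo_AE_0) auto
  then show ?thesis
    by eventually_elim (simp add: vec_eq_iff)
qed

text \<open>Taking real parts term by term keeps the field real for arbitrary \<open>K\<close> and
  \<open>c\<close>, so a single frequency gives a real test mode. For symmetric \<open>K\<close> and
  hermitian \<open>c\<close> the imaginary parts cancel in pairs and this is the usual exponential
  sum.\<close>

definition synth :: "(int^3) set \<Rightarrow> (int^3 \<Rightarrow> complex^3) \<Rightarrow> field" where
  "synth K c x = (\<chi> i. \<Sum>k\<in>K. Re (c k $ i * expo k x))"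

lemma synth_nth: "synth K c x $ i = (\<Sum>k\<in>K. Re (c k $ i * expo k x))"
  by (simp add: synth_def)

lemma continuous_synth: "continuous_on S (synth K c)"
  unfolding synth_def by (intro continuous_intros)

lemma periodic_synth: "periodic (synth K c)"
  using periodic_expo by (simp add: periodic_def synth_def)

lemma synth_L2: "synth K c \<in> L2"
  by (rule continuous_periodic_L2[OF continuous_synth periodic_synth])

text \<open>Holds frequency by frequency, so that pairing with \<open>synth {k} c\<close> turns an
  integral identity into one about the coefficient at k. The inner product of complex vectors is the
  real one.\<close>

lemma l2inner_synth:
  assumes f: "f \<in> L2"
  shows "l2inner f (synth K c) = (\<Sum>k\<in>K. fourier f k \<bullet> c k)"
proof -
  have i: "integrable torus (\<lambda>x. complex_of_real (f x $ i) * expo k x)" for i k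
    by (rule integrable_fourier[OF f])
  have re: "integrable torus (\<lambda>x. Re (c k $ i * (complex_of_real (f x $ i) * expo k x)))" for i k
    by (intro integrable_Re integrable_mult_right i)
  have "l2inner f (synth K c)
      = (\<integral>x. (\<Sum>i\<in>UNIV. \<Sum>k\<in>K. Re (c k $ i * (complex_of_real (f x $ i) * expo k x))) \<partial>torus)"
    unfolding l2inner_def inner_vec_def synth_nth
    by (intro Bochner_Integration.integral_cong refl sum.cong)
      (simp add: sum_distrib_left algebra_simps)
  also have "\<dots> = (\<Sum>i\<in>UNIV. \<Sum>k\<in>K. (\<integral>x. Re (c k $ i * (complex_of_real (f x $ i) * expo k x)) \<partial>torus))"
    by (simp only: Bochner_Integration.integral_sum Bochner_Integration.integrable_sum re)
  also have "\<dots> = (\<Sum>i\<in>UNIV. \<Sum>k\<in>K. Re (c k $ i * cnj (fourier f k $ i)))"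
    by (intro sum.cong refl) (simp only: integral_Re[OF integrable_mult_right[OF i]]
        integral_mult_right_zero cnj_fourier_nth)
  also have "\<dots> = (\<Sum>k\<in>K. \<Sum>i\<in>UNIV. Re (c k $ i * cnj (fourier f k $ i)))"
    by (rule sum.swap)
  also have "\<dots> = (\<Sum>k\<in>K. fourier f k \<bullet> c k)"
    unfolding inner_vec_def inner_complex_def by (intro sum.cong refl) (simp add: algebra_simps)
  finally show ?thesis .
qed

text \<open>Each real part puts half of its amplitude at k and half at -k; the symmetry of
  \<open>K\<close> and \<open>c\<close> adds two equal halves at every frequency.\<close>

lemma fourier_synth:
  assumes K: "finite K" "\<And>k. - k \<in> K \<longleftrightarrow> k \<in> K" and c: "hermitian c"
  shows "fourier (synth K c) m = (if m \<in> K then c m else 0)"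
proof (rule vec_eq_iff[THEN iffD2], intro allI)
  fix i
  have ie: "integrable torus (expo k)" for k
    by (intro continuous_integrable_torus continuous_expo)
  have cpx: "complex_of_real (Re z) = (z + cnj z) / 2" for z
    by (simp add: complex_eq_iff)
  have "fourier (synth K c) m $ i
      = (\<integral>x. (\<Sum>k\<in>K. c k $ i / 2 * expo (k - m) x + c (- k) $ i / 2 * expo (- k - m) x) \<partial>torus)"
    unfolding fourier_nth synth_nth
  proof (intro Bochner_Integration.integral_cong refl)
    fix x
    have "complex_of_real (Re (c k $ i * expo k x)) * expo (- m) x
        = c k $ i / 2 * expo (k - m) x + c (- k) $ i / 2 * expo (- k - m) x" for k
      using c unfolding cpx hermitian_def
      by (simp add: expo_diff expo_minus add_divide_distrib distrib_right mult.assoc)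
    then show "complex_of_real (\<Sum>k\<in>K. Re (c k $ i * expo k x)) * expo (- m) x
        = (\<Sum>k\<in>K. c k $ i / 2 * expo (k - m) x + c (- k) $ i / 2 * expo (- k - m) x)"
      by (simp only: of_real_sum sum_distrib_right)
  qed
  also have "\<dots> = (\<Sum>k\<in>K. (\<integral>x. c k $ i / 2 * expo (k - m) x + c (- k) $ i / 2 * expo (- k - m) x \<partial>torus))"
    by (rule Bochner_Integration.integral_sum) (intro Bochner_Integration.integrable_add integrable_mult_right ie)
  also have "\<dots> = (\<Sum>k\<in>K. c k $ i / 2 * (if k = m then 1 else 0) + c (- k) $ i / 2 * (if k = - m then 1 else 0))"
  proof (intro sum.cong refl)
    fix k
    have *: "- k - m = 0 \<longleftrightarrow> k = - m" by (metis add.inverse_inverse diff_eq_eq add_0 minus_equation_iff)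
    show "(\<integral>x. c k $ i / 2 * expo (k - m) x + c (- k) $ i / 2 * expo (- k - m) x \<partial>torus)
        = c k $ i / 2 * (if k = m then 1 else 0) + c (- k) $ i / 2 * (if k = - m then 1 else 0)"
      using expo_integral[of "k - m"] expo_integral[of "- k - m"] *
      by (simp add: ie Bochner_Integration.integral_add integrable_mult_right split del: if_split)
  qed
  also have "\<dots> = (\<Sum>k\<in>K. if k = m then c k $ i / 2 else 0) + (\<Sum>k\<in>K. if k = - m then c (- k) $ i / 2 else 0)"
    unfolding sum.distrib[symmetric]
    by (intro sum.cong refl arg_cong2[where f = "(+)"]) simp_all
  also have "(\<Sum>k\<in>K. if k = m then c k $ i / 2 else 0) = (if m \<in> K then c m $ i / 2 else 0)"
    using K(1) by simp
  also have "(\<Sum>k\<in>K. if k = - m then c (- k) $ i / 2 else 0) = (if m \<in> K then c m $ i / 2 else 0)"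
    using K(1) K(2)[of m] by simp
  also have "(if m \<in> K then c m $ i / 2 else 0) + (if m \<in> K then c m $ i / 2 else 0)
      = (if m \<in> K then c m else 0) $ i"
    by simp
  finally show "fourier (synth K c) m $ i = (if m \<in> K then c m else 0) $ i" .
qed

text \<open>An exhaustion of the frequencies by finite sets that are symmetric under k -> -k, as
  real truncations need.\<close>

definition cube :: "nat \<Rightarrow> (int^3) set" where
  "cube n = {k. \<forall>i. \<bar>k $ i\<bar> \<le> int n}"

lemma finite_cube [simp]: "finite (cube n)"
proof -
  have "cube n \<subseteq> (\<lambda>f. \<chi> i. f i) ` (UNIV \<rightarrow>\<^sub>E {- int n..int n})"
  proof
    fix k assume k: "k \<in> cube n"
    have "- int n \<le> k $ i \<and> k $ i \<le> int n" for i
      using k by (auto simp: cube_def abs_le_iff dest: spec[of _ i])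
    then have "(\<lambda>i. k $ i) \<in> UNIV \<rightarrow>\<^sub>E {- int n..int n}"
      by (auto simp: PiE_UNIV_domain)
    moreover have "k = (\<chi> i. k $ i)" by simp
    ultimately show "k \<in> (\<lambda>f. \<chi> i. f i) ` (UNIV \<rightarrow>\<^sub>E {- int n..int n})"
      by blast
  qed
  then show ?thesis
    by (rule finite_subset) (intro finite_imageI finite_PiE, simp_all)
qed

lemma minus_in_cube [simp]: "- k \<in> cube n \<longleftrightarrow> k \<in> cube n"
  by (simp add: cube_def)

lemma cube_mono: "m \<le> n \<Longrightarrow> cube m \<subseteq> cube n"
  by (auto simp: cube_def intro: order_trans)

lemma ex_cube: "\<exists>n. k \<in> cube n"
proof -
  have "\<bar>k $ i\<bar> \<le> int (nat (\<Sum>i\<in>UNIV. \<bar>k $ i\<bar>))" for i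
    using member_le_sum[of i UNIV "\<lambda>i. \<bar>k $ i\<bar>"] by (simp add: sum_nonneg)
  then show ?thesis unfolding cube_def by blast
qed

lemma finite_subset_cube:
  assumes "finite X"
  shows "\<exists>n. X \<subseteq> cube n"
  using assms
proof induction
  case (insert k X)
  then obtain n m where "X \<subseteq> cube n" "k \<in> cube m" using ex_cube by blast
  then have "insert k X \<subseteq> cube (max n m)"
    using cube_mono[of n "max n m"] cube_mono[of m "max n m"] by auto
  then show ?case by blast
qed simp

text \<open>Lets unordered sums over the lattice be computed as limits of a sequence of
  truncations.\<close>

lemma filterlim_cube: "filterlim cube (finite_subsets_at_top UNIV) sequentially"
  unfolding filterlim_finite_subsets_at_top
proof (intro allI impI)
  fix X :: "(int^3) set" assume "finite X \<and> X \<subseteq> UNIV"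
  then obtain n where n: "X \<subseteq> cube n" using finite_subset_cube by blast
  show "eventually (\<lambda>n. finite (cube n) \<and> X \<subseteq> cube n \<and> cube n \<subseteq> UNIV) sequentially"
    using eventually_ge_at_top[of n] by eventually_elim (use n cube_mono in force)
qed

lemma summable_cube_limit:
  fixes f :: "int^3 \<Rightarrow> 'b::{topological_comm_monoid_add, t2_space}"
  assumes "f summable_on UNIV"
  shows "(\<lambda>n. sum f (cube n)) \<longlonglongrightarrow> infsum f UNIV"
  using filterlim_compose[OF _ filterlim_cube] has_sum_infsum[OF assms]
  unfolding has_sum_def by blast

lemma l2norm_synth:
  assumes K: "finite K" "\<And>k. - k \<in> K \<longleftrightarrow> k \<in> K" and c: "hermitian c"
  shows "(l2norm (synth K c))\<^sup>2 = (\<Sum>k\<in>K. (norm (c k))\<^sup>2)"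
  unfolding l2norm_sq l2inner_synth[OF synth_L2]
  by (intro sum.cong refl) (simp add: fourier_synth[OF assms] power2_norm_eq_inner)

lemma synth_cube_diff:
  assumes "m \<le> n"
  shows "(\<lambda>x. synth (cube n) c x - synth (cube m) c x) = synth (cube n - cube m) c"
proof -
  have "synth (cube n) c x - synth (cube m) c x = synth (cube n - cube m) c x" for x
    unfolding vec_eq_iff vector_minus_component synth_nth
    by (intro allI sum_diff[OF finite_cube cube_mono[OF assms], symmetric])
  then show ?thesis by (rule ext)
qed

text \<open>By orthogonality the distance of two partial sums is a piece of the given series, so
  completeness provides a limit; its coefficients are read off by continuity.\<close>

lemma Riesz_Fischer:
  assumes c: "hermitian c" and s: "(\<lambda>k. (norm (c k))\<^sup>2) summable_on UNIV"
  shows "\<exists>g\<in>L2. (\<forall>k. fourier g k = c k) \<and> (\<lambda>n. l2norm (\<lambda>x. synth (cube n) c x - g x)) \<longlonglongrightarrow> 0"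
proof -
  let ?s = "\<lambda>n. \<Sum>k\<in>cube n. (norm (c k))\<^sup>2"
  have lt: "l2norm (\<lambda>x. synth (cube n) c x - synth (cube m) c x) < e"
    if "m \<le> n" "\<bar>?s n - ?s m\<bar> < e\<^sup>2" "e > 0" for m n e
  proof -
    have "(l2norm (\<lambda>x. synth (cube n) c x - synth (cube m) c x))\<^sup>2 = (\<Sum>k\<in>cube n - cube m. (norm (c k))\<^sup>2)"
      unfolding synth_cube_diff[OF that(1)] by (rule l2norm_synth) (auto simp: c)
    also have "\<dots> = ?s n - ?s m"
      by (rule sum_diff[OF finite_cube cube_mono[OF that(1)]])
    also have "\<dots> < e\<^sup>2" using that(2) by linarith
    finally show ?thesis
      by (rule power_less_imp_less_base) (use that in simp)
  qed
  have "Cauchy ?s"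
    using summable_cube_limit[OF s] by (rule LIMSEQ_imp_Cauchy)
  have "\<exists>g\<in>L2. (\<lambda>n. l2norm (\<lambda>x. synth (cube n) c x - g x)) \<longlonglongrightarrow> 0"
  proof (rule L2_complete)
    fix e :: real assume e: "e > 0"
    then obtain N where N: "\<And>m n. m \<ge> N \<Longrightarrow> n \<ge> N \<Longrightarrow> \<bar>?s m - ?s n\<bar> < e\<^sup>2"
      using metric_CauchyD[OF \<open>Cauchy ?s\<close>, of "e\<^sup>2"] by (auto simp: dist_real_def)
    show "\<exists>N. \<forall>m\<ge>N. \<forall>n\<ge>N. l2norm (\<lambda>x. synth (cube m) c x - synth (cube n) c x) < e"
    proof (intro exI[of _ N] allI impI)
      fix m n assume mn: "N \<le> m" "N \<le> n"
      show "l2norm (\<lambda>x. synth (cube m) c x - synth (cube n) c x) < e"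
      proof (cases "m \<le> n")
        case True
        then show ?thesis
          using lt[OF True N[OF mn(2,1)] e]
          by (subst l2norm_minus_commute)
      qed (use lt[OF _ N[OF mn] e] in simp)
    qed
  qed (rule synth_L2)
  then obtain g where g: "g \<in> L2" "(\<lambda>n. l2norm (\<lambda>x. synth (cube n) c x - g x)) \<longlonglongrightarrow> 0"
    by blast
  have "fourier g k = c k" for k
  proof -
    have "(\<lambda>n. fourier (synth (cube n) c) k - fourier g k) \<longlonglongrightarrow> 0"
    proof (rule Lim_null_comparison)
      show "(\<lambda>n. 3 * l2norm (\<lambda>x. synth (cube n) c x - g x)) \<longlonglongrightarrow> 0"
        using tendsto_mult_left[OF g(2), of 3] by simp
      show "eventually (\<lambda>n. norm (fourier (synth (cube n) c) k - fourier g k)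
          \<le> 3 * l2norm (\<lambda>x. synth (cube n) c x - g x)) sequentially"
        using norm_fourier_le[OF L2_diff[OF synth_L2 g(1)]]
        by (simp add: fourier_diff[OF synth_L2 g(1)])
    qed
    then have "(\<lambda>n. fourier (synth (cube n) c) k) \<longlonglongrightarrow> fourier g k"
      by (rule LIM_zero_cancel)
    moreover obtain N where N: "k \<in> cube N" using ex_cube by blast
    have "(\<lambda>n. fourier (synth (cube n) c) k) \<longlonglongrightarrow> c k"
    proof (rule tendsto_eventually)
      show "eventually (\<lambda>n. fourier (synth (cube n) c) k = c k) sequentially"
        using eventually_ge_at_top[of N]
        by eventually_elim (use N cube_mono in \<open>auto simp: fourier_synth c\<close>)
    qed
    ultimately show ?thesis by (rule LIMSEQ_unique)
  qed
  then show ?thesis by (intro bexI[OF _ g(1)] conjI allI g(2))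
qed

abbreviation trunc :: "nat \<Rightarrow> field \<Rightarrow> field" where
  "trunc n f \<equiv> synth (cube n) (fourier f)"

lemma fourier_trunc: "fourier (trunc n f) k = (if k \<in> cube n then fourier f k else 0)"
  by (rule fourier_synth) (simp_all add: hermitian_fourier)

lemma Bessel:
  assumes f: "f \<in> L2"
  shows "(\<Sum>k\<in>cube n. (norm (fourier f k))\<^sup>2) \<le> (l2norm f)\<^sup>2"
proof -
  have 1: "l2inner f (trunc n f) = (\<Sum>k\<in>cube n. (norm (fourier f k))\<^sup>2)"
    by (simp add: l2inner_synth[OF f] power2_norm_eq_inner)
  have 2: "l2inner (trunc n f) (trunc n f) = (\<Sum>k\<in>cube n. (norm (fourier f k))\<^sup>2)"
    unfolding l2norm_sq[symmetric] by (rule l2norm_synth) (simp_all add: hermitian_fourier)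
  have "0 \<le> 1\<^sup>2 * l2inner f f + 2 * 1 * (-1) * l2inner f (trunc n f) + (-1)\<^sup>2 * l2inner (trunc n f) (trunc n f)"
    by (subst l2inner_quadratic[OF f synth_L2, symmetric]) (rule l2inner_self_nonneg)
  then show ?thesis
    by (simp only: 1 2 l2norm_sq) simp
qed

lemma fourier_summable:
  assumes f: "f \<in> L2"
  shows "(\<lambda>k. (norm (fourier f k))\<^sup>2) summable_on UNIV"
proof (rule nonneg_bdd_above_summable_on)
  show "bdd_above (sum (\<lambda>k. (norm (fourier f k))\<^sup>2) ` {F. F \<subseteq> UNIV \<and> finite F})"
  proof (rule bdd_aboveI2)
    fix X :: "(int^3) set" assume "X \<in> {F. F \<subseteq> UNIV \<and> finite F}"
    then obtain n where n: "X \<subseteq> cube n" using finite_subset_cube by blast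
    have "(\<Sum>k\<in>X. (norm (fourier f k))\<^sup>2) \<le> (\<Sum>k\<in>cube n. (norm (fourier f k))\<^sup>2)"
      by (rule sum_mono2[OF finite_cube n]) simp
    also have "\<dots> \<le> (l2norm f)\<^sup>2" by (rule Bessel[OF f])
    finally show "(\<Sum>k\<in>X. (norm (fourier f k))\<^sup>2) \<le> (l2norm f)\<^sup>2" .
  qed
qed simp

text \<open>The truncations converge to some field with the coefficients of f, and by uniqueness of
  coefficients that field is f.\<close>

lemma trunc_tendsto_L2:
  assumes f: "f \<in> L2"
  shows "(\<lambda>n. l2norm (\<lambda>x. trunc n f x - f x)) \<longlonglongrightarrow> 0"
proof -
  obtain g where g: "g \<in> L2" "\<And>k. fourier g k = fourier f k"
    "(\<lambda>n. l2norm (\<lambda>x. trunc n f x - g x)) \<longlonglongrightarrow> 0"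
    using Riesz_Fischer[OF hermitian_fourier fourier_summable[OF f]] by blast
  have "AE x in torus. g x = f x"
    by (rule L2_eqI_fourier[OF g(1) f g(2)])
  then have "l2norm (\<lambda>x. trunc n f x - g x) = l2norm (\<lambda>x. trunc n f x - f x)" for n
    by (intro l2norm_cong_AE L2_diff synth_L2 g f) (auto elim: eventually_mono)
  with g(3) show ?thesis by simp
qed

lemma l2inner_tendsto:
  assumes F: "\<And>n. F n \<in> L2" "f \<in> L2" "h \<in> L2" "((\<lambda>n. l2norm (\<lambda>x. F n x - f x)) \<longlongrightarrow> 0) \<F>"
  shows "((\<lambda>n. l2inner (F n) h) \<longlongrightarrow> l2inner f h) \<F>"
proof (rule LIM_zero_cancel, rule Lim_null_comparison)
  show "((\<lambda>n. l2norm (\<lambda>x. F n x - f x) * l2norm h) \<longlongrightarrow> 0) \<F>"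
    using tendsto_mult_right[OF F(4), of "l2norm h"] by simp
  show "eventually (\<lambda>n. norm (l2inner (F n) h - l2inner f h) \<le> l2norm (\<lambda>x. F n x - f x) * l2norm h) \<F>"
    using l2inner_Cauchy_Schwarz[OF L2_diff[OF F(1,2)] F(3)]
    by (simp add: l2inner_diff_left[OF F(1-3)])
qed

lemma Parseval:
  assumes f: "f \<in> L2" and g: "g \<in> L2"
  shows "(\<lambda>k. fourier f k \<bullet> fourier g k) summable_on UNIV"
    and "l2inner f g = (\<Sum>\<^sub>\<infinity>k. fourier f k \<bullet> fourier g k)"
proof -
  show s: "(\<lambda>k. fourier f k \<bullet> fourier g k) summable_on UNIV"
  proof (rule abs_summable_summable, rule summable_on_comparison_test)
    show "(\<lambda>k. (norm (fourier f k))\<^sup>2 + (norm (fourier g k))\<^sup>2) summable_on UNIV"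
      by (intro summable_on_add fourier_summable f g)
    fix k
    have "norm (fourier f k \<bullet> fourier g k) \<le> norm (fourier f k) * norm (fourier g k)"
      by (simp add: Cauchy_Schwarz_ineq2)
    also have "\<dots> \<le> (norm (fourier f k))\<^sup>2 + (norm (fourier g k))\<^sup>2"
      using sum_squares_bound[of "norm (fourier f k)" "norm (fourier g k)"]
        mult_nonneg_nonneg[OF norm_ge_zero[of "fourier f k"] norm_ge_zero[of "fourier g k"]] by linarith
    finally show "norm (fourier f k \<bullet> fourier g k) \<le> (norm (fourier f k))\<^sup>2 + (norm (fourier g k))\<^sup>2" .
  qed simp
  have "(\<lambda>n. l2inner (trunc n g) f) \<longlonglongrightarrow> l2inner g f"
    by (rule l2inner_tendsto[OF synth_L2 g f trunc_tendsto_L2[OF g]])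
  moreover have "l2inner (trunc n g) f = (\<Sum>k\<in>cube n. fourier f k \<bullet> fourier g k)" for n
    by (subst l2inner_commute) (rule l2inner_synth[OF f])
  ultimately have "(\<lambda>n. \<Sum>k\<in>cube n. fourier f k \<bullet> fourier g k) \<longlonglongrightarrow> l2inner f g"
    by (simp add: l2inner_commute[of g f])
  from LIMSEQ_unique[OF this summable_cube_limit[OF s]]
  show "l2inner f g = (\<Sum>\<^sub>\<infinity>k. fourier f k \<bullet> fourier g k)" .
qed

subsection \<open>Weighted forms and Sobolev norms\<close>

definition freq :: "int^3 \<Rightarrow> real" where
  "freq k = (2 * pi * norm (lattice_vec k))\<^sup>2"

lemma freq_nonneg [simp]: "0 \<le> freq k"
  by (simp add: freq_def)

text \<open>One form for three purposes: weight 1 gives the L2 product, \<open>sweight\<close> the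
  Sobolev norms, and the symbol of A^r the form Q.\<close>

definition wform :: "(int^3 \<Rightarrow> real) \<Rightarrow> field \<Rightarrow> field \<Rightarrow> real" where
  "wform w f g = (\<Sum>\<^sub>\<infinity>k. w k * (fourier f k \<bullet> fourier g k))"

definition wspace :: "(int^3 \<Rightarrow> real) \<Rightarrow> field set" where
  "wspace w = {f. f \<in> L2 \<and> (\<lambda>k. w k * (norm (fourier f k))\<^sup>2) summable_on UNIV}"

lemma wspace_L2: "f \<in> wspace w \<Longrightarrow> f \<in> L2"
  by (simp add: wspace_def)

lemma wspace_summable: "f \<in> wspace w \<Longrightarrow> (\<lambda>k. w k * (norm (fourier f k))\<^sup>2) summable_on UNIV"
  by (simp add: wspace_def)

lemma wform_commute: "wform w f g = wform w g f"
  by (simp add: wform_def inner_commute)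

lemma norm_lincomb_sq:
  fixes x y :: "'a::real_inner"
  shows "(norm (a *\<^sub>R x + c *\<^sub>R y))\<^sup>2 = a\<^sup>2 * (norm x)\<^sup>2 + 2 * a * c * (x \<bullet> y) + c\<^sup>2 * (norm y)\<^sup>2"
proof -
  have "(norm (a *\<^sub>R x + c *\<^sub>R y))\<^sup>2 = a * (a * (x \<bullet> x)) + a * (c * (x \<bullet> y)) + (c * (a * (y \<bullet> x)) + c * (c * (y \<bullet> y)))"
    unfolding power2_norm_eq_inner by (simp add: inner_add_left inner_add_right distrib_left)
  then show ?thesis
    unfolding inner_commute[of y x] power2_norm_eq_inner by (simp add: power2_eq_square)
qed

context
  fixes w :: "int^3 \<Rightarrow> real"
  assumes w: "\<And>k. 0 \<le> w k"
begin

lemma wform_summable: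
  assumes "f \<in> wspace w" "g \<in> wspace w"
  shows "(\<lambda>k. w k * (fourier f k \<bullet> fourier g k)) summable_on UNIV"
proof (rule abs_summable_summable, rule summable_on_comparison_test)
  show "(\<lambda>k. w k * (norm (fourier f k))\<^sup>2 + w k * (norm (fourier g k))\<^sup>2) summable_on UNIV"
    by (intro summable_on_add wspace_summable assms)
  fix k
  have "norm (fourier f k \<bullet> fourier g k) \<le> norm (fourier f k) * norm (fourier g k)"
    by (simp add: Cauchy_Schwarz_ineq2)
  also have "\<dots> \<le> (norm (fourier f k))\<^sup>2 + (norm (fourier g k))\<^sup>2"
    using sum_squares_bound[of "norm (fourier f k)" "norm (fourier g k)"]
      mult_nonneg_nonneg[OF norm_ge_zero[of "fourier f k"] norm_ge_zero[of "fourier g k"]] by linarith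
  finally have "w k * norm (fourier f k \<bullet> fourier g k) \<le> w k * ((norm (fourier f k))\<^sup>2 + (norm (fourier g k))\<^sup>2)"
    using w[of k] by (intro mult_left_mono)
  then show "norm (w k * (fourier f k \<bullet> fourier g k)) \<le> w k * (norm (fourier f k))\<^sup>2 + w k * (norm (fourier g k))\<^sup>2"
    using w[of k] by (simp add: abs_mult distrib_left)
qed simp

lemma wspace_lincomb:
  assumes f: "f \<in> wspace w" and g: "g \<in> wspace w"
  shows "(\<lambda>x. a *\<^sub>R f x + c *\<^sub>R g x) \<in> wspace w"
proof -
  have "(\<lambda>k. a\<^sup>2 * (w k * (norm (fourier f k))\<^sup>2) + (2 * a * c * (w k * (fourier f k \<bullet> fourier g k))
      + c\<^sup>2 * (w k * (norm (fourier g k))\<^sup>2))) summable_on UNIV"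
    by (intro summable_on_add summable_on_cmult_right wspace_summable wform_summable f g)
  also have "(\<lambda>k. a\<^sup>2 * (w k * (norm (fourier f k))\<^sup>2) + (2 * a * c * (w k * (fourier f k \<bullet> fourier g k))
      + c\<^sup>2 * (w k * (norm (fourier g k))\<^sup>2)))
      = (\<lambda>k. w k * (norm (fourier (\<lambda>x. a *\<^sub>R f x + c *\<^sub>R g x) k))\<^sup>2)"
    unfolding fourier_lincomb[OF wspace_L2[OF f] wspace_L2[OF g]] norm_lincomb_sq
    by (rule ext) (simp add: algebra_simps)
  finally show ?thesis
    using L2_lincomb[OF wspace_L2[OF f] wspace_L2[OF g]] by (simp add: wspace_def)
qed

lemma wspace_diff: "f \<in> wspace w \<Longrightarrow> g \<in> wspace w \<Longrightarrow> (\<lambda>x. f x - g x) \<in> wspace w"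
  using wspace_lincomb[of f g 1 "-1"] by simp

lemma wform_lincomb_left:
  assumes f: "f \<in> wspace w" and g: "g \<in> wspace w" and h: "h \<in> wspace w"
  shows "wform w (\<lambda>x. a *\<^sub>R f x + c *\<^sub>R g x) h = a * wform w f h + c * wform w g h"
proof -
  have "wform w (\<lambda>x. a *\<^sub>R f x + c *\<^sub>R g x) h
      = (\<Sum>\<^sub>\<infinity>k. a * (w k * (fourier f k \<bullet> fourier h k)) + c * (w k * (fourier g k \<bullet> fourier h k)))"
    unfolding wform_def fourier_lincomb[OF wspace_L2[OF f] wspace_L2[OF g]]
    by (simp add: inner_add_left algebra_simps)
  also have "\<dots> = a * wform w f h + c * wform w g h"
    unfolding wform_def
    by (subst infsum_add) (auto intro!: summable_on_cmult_right wform_summable f g h simp: infsum_cmult_right')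
  finally show ?thesis .
qed

lemma wform_lincomb_right:
  assumes "f \<in> wspace w" "g \<in> wspace w" "h \<in> wspace w"
  shows "wform w h (\<lambda>x. a *\<^sub>R f x + c *\<^sub>R g x) = a * wform w h f + c * wform w h g"
  unfolding wform_commute[of w h] by (rule wform_lincomb_left[OF assms])

lemma wform_self_nonneg: "0 \<le> wform w f f"
  unfolding wform_def by (intro infsum_nonneg mult_nonneg_nonneg w) simp

lemma wform_quadratic:
  assumes f: "f \<in> wspace w" and g: "g \<in> wspace w"
  shows "wform w (\<lambda>x. a *\<^sub>R f x + c *\<^sub>R g x) (\<lambda>x. a *\<^sub>R f x + c *\<^sub>R g x)
    = a\<^sup>2 * wform w f f + 2 * a * c * wform w f g + c\<^sup>2 * wform w g g"
proof -
  let ?q = "\<lambda>x. a *\<^sub>R f x + c *\<^sub>R g x"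
  have q: "?q \<in> wspace w" by (rule wspace_lincomb[OF f g])
  have "wform w ?q ?q = a * wform w f ?q + c * wform w g ?q"
    by (rule wform_lincomb_left[OF f g q])
  also have "wform w f ?q = a * wform w f f + c * wform w f g"
    by (rule wform_lincomb_right[OF f g f])
  also have "wform w g ?q = a * wform w f g + c * wform w g g"
    unfolding wform_lincomb_right[OF f g g] by (simp only: wform_commute[of w g f])
  finally show ?thesis
    by (simp add: algebra_simps power2_eq_square)
qed

lemma wform_Cauchy_Schwarz:
  assumes "f \<in> wspace w" "g \<in> wspace w"
  shows "\<bar>wform w f g\<bar> \<le> sqrt (wform w f f) * sqrt (wform w g g)"
proof (rule quadratic_form_nonneg)
  show "0 \<le> wform w f f + 2 * t * wform w f g + t\<^sup>2 * wform w g g" for t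
    using wform_quadratic[OF assms, of 1 t] wform_self_nonneg[of "\<lambda>x. 1 *\<^sub>R f x + t *\<^sub>R g x"] by simp
qed (rule wform_self_nonneg)+

lemma wnorm_triangle:
  assumes "f \<in> wspace w" "g \<in> wspace w"
  shows "sqrt (wform w (\<lambda>x. f x + g x) (\<lambda>x. f x + g x)) \<le> sqrt (wform w f f) + sqrt (wform w g g)"
proof (rule real_le_lsqrt)
  have "wform w (\<lambda>x. f x + g x) (\<lambda>x. f x + g x) = wform w f f + 2 * wform w f g + wform w g g"
    using wform_quadratic[OF assms, of 1 1] by simp
  also have "\<dots> \<le> wform w f f + 2 * (sqrt (wform w f f) * sqrt (wform w g g)) + wform w g g"
    using wform_Cauchy_Schwarz[OF assms] by simp
  also have "\<dots> = (sqrt (wform w f f) + sqrt (wform w g g))\<^sup>2"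
    by (simp add: power2_sum wform_self_nonneg)
  finally show "wform w (\<lambda>x. f x + g x) (\<lambda>x. f x + g x) \<le> (sqrt (wform w f f) + sqrt (wform w g g))\<^sup>2" .
qed (simp add: wform_self_nonneg)

lemma wspace_mono:
  assumes "\<And>k. w k \<le> w' k" "f \<in> wspace w'"
  shows "f \<in> wspace w"
proof -
  have "(\<lambda>k. w k * (norm (fourier f k))\<^sup>2) summable_on UNIV"
  proof (rule summable_on_comparison_test[OF wspace_summable[OF assms(2)]])
    show "w k * (norm (fourier f k))\<^sup>2 \<le> w' k * (norm (fourier f k))\<^sup>2" for k
      by (rule mult_right_mono[OF assms(1)]) simp
  qed (simp add: w)
  then show ?thesis using assms(2) by (simp add: wspace_def)
qed

lemma wform_mono:
  assumes "\<And>k. w k \<le> w' k" "f \<in> wspace w'"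
  shows "wform w f f \<le> wform w' f f"
  unfolding wform_def power2_norm_eq_inner[symmetric]
  using wspace_summable[OF wspace_mono[OF assms]] wspace_summable[OF assms(2)]
  by (rule infsum_mono) (rule mult_right_mono[OF assms(1)], simp)

end

lemma synth_wspace:
  assumes K: "finite K" "\<And>k. - k \<in> K \<longleftrightarrow> k \<in> K" and c: "hermitian c"
  shows "synth K c \<in> wspace w"
proof -
  have "(\<lambda>k. w k * (norm (fourier (synth K c) k))\<^sup>2) summable_on UNIV"
    using summable_on_finite[OF K(1), of "\<lambda>k. w k * (norm (fourier (synth K c) k))\<^sup>2"]
    by (subst summable_on_cong_neutral[where T = K and g = "\<lambda>k. w k * (norm (fourier (synth K c) k))\<^sup>2"])
      (auto simp: fourier_synth[OF assms])
  then show ?thesis by (simp add: wspace_def synth_L2)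
qed

lemma trunc_wspace: "trunc n f \<in> wspace w"
  by (rule synth_wspace) (simp_all add: hermitian_fourier)

lemma trunc_tendsto_wform:
  assumes f: "f \<in> wspace w"
  shows "(\<lambda>n. wform w (\<lambda>x. trunc n f x - f x) (\<lambda>x. trunc n f x - f x)) \<longlonglongrightarrow> 0"
proof -
  let ?g = "\<lambda>k. w k * (norm (fourier f k))\<^sup>2"
  have s: "?g summable_on UNIV" by (rule wspace_summable[OF f])
  have "wform w (\<lambda>x. trunc n f x - f x) (\<lambda>x. trunc n f x - f x) = infsum ?g UNIV - sum ?g (cube n)" for n
  proof -
    have s2: "(\<lambda>k. if k \<in> cube n then ?g k else 0) summable_on UNIV"
      using summable_on_finite[OF finite_cube[of n], of ?g]
      by (subst summable_on_cong_neutral[where T = "cube n" and g = ?g]) auto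
    have i2: "infsum (\<lambda>k. if k \<in> cube n then ?g k else 0) UNIV = sum ?g (cube n)"
      by (subst infsum_cong_neutral[where T = "cube n" and g = ?g]) auto
    have "wform w (\<lambda>x. trunc n f x - f x) (\<lambda>x. trunc n f x - f x)
        = (\<Sum>\<^sub>\<infinity>k. ?g k + - (if k \<in> cube n then ?g k else 0))"
      unfolding wform_def power2_norm_eq_inner[symmetric]
      by (intro infsum_cong) (simp add: fourier_diff[OF synth_L2 wspace_L2[OF f]] fourier_trunc)
    also have "\<dots> = infsum ?g UNIV + infsum (\<lambda>k. - (if k \<in> cube n then ?g k else 0)) UNIV"
      using s summable_on_uminus[THEN iffD2, OF s2] by (rule infsum_add)
    also have "\<dots> = infsum ?g UNIV - sum ?g (cube n)"
      by (simp only: infsum_uminus i2 diff_conv_add_uminus)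
    finally show ?thesis .
  qed
  moreover have "(\<lambda>n. infsum ?g UNIV - sum ?g (cube n)) \<longlonglongrightarrow> infsum ?g UNIV - infsum ?g UNIV"
    by (intro tendsto_intros summable_cube_limit s)
  ultimately show ?thesis by simp
qed

lemma l2inner_eq_wform:
  assumes "f \<in> L2" "g \<in> L2"
  shows "l2inner f g = wform (\<lambda>_. 1) f g"
  by (simp add: wform_def Parseval(2)[OF assms])

section \<open>Sobolev norms as weighted forms\<close>

abbreviation sweight :: "real \<Rightarrow> int^3 \<Rightarrow> real" where
  "sweight s k \<equiv> (1 + freq k) powr s"

lemma sweight_nonneg: "0 \<le> sweight s k"
  by simp

lemma sweight_mono: "s \<le> s' \<Longrightarrow> sweight s k \<le> sweight s' k"
  by (rule powr_mono) simp_all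

lemma sweight_0: "sweight 0 = (\<lambda>_. 1)"
  using freq_nonneg by (auto simp: fun_eq_iff add_nonneg_eq_0_iff)

lemma Sobolev_eq_wspace: "Sobolev s = wspace (sweight s)"
  unfolding Sobolev_def wspace_def sobolev_term_def freq_def by simp

lemma hsnorm_eq_wform: "hsnorm s f = sqrt (wform (sweight s) f f)"
  unfolding hsnorm_def wform_def sobolev_term_def freq_def by (simp add: power2_norm_eq_inner)

lemma hsnorm_sq: "(hsnorm s f)\<^sup>2 = wform (sweight s) f f"
  by (simp add: hsnorm_eq_wform wform_self_nonneg)

lemma hsnorm_nonneg [simp]: "0 \<le> hsnorm s f"
  by (simp add: hsnorm_eq_wform wform_self_nonneg)

lemma Sobolev_L2: "f \<in> Sobolev s \<Longrightarrow> f \<in> L2"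
  by (simp add: Sobolev_def)

lemma Sobolev_mono: "s \<le> s' \<Longrightarrow> f \<in> Sobolev s' \<Longrightarrow> f \<in> Sobolev s"
  unfolding Sobolev_eq_wspace by (rule wspace_mono[OF sweight_nonneg sweight_mono])

lemma hsnorm_mono: "s \<le> s' \<Longrightarrow> f \<in> Sobolev s' \<Longrightarrow> hsnorm s f \<le> hsnorm s' f"
  unfolding Sobolev_eq_wspace hsnorm_eq_wform
  by (intro real_sqrt_le_mono wform_mono[OF sweight_nonneg sweight_mono])

lemma Sobolev_lincomb: "f \<in> Sobolev s \<Longrightarrow> g \<in> Sobolev s \<Longrightarrow> (\<lambda>x. a *\<^sub>R f x + c *\<^sub>R g x) \<in> Sobolev s"
  unfolding Sobolev_eq_wspace by (rule wspace_lincomb[OF sweight_nonneg])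

lemma Sobolev_diff: "f \<in> Sobolev s \<Longrightarrow> g \<in> Sobolev s \<Longrightarrow> (\<lambda>x. f x - g x) \<in> Sobolev s"
  unfolding Sobolev_eq_wspace by (rule wspace_diff[OF sweight_nonneg])

lemma hsnorm_triangle:
  "f \<in> Sobolev s \<Longrightarrow> g \<in> Sobolev s \<Longrightarrow> hsnorm s (\<lambda>x. f x + g x) \<le> hsnorm s f + hsnorm s g"
  unfolding Sobolev_eq_wspace hsnorm_eq_wform by (rule wnorm_triangle[OF sweight_nonneg])

lemma hsnorm_scale:
  assumes "f \<in> Sobolev s"
  shows "hsnorm s (\<lambda>x. a *\<^sub>R f x) = \<bar>a\<bar> * hsnorm s f"
  using wform_quadratic[OF sweight_nonneg assms[unfolded Sobolev_eq_wspace] assms[unfolded Sobolev_eq_wspace], of a 0]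
  by (simp add: hsnorm_eq_wform real_sqrt_mult)

lemma hsnorm_minus_commute:
  assumes "f \<in> Sobolev s" "g \<in> Sobolev s"
  shows "hsnorm s (\<lambda>x. f x - g x) = hsnorm s (\<lambda>x. g x - f x)"
  using hsnorm_scale[OF Sobolev_diff[OF assms], of "-1"] by simp

lemma hsnorm_diff_ineq:
  assumes "f \<in> Sobolev s" "g \<in> Sobolev s"
  shows "\<bar>hsnorm s f - hsnorm s g\<bar> \<le> hsnorm s (\<lambda>x. f x - g x)"
  using hsnorm_triangle[OF Sobolev_diff[OF assms] assms(2)]
    hsnorm_triangle[OF Sobolev_diff[OF assms(2,1)] assms(1)] hsnorm_minus_commute[OF assms]
  by (simp add: abs_le_iff)

lemma hsnorm_0: "f \<in> L2 \<Longrightarrow> hsnorm 0 f = l2norm f"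
  unfolding hsnorm_eq_wform sweight_0 l2norm_eq by (simp add: l2inner_eq_wform)

lemma l2norm_le_hsnorm: "0 \<le> s \<Longrightarrow> f \<in> Sobolev s \<Longrightarrow> l2norm f \<le> hsnorm s f"
  using hsnorm_mono[of 0 s f] hsnorm_0[OF Sobolev_L2] by simp

lemma trunc_Sobolev: "trunc n f \<in> Sobolev s"
  unfolding Sobolev_eq_wspace by (rule trunc_wspace)

lemma trunc_tendsto_hsnorm:
  assumes "f \<in> Sobolev s"
  shows "(\<lambda>n. hsnorm s (\<lambda>x. trunc n f x - f x)) \<longlonglongrightarrow> 0"
  using tendsto_real_sqrt[OF trunc_tendsto_wform[OF assms[unfolded Sobolev_eq_wspace]]]
  by (simp add: hsnorm_eq_wform)

lemma tendsto_hsnorm: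
  assumes "\<And>n. F n \<in> Sobolev s" "f \<in> Sobolev s" "((\<lambda>n. hsnorm s (\<lambda>x. F n x - f x)) \<longlongrightarrow> 0) \<F>"
  shows "((\<lambda>n. hsnorm s (F n)) \<longlongrightarrow> hsnorm s f) \<F>"
proof (rule LIM_zero_cancel, rule Lim_null_comparison[OF _ assms(3)])
  show "eventually (\<lambda>n. norm (hsnorm s (F n) - hsnorm s f) \<le> hsnorm s (\<lambda>x. F n x - f x)) \<F>"
    using hsnorm_diff_ineq[OF assms(1,2)] by simp
qed

subsection \<open>Derivatives of trigonometric polynomials\<close>

text \<open>Real modes with a complex amplitude c comprise sines and cosines at once, and
  differentiation only changes c; smoothness follows by induction with c arbitrary.\<close>

lemma has_derivative_rexp:
  "((\<lambda>x. Re (c * expo k x)) has_derivative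
    (\<lambda>h. 2 * pi * (lattice_vec k \<bullet> h) * Re (\<i> * c * expo k x))) (at x)"
proof -
  have "(\<lambda>x. Re (c * expo k x)) = (\<lambda>x. Re c * cos (2 * pi * (lattice_vec k \<bullet> x)) - Im c * sin (2 * pi * (lattice_vec k \<bullet> x)))"
    by (simp add: expo_def)
  then show ?thesis
    by (auto intro!: derivative_eq_intros simp: expo_def algebra_simps)
qed

lemma differentiable_rexp: "(\<lambda>x. Re (c * expo k x)) differentiable (at x)"
  using has_derivative_rexp unfolding differentiable_def by blast

lemma pd_rexp:
  "pd j (\<lambda>x. Re (c * expo k x)) = (\<lambda>x. Re (complex_of_real (2 * pi * real_of_int (k $ j)) * \<i> * c * expo k x))"
  by (rule ext, subst pd_eqI[OF has_derivative_rexp]) (simp add: inner_axis algebra_simps)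

lemma periodic_rexp: "periodic (\<lambda>x. Re (c * expo k x))"
  using periodic_expo by (simp add: periodic_def)

lemma Ck_rexp: "Ck n (\<lambda>x. Re (c * expo k x))"
proof (induction n arbitrary: c)
  case 0
  show ?case by (simp only: Ck.simps) (intro continuous_intros)
next
  case (Suc n)
  show ?case
    unfolding Ck.simps pd_rexp using differentiable_rexp Suc by blast
qed

lemma smooth_periodic_rexp: "smooth_periodic (\<lambda>x. Re (c * expo k x))"
  by (simp only: smooth_periodic_def periodic_rexp Ck_rexp simp_thms)

text \<open>The Fourier symbol 2 pi i k_j of the j-th partial derivative.\<close>

definition dcoef :: "3 \<Rightarrow> (int^3 \<Rightarrow> complex^3) \<Rightarrow> int^3 \<Rightarrow> complex^3" where
  "dcoef j c k = (\<chi> i. complex_of_real (2 * pi * real_of_int (k $ j)) * \<i> * c k $ i)"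

lemma dcoef_nth: "dcoef j c k $ i = complex_of_real (2 * pi * real_of_int (k $ j)) * \<i> * c k $ i"
  by (simp add: dcoef_def)

text \<open>Integration by parts on the Fourier side: the symbol is purely imaginary.\<close>

lemma dcoef_skew: "dcoef j c k \<bullet> d k = - (c k \<bullet> dcoef j d k)"
proof -
  have "(complex_of_real a * \<i> * x) \<bullet> y = - (x \<bullet> (complex_of_real a * \<i> * y))" for a x y
    by (simp add: inner_complex_def algebra_simps)
  then show ?thesis
    by (simp only: inner_vec_def dcoef_nth sum_negf)
qed

lemma hermitian_dcoef: "hermitian c \<Longrightarrow> hermitian (dcoef j c)"
  by (simp add: hermitian_def dcoef_nth)

lemma norm_dcoef: "(norm (dcoef j c k))\<^sup>2 = (2 * pi * real_of_int (k $ j))\<^sup>2 * (norm (c k))\<^sup>2"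
proof -
  have "dcoef j c k \<bullet> dcoef j c k = (2 * pi * real_of_int (k $ j))\<^sup>2 * (c k \<bullet> c k)"
  proof -
    have "(complex_of_real a * \<i> * x) \<bullet> (complex_of_real a * \<i> * x) = a\<^sup>2 * (x \<bullet> x)" for a x
      by (simp add: inner_complex_def power2_eq_square algebra_simps)
    then show ?thesis
      by (simp only: inner_vec_def dcoef_nth sum_distrib_left)
  qed
  then show ?thesis by (simp only: power2_norm_eq_inner)
qed

lemma freq_eq_sum: "freq k = (\<Sum>j\<in>UNIV. (2 * pi * real_of_int (k $ j))\<^sup>2)"
proof -
  have "(norm (lattice_vec k))\<^sup>2 = (\<Sum>j\<in>UNIV. (real_of_int (k $ j))\<^sup>2)"
    unfolding power2_norm_eq_inner inner_vec_def by (simp add: power2_eq_square)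
  then show ?thesis
    by (simp add: freq_def power_mult_distrib sum_distrib_left)
qed

lemma dcoef_freq_le: "(2 * pi * real_of_int (k $ j))\<^sup>2 \<le> freq k"
  unfolding freq_eq_sum by (rule member_le_sum) simp_all

lemma pd_nth:
  fixes F :: field
  assumes "F differentiable (at x)"
  shows "pd j (\<lambda>x. F x $ i) x = pd j F x $ i"
proof -
  have "(F has_derivative frechet_derivative F (at x)) (at x)"
    using assms by (simp add: frechet_derivative_works)
  from bounded_linear.has_derivative[OF bounded_linear_vec_nth this]
  show ?thesis
    by (subst pd_eqI) (auto simp: pd_def)
qed

lemma Ck_1_nth:
  fixes F :: field
  assumes "Ck 1 F"
  shows "Ck 1 (\<lambda>x. F x $ i)"
proof -
  have "(\<lambda>x. F x $ i) differentiable (at x)" for x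
  proof -
    have "(F has_derivative frechet_derivative F (at x)) (at x)"
      using Ck_1D(1)[OF assms] by (simp add: frechet_derivative_works)
    from bounded_linear.has_derivative[OF bounded_linear_vec_nth this]
    show ?thesis unfolding differentiable_def by blast
  qed
  moreover have "pd j (\<lambda>x. F x $ i) = (\<lambda>x. pd j F x $ i)" for j
    by (rule ext, rule pd_nth, rule Ck_1D(1)[OF assms])
  moreover have "continuous_on UNIV (\<lambda>x. pd j F x $ i)" for j
    by (intro continuous_on_component Ck_1D(2)[OF assms])
  ultimately show ?thesis
    by (simp only: One_nat_def Ck.simps simp_thms)
qed

lemma pd_synth_full:
  "(synth K c has_derivative (\<lambda>h. \<chi> i. \<Sum>k\<in>K. 2 * pi * (lattice_vec k \<bullet> h) * Re (\<i> * c k $ i * expo k x))) (at x)"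
proof (subst has_derivative_componentwise_within, intro ballI)
  fix b :: "real^3" assume "b \<in> Basis"
  then obtain i where b: "b = axis i 1" by (auto simp: Basis_vec_def)
  have "((\<lambda>x. \<Sum>k\<in>K. Re (c k $ i * expo k x)) has_derivative
      (\<lambda>h. \<Sum>k\<in>K. 2 * pi * (lattice_vec k \<bullet> h) * Re (\<i> * c k $ i * expo k x))) (at x)"
    by (intro has_derivative_sum has_derivative_rexp)
  then show "((\<lambda>x. synth K c x \<bullet> b) has_derivative
      (\<lambda>h. (\<chi> i. \<Sum>k\<in>K. 2 * pi * (lattice_vec k \<bullet> h) * Re (\<i> * c k $ i * expo k x)) \<bullet> b)) (at x)"
    unfolding b inner_axis by (simp only: synth_nth vec_lambda_beta inner_real_def mult_1_right)
qed

lemma differentiable_synth: "synth K c differentiable (at x)"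
  using pd_synth_full unfolding differentiable_def by blast

lemma pd_synth: "pd j (synth K c) = synth K (dcoef j c)"
proof (rule ext, rule vec_eq_iff[THEN iffD2], intro allI)
  fix x i
  have "pd j (synth K c) x $ i = pd j (\<lambda>x. synth K c x $ i) x"
    by (rule pd_nth[symmetric, OF differentiable_synth])
  also have "\<dots> = (\<Sum>k\<in>K. pd j (\<lambda>x. Re (c k $ i * expo k x)) x)"
    unfolding synth_nth
    by (rule pd_eqI[OF has_derivative_sum, THEN trans])
      (rule differentiable_rexp[unfolded frechet_derivative_works], simp add: pd_def)
  also have "\<dots> = synth K (dcoef j c) x $ i"
    unfolding synth_nth pd_rexp dcoef_nth by (simp only: mult.assoc)
  finally show "pd j (synth K c) x $ i = synth K (dcoef j c) x $ i" .
qed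

lemma Ck_synth: "Ck n (synth K c)"
proof (induction n arbitrary: c)
  case 0
  show ?case by (simp only: Ck.simps continuous_synth)
next
  case (Suc n)
  show ?case
    unfolding Ck.simps pd_synth using differentiable_synth Suc by blast
qed

lemma smooth_periodic_synth: "smooth_periodic (synth K c)"
  by (simp only: smooth_periodic_def periodic_synth Ck_synth simp_thms)

lemma periodic_pd:
  fixes f :: "real^3 \<Rightarrow> 'b::euclidean_space"
  assumes per: "periodic f" and diff: "\<And>x. f differentiable (at x)"
  shows "periodic (pd j f)"
  unfolding periodic_def
proof (intro allI)
  fix x k
  have shift: "f = (\<lambda>y. f (y + lattice_vec k))"
    using per by (simp add: periodic_def)
  have D: "(f has_derivative frechet_derivative f (at (x + lattice_vec k))) (at (x + lattice_vec k))"
    using diff by (simp add: frechet_derivative_works[symmetric])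
  have "((\<lambda>y. f (y + lattice_vec k)) has_derivative frechet_derivative f (at (x + lattice_vec k))) (at x)"
    by (rule has_derivative_compose[where f = "\<lambda>y. y + lattice_vec k" and f' = "\<lambda>h. h" and g = f])
      (use D in \<open>auto intro!: derivative_eq_intros\<close>)
  then have "(f has_derivative frechet_derivative f (at (x + lattice_vec k))) (at x)"
    by (subst shift)
  then show "pd j f (x + lattice_vec k) = pd j f x"
    by (subst pd_eqI[of f _ x]) (assumption, simp only: pd_def)
qed

lemma Ck_1_L2:
  fixes F :: field
  assumes "periodic F" "Ck 1 F"
  shows "F \<in> L2" "pd j F \<in> L2"
  by (intro continuous_periodic_L2 Ck_1D[OF assms(2)] assms(1) periodic_pd)+

lemma integral_nth:
  fixes F :: field
  assumes "integrable torus F"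
  shows "(\<integral>x. F x \<partial>torus) $ i = (\<integral>x. F x $ i \<partial>torus)"
  using integral_inner_left[of "axis i 1" torus F] assms by (simp add: inner_axis)

lemma l2inner_by_parts:
  fixes F G :: field
  assumes F: "periodic F" "Ck 1 F" and G: "periodic G" "Ck 1 G"
  shows "l2inner (pd j F) G = - l2inner F (pd j G)"
proof -
  have per: "periodic (\<lambda>x. F x $ i)" "periodic (\<lambda>x. G x $ i)" for i
    using F(1) G(1) by (simp_all add: periodic_def)
  have cF: "continuous_on UNIV (\<lambda>x. F x $ i)" "continuous_on UNIV (\<lambda>x. pd j F x $ i)" for i
    by (intro continuous_on_component Ck_1D[OF F(2)])+
  have cG: "continuous_on UNIV (\<lambda>x. G x $ i)" "continuous_on UNIV (\<lambda>x. pd j G x $ i)" for i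
    by (intro continuous_on_component Ck_1D[OF G(2)])+
  have "l2inner F (pd j G) = (\<Sum>i\<in>UNIV. \<integral>x. F x $ i * pd j G x $ i \<partial>torus)"
    unfolding l2inner_def inner_vec_def inner_real_def
    by (intro Bochner_Integration.integral_sum continuous_integrable_torus continuous_on_mult cF cG)
  also have "\<dots> = (\<Sum>i\<in>UNIV. - (\<integral>x. pd j F x $ i * G x $ i \<partial>torus))"
    using torus_integral_by_parts[OF per Ck_1_nth[OF F(2)] Ck_1_nth[OF G(2)]]
    by (simp only: pd_nth[OF Ck_1D(1)[OF F(2)]] pd_nth[OF Ck_1D(1)[OF G(2)]])
  also have "\<dots> = - (\<Sum>i\<in>UNIV. \<integral>x. pd j F x $ i * G x $ i \<partial>torus)"
    by (rule sum_negf)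
  also have "(\<Sum>i\<in>UNIV. \<integral>x. pd j F x $ i * G x $ i \<partial>torus) = l2inner (pd j F) G"
    unfolding l2inner_def inner_vec_def inner_real_def
    by (intro Bochner_Integration.integral_sum[symmetric] continuous_integrable_torus continuous_on_mult cF cG)
  finally show ?thesis by simp
qed

lemma inner_eqI_axis:
  fixes x y :: "complex^3"
  assumes "\<And>i c. x \<bullet> axis i c = y \<bullet> axis i c"
  shows "x = y"
proof (rule vec_eq_iff[THEN iffD2], intro allI)
  fix i
  have "(x $ i - y $ i) \<bullet> (x $ i - y $ i) = 0"
    using assms[of i "x $ i - y $ i"] by (simp add: inner_axis inner_diff_left)
  then show "x $ i = y $ i" by simp
qed

text \<open>Integrating by parts against a single mode moves the derivative onto the mode, where it
  is explicit.\<close>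

lemma fourier_pd:
  fixes F :: field
  assumes F: "periodic F" "Ck 1 F"
  shows "fourier (pd j F) k = dcoef j (fourier F) k"
proof (rule inner_eqI_axis)
  fix i c
  let ?c = "\<lambda>_::int^3. axis i c :: complex^3"
  have "fourier (pd j F) k \<bullet> axis i c = l2inner (pd j F) (synth {k} ?c)"
    by (simp add: l2inner_synth[OF Ck_1_L2(2)[OF F]])
  also have "\<dots> = - l2inner F (synth {k} (dcoef j ?c))"
    unfolding pd_synth[symmetric] by (intro l2inner_by_parts F periodic_synth Ck_synth)
  also have "\<dots> = dcoef j (fourier F) k \<bullet> axis i c"
    using dcoef_skew[of j "fourier F" k ?c] by (simp add: l2inner_synth[OF Ck_1_L2(1)[OF F]])
  finally show "fourier (pd j F) k \<bullet> axis i c = dcoef j (fourier F) k \<bullet> axis i c" .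
qed

subsection \<open>Solenoidal fields\<close>

text \<open>The symbol of the divergence up to the factor 2 pi i.\<close>

definition kdot :: "int^3 \<Rightarrow> complex^3 \<Rightarrow> complex" where
  "kdot k v = (\<Sum>i\<in>UNIV. of_int (k $ i) * v $ i)"

text \<open>Divergence-free and mean-free, read on coefficients. The distributional, the classical
  and the closure descriptions of these conditions all pass through this one.\<close>

definition solen :: "field \<Rightarrow> bool" where
  "solen f \<longleftrightarrow> fourier f 0 = 0 \<and> (\<forall>k. kdot k (fourier f k) = 0)"

lemma kdot_lincomb: "kdot k (a *\<^sub>R v + c *\<^sub>R w) = a *\<^sub>R kdot k v + c *\<^sub>R kdot k w"
  by (simp add: kdot_def sum.distrib scaleR_sum_right distrib_left)

lemma kdot_0 [simp]: "kdot k 0 = 0"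
  by (simp add: kdot_def)

lemma solen_lincomb:
  assumes "f \<in> L2" "g \<in> L2" "solen f" "solen g"
  shows "solen (\<lambda>x. a *\<^sub>R f x + c *\<^sub>R g x)"
  using assms(3,4) by (simp add: solen_def fourier_lincomb[OF assms(1,2)] kdot_lincomb)

lemma solen_diff: "f \<in> L2 \<Longrightarrow> g \<in> L2 \<Longrightarrow> solen f \<Longrightarrow> solen g \<Longrightarrow> solen (\<lambda>x. f x - g x)"
  using solen_lincomb[of f g 1 "-1"] by simp

lemma mean_free_iff:
  assumes "f \<in> L2"
  shows "mean_free f \<longleftrightarrow> fourier f 0 = 0"
proof -
  have "fourier f 0 $ i = complex_of_real ((\<integral>x. f x \<partial>torus) $ i)" for i
    unfolding fourier_nth integral_nth[OF L2_integrable[OF assms]] by simp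
  then show ?thesis
    by (simp add: mean_free_def vec_eq_iff)
qed

text \<open>Testing with real modes of amplitude c shows that Z =
  \<open>kdot k (fourier f k)\<close> is orthogonal, as a vector of the real plane, to every complex
  number.\<close>

lemma div_free_imp_kdot:
  assumes f: "f \<in> L2" and d: "div_free f"
  shows "kdot k (fourier f k) = 0"
proof -
  let ?Z = "kdot k (fourier f k)"
  have *: "Re (cnj (2 * pi * \<i> * c) * ?Z) = 0" for c
  proof -
    let ?c = "\<lambda>_::int^3. \<chi> i. complex_of_real (2 * pi * real_of_int (k $ i)) * \<i> * c :: complex^3"
    have "(\<integral>x. (\<Sum>i\<in>UNIV. f x $ i * pd i (\<lambda>x. Re (c * expo k x)) x) \<partial>torus) = 0"
      using d smooth_periodic_rexp unfolding div_free_def by blast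
    then have "l2inner f (synth {k} ?c) = 0"
      unfolding pd_rexp l2inner_def inner_vec_def synth_nth by (simp add: mult.assoc)
    then have "fourier f k \<bullet> ?c k = 0"
      by (simp add: l2inner_synth[OF f])
    moreover have "fourier f k \<bullet> ?c k = Re (cnj (2 * pi * \<i> * c) * ?Z)"
    proof -
      have "z \<bullet> (complex_of_real (2 * pi * real_of_int a) * \<i> * c) = Re (cnj (2 * pi * \<i> * c) * (of_int a * z))" for z a
        by (simp add: inner_complex_def algebra_simps)
      then show ?thesis
        unfolding inner_vec_def kdot_def vec_lambda_beta sum_distrib_left Re_sum by (intro sum.cong refl)
    qed
    ultimately show ?thesis by simp
  qed
  \<comment> \<open>The amplitude Z / (2 pi i) makes the tested expression equal to |Z|^2.\<close>
  have "(2 * pi * \<i>) * ((1 / (2 * pi * \<i>)) * ?Z) = ?Z" by simp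
  then have "cnj (2 * pi * \<i> * ((1 / (2 * pi * \<i>)) * ?Z)) * ?Z = cnj ?Z * ?Z" by simp
  then have "Re (cnj ?Z * ?Z) = 0" using *[of "(1 / (2 * pi * \<i>)) * ?Z"] by metis
  then have "(Re ?Z)\<^sup>2 + (Im ?Z)\<^sup>2 = 0" by (simp add: power2_eq_square)
  then show ?thesis by (simp add: complex_eq_iff sum_power2_eq_zero_iff)
qed

lemma div_free_imp_solen: "f \<in> L2 \<Longrightarrow> div_free f \<Longrightarrow> mean_free f \<Longrightarrow> solen f"
  by (simp add: solen_def mean_free_iff div_free_imp_kdot)

lemma smooth_sol_Ck: "f \<in> smooth_sol \<Longrightarrow> periodic f \<and> Ck 1 f"
  unfolding smooth_sol_def smooth_periodic_def by blast

lemma smooth_sol_L2: "f \<in> smooth_sol \<Longrightarrow> f \<in> L2"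
  using Ck_1_L2(1) smooth_sol_Ck by blast

lemma smooth_sol_kdot:
  assumes "f \<in> smooth_sol"
  shows "kdot k (fourier f k) = 0"
proof -
  have F: "periodic f" "Ck 1 f" using smooth_sol_Ck[OF assms] by auto
  have div: "(\<Sum>i\<in>UNIV. pd i f x $ i) = 0" for x
    using assms by (simp add: smooth_sol_def)
  have "(\<Sum>i\<in>UNIV. fourier (pd i f) k $ i) = (\<integral>x. (\<Sum>i\<in>UNIV. complex_of_real (pd i f x $ i) * expo (- k) x) \<partial>torus)"
    unfolding fourier_nth
    by (intro Bochner_Integration.integral_sum[symmetric] integrable_fourier Ck_1_L2(2)[OF F])
  also have "\<dots> = (\<integral>x. complex_of_real (\<Sum>i\<in>UNIV. pd i f x $ i) * expo (- k) x \<partial>torus)"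
    by (simp add: sum_distrib_right)
  also have "\<dots> = 0" unfolding div by simp
  finally have "(\<Sum>i\<in>UNIV. complex_of_real (2 * pi * real_of_int (k $ i)) * \<i> * fourier f k $ i) = 0"
    unfolding fourier_pd[OF F] dcoef_nth .
  moreover have "(\<Sum>i\<in>UNIV. complex_of_real (2 * pi * real_of_int (k $ i)) * \<i> * fourier f k $ i)
      = 2 * pi * \<i> * kdot k (fourier f k)"
    unfolding kdot_def sum_distrib_left by (intro sum.cong refl) simp
  ultimately show ?thesis by simp
qed

lemma smooth_sol_solen:
  assumes "f \<in> smooth_sol"
  shows "solen f"
proof -
  have "mean_free f" using assms by (simp add: smooth_sol_def)
  then show ?thesis
    using smooth_sol_kdot[OF assms] mean_free_iff[OF smooth_sol_L2[OF assms]] by (simp add: solen_def)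
qed

lemma summable_on_sum:
  fixes f :: "'i \<Rightarrow> 'a \<Rightarrow> real"
  shows "(\<And>j. j \<in> J \<Longrightarrow> f j summable_on A) \<Longrightarrow> (\<lambda>k. \<Sum>j\<in>J. f j k) summable_on A"
  by (induction J rule: infinite_finite_induct) (auto intro: summable_on_add)

text \<open>Parseval for the field and its first derivatives; order 1 covers every V^r with r <=
  1.\<close>

lemma smooth_sol_Sobolev:
  assumes "f \<in> smooth_sol"
  shows "f \<in> Sobolev 1"
proof -
  have F: "periodic f" "Ck 1 f" using smooth_sol_Ck[OF assms] by auto
  have "(\<lambda>k. (norm (fourier f k))\<^sup>2 + (\<Sum>j\<in>UNIV. (norm (fourier (pd j f) k))\<^sup>2)) summable_on UNIV"
    by (intro summable_on_add summable_on_sum fourier_summable Ck_1_L2[OF F])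
  also have "(\<lambda>k. (norm (fourier f k))\<^sup>2 + (\<Sum>j\<in>UNIV. (norm (fourier (pd j f) k))\<^sup>2))
      = (\<lambda>k. sweight 1 k * (norm (fourier f k))\<^sup>2)"
    unfolding fourier_pd[OF F] norm_dcoef by (simp add: freq_eq_sum sum_distrib_right distrib_right add_nonneg_nonneg sum_nonneg)
  finally show ?thesis
    unfolding Sobolev_eq_wspace wspace_def using smooth_sol_L2[OF assms] by simp
qed

text \<open>Truncation acts on each frequency separately, so it preserves \<open>solen\<close>; this
  supplies the smooth approximants in the closures \<open>Hspace\<close> and
  \<open>Vspace\<close>.\<close>

lemma trunc_smooth_sol:
  assumes "solen f"
  shows "trunc n f \<in> smooth_sol"
proof -
  have "(\<Sum>i\<in>UNIV. pd i (trunc n f) x $ i) = 0" for x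
  proof -
    have "(\<Sum>i\<in>UNIV. pd i (trunc n f) x $ i)
        = (\<Sum>k\<in>cube n. \<Sum>i\<in>UNIV. Re (complex_of_real (2 * pi * real_of_int (k $ i)) * \<i> * fourier f k $ i * expo k x))"
      unfolding pd_synth synth_nth dcoef_nth by (rule sum.swap)
    also have "\<dots> = (\<Sum>k\<in>cube n. Re (2 * pi * \<i> * kdot k (fourier f k) * expo k x))"
      unfolding kdot_def sum_distrib_left sum_distrib_right Re_sum
      by (intro sum.cong refl arg_cong[where f = Re]) simp
    also have "\<dots> = 0" using assms by (simp add: solen_def)
    finally show ?thesis .
  qed
  moreover have "mean_free (trunc n f)"
    using assms mean_free_iff[OF synth_L2] by (simp add: fourier_trunc solen_def)
  ultimately show ?thesis
    by (simp add: smooth_sol_def smooth_periodic_synth)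
qed

lemma solen_closed:
  assumes f: "f \<in> L2" and ex: "\<And>e. e > 0 \<Longrightarrow> \<exists>g\<in>L2. solen g \<and> l2norm (\<lambda>x. f x - g x) < e"
  shows "solen f"
proof -
  have "\<exists>g. \<forall>n. g n \<in> L2 \<and> solen (g n) \<and> l2norm (\<lambda>x. f x - g n x) < 1 / real (Suc n)"
    using ex by (intro choice allI) (metis of_nat_0_less_iff zero_less_Suc zero_less_divide_1_iff)
  then obtain g where g: "\<And>n. g n \<in> L2" "\<And>n. solen (g n)" "\<And>n. l2norm (\<lambda>x. f x - g n x) < 1 / real (Suc n)"
    by blast
  have lim: "(\<lambda>n. fourier (g n) k) \<longlonglongrightarrow> fourier f k" for k
  proof (rule LIM_zero_cancel, rule Lim_null_comparison)
    show "(\<lambda>n. 3 * (1 / real (Suc n))) \<longlonglongrightarrow> 0"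
      using tendsto_mult_left[OF LIMSEQ_Suc[OF lim_1_over_n[where 'a = real]], of 3] by simp
    have "norm (fourier (g n) k - fourier f k) \<le> 3 * (1 / real (Suc n))" for n
    proof -
      have "norm (fourier f k - fourier (g n) k) \<le> 3 * l2norm (\<lambda>x. f x - g n x)"
        unfolding fourier_diff[OF f g(1), symmetric] by (rule norm_fourier_le[OF L2_diff[OF f g(1)]])
      also have "\<dots> \<le> 3 * (1 / real (Suc n))" using g(3)[of n] by simp
      finally show ?thesis by (simp add: norm_minus_commute)
    qed
    then show "eventually (\<lambda>n. norm (fourier (g n) k - fourier f k) \<le> 3 * (1 / real (Suc n))) sequentially"
      by simp
  qed
  have "fourier f 0 = 0"
    using LIMSEQ_unique[OF lim[of 0]] g(2) by (simp add: solen_def)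
  moreover have "kdot k (fourier f k) = 0" for k
  proof -
    have "(\<lambda>n. kdot k (fourier (g n) k)) \<longlonglongrightarrow> kdot k (fourier f k)"
      unfolding kdot_def by (intro tendsto_intros tendsto_vec_nth lim)
    then show ?thesis
      using g(2) LIMSEQ_unique[OF _ tendsto_const] by (simp add: solen_def)
  qed
  ultimately show ?thesis by (simp add: solen_def)
qed

text \<open>One inclusion is the closedness of \<open>solen\<close> in L2, the other is
  approximation by truncations.\<close>

lemma Hspace_iff: "f \<in> Hspace \<longleftrightarrow> f \<in> L2 \<and> solen f"
proof
  assume "f \<in> Hspace"
  then have f: "f \<in> L2" and ex: "\<And>e. e > 0 \<Longrightarrow> \<exists>\<phi>\<in>smooth_sol. l2norm (\<lambda>x. f x - \<phi> x) < e"
    by (auto simp: Hspace_def)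
  have "solen f"
    using ex smooth_sol_solen smooth_sol_L2 by (intro solen_closed[OF f]) meson
  with f show "f \<in> L2 \<and> solen f" by blast
next
  assume f: "f \<in> L2 \<and> solen f"
  have "\<exists>\<phi>\<in>smooth_sol. l2norm (\<lambda>x. f x - \<phi> x) < e" if "e > 0" for e
  proof -
    have "eventually (\<lambda>n. l2norm (\<lambda>x. trunc n f x - f x) < e) sequentially"
      using trunc_tendsto_L2 f that by (intro order_tendstoD) auto
    then obtain n where "l2norm (\<lambda>x. trunc n f x - f x) < e"
      by (meson eventually_sequentially order_refl)
    then show ?thesis
      using trunc_smooth_sol f by (subst (asm) l2norm_minus_commute) blast
  qed
  then show "f \<in> Hspace" using f by (simp add: Hspace_def)
qed

lemma Vspace_iff:
  assumes r: "0 \<le> r" "r \<le> 1"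
  shows "f \<in> Vspace r \<longleftrightarrow> f \<in> Sobolev r \<and> solen f"
proof
  assume "f \<in> Vspace r"
  then have f: "f \<in> Sobolev r" and ex: "\<And>e. e > 0 \<Longrightarrow> \<exists>\<phi>\<in>smooth_sol. hsnorm r (\<lambda>x. f x - \<phi> x) < e"
    by (auto simp: Vspace_def)
  have "solen f"
  proof (rule solen_closed[OF Sobolev_L2[OF f]])
    fix e :: real assume "e > 0"
    then obtain \<phi> where p: "\<phi> \<in> smooth_sol" "hsnorm r (\<lambda>x. f x - \<phi> x) < e" using ex by blast
    \<comment> \<open>Membership has to come first: outside \<open>Sobolev r\<close> the divergent
      sum has the default value 0, and \<open>hsnorm r\<close> would bound nothing.\<close>
    have "\<phi> \<in> Sobolev r" using Sobolev_mono[OF r(2)] smooth_sol_Sobolev[OF p(1)] by blast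
    then have "l2norm (\<lambda>x. f x - \<phi> x) < e"
      using l2norm_le_hsnorm[OF r(1) Sobolev_diff[OF f]] p(2) by fastforce
    then show "\<exists>g\<in>L2. solen g \<and> l2norm (\<lambda>x. f x - g x) < e"
      using smooth_sol_L2[OF p(1)] smooth_sol_solen[OF p(1)] by blast
  qed
  with f show "f \<in> Sobolev r \<and> solen f" by blast
next
  assume f: "f \<in> Sobolev r \<and> solen f"
  have "\<exists>\<phi>\<in>smooth_sol. hsnorm r (\<lambda>x. f x - \<phi> x) < e" if "e > 0" for e
  proof -
    have "eventually (\<lambda>n. hsnorm r (\<lambda>x. trunc n f x - f x) < e) sequentially"
      using trunc_tendsto_hsnorm f that by (intro order_tendstoD) auto
    then obtain n where "hsnorm r (\<lambda>x. trunc n f x - f x) < e"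
      by (meson eventually_sequentially order_refl)
    then show ?thesis
      using trunc_smooth_sol f hsnorm_minus_commute[OF trunc_Sobolev conjunct1[OF f]] by metis
  qed
  then show "f \<in> Vspace r" using f by (simp add: Vspace_def)
qed

subsection \<open>Weak derivatives\<close>

definition weak_deriv :: "3 \<Rightarrow> field \<Rightarrow> field \<Rightarrow> bool" where
  "weak_deriv j f g \<longleftrightarrow> g \<in> L2 \<and>
     (\<forall>\<psi> :: real^3 \<Rightarrow> real. smooth_periodic \<psi> \<longrightarrow>
        (\<integral>x. \<psi> x *\<^sub>R g x \<partial>torus) = - (\<integral>x. pd j \<psi> x *\<^sub>R f x \<partial>torus))"

lemma smooth_periodicD:
  assumes "smooth_periodic \<psi>"
  shows "periodic \<psi>" "Ck 1 \<psi>"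
  using assms unfolding smooth_periodic_def by blast+

lemma scaleR_axis_C1:
  fixes \<psi> :: "real^3 \<Rightarrow> real" and i :: 3
  assumes "Ck 1 \<psi>"
  shows "pd j (\<lambda>x. \<psi> x *\<^sub>R axis i 1 :: real^3) = (\<lambda>x. pd j \<psi> x *\<^sub>R axis i 1)"
    and "Ck 1 (\<lambda>x. \<psi> x *\<^sub>R axis i 1 :: real^3)"
proof -
  have D: "((\<lambda>x. \<psi> x *\<^sub>R axis i 1 :: real^3) has_derivative (\<lambda>h. frechet_derivative \<psi> (at x) h *\<^sub>R axis i 1)) (at x)" for x
    using Ck_1D(1)[OF assms] by (intro has_derivative_scaleR_left) (simp add: frechet_derivative_works[symmetric])
  show pd: "pd j (\<lambda>x. \<psi> x *\<^sub>R axis i 1 :: real^3) = (\<lambda>x. pd j \<psi> x *\<^sub>R axis i 1)" for j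
    by (rule ext, subst pd_eqI[OF D]) (simp only: pd_def)
  have "continuous_on UNIV (\<lambda>x. pd j \<psi> x *\<^sub>R axis i 1 :: real^3)" for j
    by (intro continuous_on_scaleR Ck_1D(2)[OF assms] continuous_on_const)
  moreover have "(\<lambda>x. \<psi> x *\<^sub>R axis i 1 :: real^3) differentiable (at x)" for x
    using D unfolding differentiable_def by blast
  ultimately show "Ck 1 (\<lambda>x. \<psi> x *\<^sub>R axis i 1 :: real^3)"
    by (simp only: One_nat_def Ck.simps pd simp_thms)
qed

lemma L2_scaleR_integrable:
  fixes \<psi> :: "real^3 \<Rightarrow> real" and g :: field
  assumes "\<psi> \<in> L2" "g \<in> L2"
  shows "integrable torus (\<lambda>x. \<psi> x *\<^sub>R g x)"
proof (rule Bochner_Integration.integrable_bound)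
  show "integrable torus (\<lambda>x. (norm (\<psi> x))\<^sup>2 + (norm (g x))\<^sup>2)"
    using assms by (intro Bochner_Integration.integrable_add L2_sq_integrable)
  show "(\<lambda>x. \<psi> x *\<^sub>R g x) \<in> borel_measurable torus"
    using L2_measurable[OF assms(1)] L2_measurable[OF assms(2)] by measurable
  have "norm (\<psi> x *\<^sub>R g x) \<le> (norm (\<psi> x))\<^sup>2 + (norm (g x))\<^sup>2" for x
    using sum_squares_bound[of "norm (\<psi> x)" "norm (g x)"]
      mult_nonneg_nonneg[OF norm_ge_zero[of "\<psi> x"] norm_ge_zero[of "g x"]]
    unfolding norm_scaleR real_norm_def by linarith
  then show "AE x in torus. norm (\<psi> x *\<^sub>R g x) \<le> norm ((norm (\<psi> x))\<^sup>2 + (norm (g x))\<^sup>2)"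
    by (intro AE_I2) simp
qed

text \<open>Converts scalar test functions, as in the definition of \<open>wderiv\<close>, into test
  fields psi e_i, to which Parseval applies.\<close>

lemma integral_scaleR_nth:
  fixes \<psi> :: "real^3 \<Rightarrow> real" and g :: field
  assumes "\<psi> \<in> L2" "g \<in> L2"
  shows "(\<integral>x. \<psi> x *\<^sub>R g x \<partial>torus) $ i = l2inner g (\<lambda>x. \<psi> x *\<^sub>R axis i 1)"
  unfolding integral_nth[OF L2_scaleR_integrable[OF assms]] l2inner_def
  by (simp add: inner_axis mult.commute)

lemma real_C1_L2:
  fixes \<psi> :: "real^3 \<Rightarrow> real"
  assumes "periodic \<psi>" "Ck 1 \<psi>"
  shows "\<psi> \<in> L2" "pd j \<psi> \<in> L2"
  by (intro continuous_periodic_L2 Ck_1D[OF assms(2)] assms(1) periodic_pd)+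

text \<open>Forward, the defining identity is tested with single modes; backward, it is Parseval
  combined with \<open>dcoef_skew\<close>.\<close>

lemma weak_deriv_iff:
  assumes f: "f \<in> L2" and g: "g \<in> L2"
  shows "weak_deriv j f g \<longleftrightarrow> (\<forall>k. fourier g k = dcoef j (fourier f) k)"
proof
  assume w: "weak_deriv j f g"
  show "\<forall>k. fourier g k = dcoef j (fourier f) k"
  proof (intro allI inner_eqI_axis)
    fix k i c
    let ?c = "\<lambda>_::int^3. axis i c :: complex^3"
    let ?\<psi> = "\<lambda>x. Re (c * expo k x)"
    have \<psi>: "periodic ?\<psi>" "Ck 1 ?\<psi>" by (rule periodic_rexp, rule Ck_rexp)
    have 1: "(\<lambda>x. ?\<psi> x *\<^sub>R axis i 1) = synth {k} ?c"
      by (rule ext) (simp add: vec_eq_iff synth_nth axis_def)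
    have 2: "(\<lambda>x. pd j ?\<psi> x *\<^sub>R axis i 1) = synth {k} (dcoef j ?c)"
      unfolding scaleR_axis_C1(1)[OF \<psi>(2), symmetric] 1 pd_synth ..
    have "(\<integral>x. ?\<psi> x *\<^sub>R g x \<partial>torus) = - (\<integral>x. pd j ?\<psi> x *\<^sub>R f x \<partial>torus)"
      using w smooth_periodic_rexp[of c k] unfolding weak_deriv_def by blast
    then have "(\<integral>x. ?\<psi> x *\<^sub>R g x \<partial>torus) $ i = - (\<integral>x. pd j ?\<psi> x *\<^sub>R f x \<partial>torus) $ i"
      by (simp only: vector_uminus_component)
    then have "l2inner g (synth {k} ?c) = - l2inner f (synth {k} (dcoef j ?c))"
      unfolding integral_scaleR_nth[OF real_C1_L2(1)[OF \<psi>] g] integral_scaleR_nth[OF real_C1_L2(2)[OF \<psi>] f] 1 2 .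
    then have "fourier g k \<bullet> axis i c = - (fourier f k \<bullet> dcoef j ?c k)"
      by (simp add: l2inner_synth[OF f] l2inner_synth[OF g])
    then show "fourier g k \<bullet> axis i c = dcoef j (fourier f) k \<bullet> axis i c"
      using dcoef_skew[of j "fourier f" k ?c] by simp
  qed
next
  assume eq: "\<forall>k. fourier g k = dcoef j (fourier f) k"
  have "(\<integral>x. \<psi> x *\<^sub>R g x \<partial>torus) = - (\<integral>x. pd j \<psi> x *\<^sub>R f x \<partial>torus)"
    if "smooth_periodic \<psi>" for \<psi> :: "real^3 \<Rightarrow> real"
  proof (rule vec_eq_iff[THEN iffD2], intro allI)
    fix i
    note \<psi> = smooth_periodicD[OF that]
    let ?\<Psi> = "\<lambda>x. \<psi> x *\<^sub>R axis i 1 :: real^3"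
    have per: "periodic ?\<Psi>" using \<psi>(1) by (simp add: periodic_def)
    note C1 = scaleR_axis_C1(2)[OF \<psi>(2)]
    have "(\<integral>x. \<psi> x *\<^sub>R g x \<partial>torus) $ i = l2inner g ?\<Psi>"
      by (rule integral_scaleR_nth[OF real_C1_L2(1)[OF \<psi>] g])
    also have "\<dots> = (\<Sum>\<^sub>\<infinity>k. - (fourier f k \<bullet> fourier (pd j ?\<Psi>) k))"
      unfolding Parseval(2)[OF g Ck_1_L2(1)[OF per C1]] fourier_pd[OF per C1]
      using eq by (simp only: dcoef_skew)
    also have "\<dots> = - l2inner f (pd j ?\<Psi>)"
      unfolding Parseval(2)[OF f Ck_1_L2(2)[OF per C1]] by (rule infsum_uminus)
    also have "l2inner f (pd j ?\<Psi>) = (\<integral>x. pd j \<psi> x *\<^sub>R f x \<partial>torus) $ i"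
      unfolding scaleR_axis_C1(1)[OF \<psi>(2)]
      by (rule integral_scaleR_nth[OF real_C1_L2(2)[OF \<psi>] f, symmetric])
    finally show "(\<integral>x. \<psi> x *\<^sub>R g x \<partial>torus) $ i = (- (\<integral>x. pd j \<psi> x *\<^sub>R f x \<partial>torus)) $ i"
      by simp
  qed
  then show "weak_deriv j f g"
    unfolding weak_deriv_def using g by blast
qed

lemma sweight_Suc: "sweight (s + 1) k = sweight s k * (1 + freq k)"
proof -
  have "1 + freq k > 0" using freq_nonneg[of k] by linarith
  then show ?thesis by (simp add: powr_add)
qed

lemma dcoef_weight_le:
  "sweight s k * (norm (dcoef j c k))\<^sup>2 \<le> sweight (s + 1) k * (norm (c k))\<^sup>2"
proof -
  have "(2 * pi * real_of_int (k $ j))\<^sup>2 \<le> 1 + freq k"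
    using dcoef_freq_le[of k j] by linarith
  then have "sweight s k * ((2 * pi * real_of_int (k $ j))\<^sup>2 * (norm (c k))\<^sup>2) \<le> sweight s k * ((1 + freq k) * (norm (c k))\<^sup>2)"
    by (intro mult_left_mono mult_right_mono) simp_all
  then show ?thesis
    unfolding norm_dcoef sweight_Suc by (simp only: mult.assoc)
qed

lemma sweight_ge_1: "0 \<le> s \<Longrightarrow> 1 \<le> sweight s k"
  by (rule ge_one_powr_ge_zero) simp_all

text \<open>One order of the weight pays for the factor 2 pi k_j, so Riesz-Fischer produces a weak
  derivative and the choice in \<open>wderiv\<close> is a genuine one.\<close>

lemma wderiv_Sobolev:
  assumes s: "0 \<le> s" and f: "f \<in> Sobolev (s + 1)"
  shows "wderiv j f \<in> Sobolev s" "fourier (wderiv j f) k = dcoef j (fourier f) k"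
    "hsnorm s (wderiv j f) \<le> hsnorm (s + 1) f"
proof -
  have fL: "f \<in> L2" by (rule Sobolev_L2[OF f])
  have fs: "(\<lambda>k. sweight (s + 1) k * (norm (fourier f k))\<^sup>2) summable_on UNIV"
    using f unfolding Sobolev_eq_wspace by (rule wspace_summable)
  have sm: "(\<lambda>k. sweight s k * (norm (dcoef j (fourier f) k))\<^sup>2) summable_on UNIV"
  proof (rule summable_on_comparison_test[OF fs])
    show "sweight s k * (norm (dcoef j (fourier f) k))\<^sup>2 \<le> sweight (s + 1) k * (norm (fourier f k))\<^sup>2" for k
      by (rule dcoef_weight_le)
  qed simp
  have "(\<lambda>k. (norm (dcoef j (fourier f) k))\<^sup>2) summable_on UNIV"
  proof (rule summable_on_comparison_test[OF sm])
    show "(norm (dcoef j (fourier f) k))\<^sup>2 \<le> sweight s k * (norm (dcoef j (fourier f) k))\<^sup>2" for k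
      using mult_right_mono[OF sweight_ge_1[OF s, of k], of "(norm (dcoef j (fourier f) k))\<^sup>2"] by simp
  qed simp
  from Riesz_Fischer[OF hermitian_dcoef[OF hermitian_fourier] this]
  obtain g where "g \<in> L2" "\<And>k. fourier g k = dcoef j (fourier f) k" by blast
  then have "\<exists>g. weak_deriv j f g"
    using weak_deriv_iff[OF fL] by blast
  then have w: "weak_deriv j f (wderiv j f)"
    unfolding wderiv_def weak_deriv_def by (rule someI_ex)
  then have L: "wderiv j f \<in> L2" by (simp only: weak_deriv_def)
  show *: "fourier (wderiv j f) k = dcoef j (fourier f) k" for k
    using w weak_deriv_iff[OF fL L] by blast
  show "wderiv j f \<in> Sobolev s"
    unfolding Sobolev_eq_wspace wspace_def using sm L by (simp add: *)
  show "hsnorm s (wderiv j f) \<le> hsnorm (s + 1) f"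
    unfolding hsnorm_eq_wform wform_def power2_norm_eq_inner[symmetric] *
    using sm fs dcoef_weight_le by (intro real_sqrt_le_mono infsum_mono)
qed

lemma wderiv_eq_pd:
  assumes "f \<in> Sobolev 1" "periodic f" "Ck 1 f"
  shows "AE x in torus. wderiv j f x = pd j f x"
proof (rule L2_eqI_fourier)
  show "wderiv j f \<in> L2" using wderiv_Sobolev(1)[of 0 f j] assms(1) Sobolev_L2 by simp
  show "pd j f \<in> L2" by (rule Ck_1_L2(2)[OF assms(2,3)])
  show "fourier (wderiv j f) k = fourier (pd j f) k" for k
    using wderiv_Sobolev(2)[of 0 f j k] assms(1) fourier_pd[OF assms(2,3), of j k] by simp
qed

subsection \<open>The Leray projection\<close>

text \<open>The symbol of the Leray projection: the orthogonal projection onto the complement of k,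
  with value 0 at k = 0 to remove the mean.\<close>

definition lproj :: "int^3 \<Rightarrow> complex^3 \<Rightarrow> complex^3" where
  "lproj k v = (if k = 0 then 0
     else (\<chi> i. v $ i - kdot k v / complex_of_real ((norm (lattice_vec k))\<^sup>2) * of_int (k $ i)))"

lemma norm_lattice_vec: "complex_of_real ((norm (lattice_vec k))\<^sup>2) = (\<Sum>i\<in>UNIV. of_int (k $ i) * of_int (k $ i))"
  unfolding power2_norm_eq_inner inner_vec_def by simp

lemma lattice_vec_eq_0: "lattice_vec k = 0 \<longleftrightarrow> k = 0"
  by (simp add: vec_eq_iff)

lemma kdot_lproj: "kdot k (lproj k v) = 0"
proof (cases "k = 0")
  case False
  let ?n = "complex_of_real ((norm (lattice_vec k))\<^sup>2)"
  have n: "?n \<noteq> 0" using False by (simp add: lattice_vec_eq_0)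
  have "kdot k (\<chi> i. v $ i - z * of_int (k $ i)) = kdot k v - z * (\<Sum>i\<in>UNIV. of_int (k $ i) * of_int (k $ i))" for z
    unfolding kdot_def vec_lambda_beta sum_distrib_left sum_subtractf[symmetric]
    by (intro sum.cong refl) (simp add: algebra_simps)
  then have "kdot k (lproj k v) = kdot k v - kdot k v / ?n * (\<Sum>i\<in>UNIV. of_int (k $ i) * of_int (k $ i))"
    using False by (simp only: lproj_def if_False)
  then show ?thesis unfolding norm_lattice_vec[symmetric] using n by simp
qed (simp add: lproj_def)

text \<open>The residual is a multiple of k; at k = 0 it is all of v, hence the second
  hypothesis.\<close>

lemma lproj_orthogonal:
  assumes "kdot k y = 0" "k = 0 \<Longrightarrow> y = 0"
  shows "(v - lproj k v) \<bullet> y = 0"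
proof (cases "k = 0")
  case False
  let ?z = "kdot k v / complex_of_real ((norm (lattice_vec k))\<^sup>2)"
  have in1: "(z * of_int a) \<bullet> x = Re (z * cnj (of_int a * x))" for z x a
    by (simp add: inner_complex_def algebra_simps)
  have "v - lproj k v = (\<chi> i. ?z * of_int (k $ i))"
    unfolding lproj_def if_not_P[OF False] by (rule vec_eq_iff[THEN iffD2]) simp
  then have "(v - lproj k v) \<bullet> y = (\<Sum>i\<in>UNIV. Re (?z * cnj (of_int (k $ i) * y $ i)))"
    by (simp only: inner_vec_def vec_lambda_beta in1)
  also have "\<dots> = Re (?z * cnj (kdot k y))"
    unfolding kdot_def cnj_sum sum_distrib_left Re_sum ..
  finally show ?thesis using assms(1) by simp
qed (use assms in simp)

lemma norm_lproj_le: "norm (lproj k v) \<le> norm v"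
proof -
  let ?p = "lproj k v"
  have "(v - ?p) \<bullet> ?p = 0"
    by (rule lproj_orthogonal[OF kdot_lproj]) (simp add: lproj_def)
  then have "norm ?p * norm ?p = v \<bullet> ?p"
    by (simp add: inner_diff_left power2_norm_eq_inner[symmetric] power2_eq_square)
  also have "\<dots> \<le> norm v * norm ?p" by (rule norm_cauchy_schwarz)
  finally show ?thesis
    by (cases "norm ?p = 0") (simp_all add: mult_le_cancel_right)
qed

lemma hermitian_lproj:
  assumes "hermitian c"
  shows "hermitian (\<lambda>k. lproj k (c k))"
proof -
  have "kdot (- k) (c (- k)) = - cnj (kdot k (c k))" for k
    using assms unfolding kdot_def hermitian_def by (simp add: sum_negf)
  then show ?thesis
    using assms unfolding hermitian_def lproj_def by simp
qed

text \<open>Justifies the choice in \<open>leray\<close>: the Fourier multiplier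
  \<open>lproj\<close> yields a field with the defining orthogonality.\<close>

lemma leray_exists:
  assumes f: "f \<in> L2"
  shows "\<exists>h. h \<in> Hspace \<and> (\<forall>w\<in>Hspace. l2inner (\<lambda>x. f x - h x) w = 0)"
proof -
  have "(\<lambda>k. (norm (lproj k (fourier f k)))\<^sup>2) summable_on UNIV"
    by (rule summable_on_comparison_test[OF fourier_summable[OF f]])
      (simp_all add: norm_lproj_le power_mono)
  from Riesz_Fischer[OF hermitian_lproj[OF hermitian_fourier] this]
  obtain h where h: "h \<in> L2" "\<And>k. fourier h k = lproj k (fourier f k)" by blast
  have "h \<in> Hspace"
    unfolding Hspace_iff solen_def using h by (simp add: kdot_lproj) (simp add: lproj_def)
  moreover have "l2inner (\<lambda>x. f x - h x) w = 0" if "w \<in> Hspace" for w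
  proof -
    have w: "w \<in> L2" "solen w" using that by (simp_all add: Hspace_iff)
    have "(fourier f k - lproj k (fourier f k)) \<bullet> fourier w k = 0" for k
      using w(2) by (intro lproj_orthogonal) (auto simp: solen_def)
    then show ?thesis
      unfolding Parseval(2)[OF L2_diff[OF f h(1)] w(1)] fourier_diff[OF f h(1)] h(2) by simp
  qed
  ultimately show ?thesis by blast
qed

lemma leray_Hspace:
  assumes "f \<in> L2"
  shows "leray f \<in> Hspace"
  unfolding leray_def using someI_ex[OF leray_exists[OF assms]] by blast

lemma Hspace_L2: "f \<in> Hspace \<Longrightarrow> f \<in> L2"
  by (simp add: Hspace_iff)

lemma leray_inner:
  assumes "f \<in> L2" "w \<in> Hspace"
  shows "l2inner (leray f) w = l2inner f w"
proof -
  have "l2inner (\<lambda>x. f x - leray f x) w = 0"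
    unfolding leray_def using someI_ex[OF leray_exists[OF assms(1)]] assms(2) by blast
  then show ?thesis
    using l2inner_diff_left[OF assms(1) Hspace_L2[OF leray_Hspace[OF assms(1)]] Hspace_L2[OF assms(2)]] by simp
qed

lemma Hspace_diff: "f \<in> Hspace \<Longrightarrow> g \<in> Hspace \<Longrightarrow> (\<lambda>x. f x - g x) \<in> Hspace"
  by (simp add: Hspace_iff L2_diff solen_diff)

lemma leray_self:
  assumes f: "f \<in> Hspace"
  shows "AE x in torus. leray f x = f x"
proof -
  note fL = Hspace_L2[OF f]
  note h = leray_Hspace[OF fL]
  have d: "(\<lambda>x. leray f x - f x) \<in> Hspace" by (rule Hspace_diff[OF h f])
  have "l2inner (\<lambda>x. leray f x - f x) (\<lambda>x. leray f x - f x) = 0"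
    unfolding l2inner_diff_left[OF Hspace_L2[OF h] fL Hspace_L2[OF d]] leray_inner[OF fL d] by simp
  then have "AE x in torus. leray f x - f x = 0"
    by (intro l2norm_eq_0_AE Hspace_L2[OF d]) (simp add: l2norm_eq)
  then show ?thesis by eventually_elim simp
qed

lemma fourier_cong_AE:
  assumes "f \<in> L2" "g \<in> L2" "AE x in torus. f x = g x"
  shows "fourier f k = fourier g k"
proof -
  have "l2norm (\<lambda>x. f x - g x) = l2norm (\<lambda>x. 0)"
    using assms(3) by (intro l2norm_cong_AE L2_diff assms L2_zero) (auto elim: eventually_mono)
  also have "\<dots> = 0" by (simp add: l2norm_def)
  finally have "norm (fourier f k - fourier g k) \<le> 0"
    using norm_fourier_le[OF L2_diff[OF assms(1,2)], of k] by (simp add: fourier_diff[OF assms(1,2)])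
  then show ?thesis by simp
qed

subsection \<open>Fractional powers of the Stokes operator\<close>

lemma fourier_zero [simp]: "fourier (\<lambda>_. 0) k = 0"
  by (simp add: vec_eq_iff fourier_nth)

lemma fourier_sum:
  assumes "\<And>i. i \<in> I \<Longrightarrow> f i \<in> L2"
  shows "fourier (\<lambda>x. \<Sum>i\<in>I. f i x) k = (\<Sum>i\<in>I. fourier (f i) k)"
  using assms
proof (induction I rule: infinite_finite_induct)
  case (insert i I)
  have "fourier (\<lambda>x. f i x + (\<Sum>i\<in>I. f i x)) k = fourier (f i) k + fourier (\<lambda>x. \<Sum>i\<in>I. f i x) k"
    using fourier_lincomb[of "f i" "\<lambda>x. \<Sum>i\<in>I. f i x" 1 1] L2_sum[of I f] insert.prems by simp
  then show ?case using insert by simp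
qed simp_all

lemma dcoef_dcoef: "dcoef j (dcoef j c) k = - ((2 * pi * real_of_int (k $ j))\<^sup>2) *\<^sub>R c k"
proof -
  have "complex_of_real a * \<i> * (complex_of_real a * \<i> * z) = - (a\<^sup>2) *\<^sub>R z" for a z
    by (simp add: complex_eq_iff power2_eq_square algebra_simps)
  then show ?thesis
    by (simp only: vec_eq_iff dcoef_nth vector_scaleR_component simp_thms)
qed

lemma laplacian_Sobolev:
  assumes "f \<in> Sobolev 2"
  shows "laplacian f \<in> L2" "fourier (laplacian f) k = - freq k *\<^sub>R fourier f k"
proof -
  have 1: "wderiv j f \<in> Sobolev (0 + 1)" and 2: "fourier (wderiv j f) = dcoef j (fourier f)" for j
    using wderiv_Sobolev(1,2)[of 1 f j] assms by (simp_all add: fun_eq_iff)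
  note d = wderiv_Sobolev(1,2)[OF order_refl 1]
  have L: "wderiv j (wderiv j f) \<in> L2" for j by (rule Sobolev_L2[OF d(1)])
  show "laplacian f \<in> L2"
    unfolding laplacian_def by (intro L2_sum L)
  have "fourier (laplacian f) k = (\<Sum>j\<in>UNIV. dcoef j (dcoef j (fourier f)) k)"
    unfolding laplacian_def fourier_sum[OF L] d(2) 2 ..
  also have "\<dots> = - freq k *\<^sub>R fourier f k"
    unfolding dcoef_dcoef freq_eq_sum by (simp add: scaleR_sum_left sum_negf)
  finally show "fourier (laplacian f) k = - freq k *\<^sub>R fourier f k" .
qed

lemma kdot_scaleR: "kdot k (a *\<^sub>R v) = a *\<^sub>R kdot k v"
  using kdot_lincomb[of k a v 0 v] by simp

text \<open>The symbol of A^r, the eigenvalue of A at frequency k being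
  \<open>freq k\<close>.\<close>

definition fweight :: "real \<Rightarrow> int^3 \<Rightarrow> real" where
  "fweight r k = freq k powr r"

lemma fweight_nonneg: "0 \<le> fweight r k"
  by (simp add: fweight_def)

lemma fweight_le_sweight: "0 \<le> r \<Longrightarrow> fweight r k \<le> sweight r k"
  unfolding fweight_def by (rule powr_mono2) simp_all

text \<open>A power of A defined without an eigenbasis. It is applied with exponent r / 2: a field
  in \<open>Sobolev r\<close> has an L2 image under the half power, and pairing two such images
  gives the form of A^r.\<close>

definition frac_stokes :: "real \<Rightarrow> field \<Rightarrow> field" where
  "frac_stokes r f = (SOME g. g \<in> L2 \<and> (\<forall>k. fourier g k = fweight r k *\<^sub>R fourier f k))"

lemma fweight_half: "fweight (r / 2) k * fweight (r / 2) k = fweight r k"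
  unfolding fweight_def by (simp add: powr_add[symmetric])

lemma frac_stokes:
  assumes r: "0 \<le> r" and f: "f \<in> Sobolev r"
  shows "frac_stokes (r / 2) f \<in> L2" "fourier (frac_stokes (r / 2) f) k = fweight (r / 2) k *\<^sub>R fourier f k"
proof -
  let ?c = "\<lambda>k. fweight (r / 2) k *\<^sub>R fourier f k"
  have "hermitian ?c"
    using hermitian_fourier[of f] fweight_def by (simp add: hermitian_def freq_def)
  moreover have "(\<lambda>k. (norm (?c k))\<^sup>2) summable_on UNIV"
  proof (rule summable_on_comparison_test)
    show "(\<lambda>k. sweight r k * (norm (fourier f k))\<^sup>2) summable_on UNIV"
      using f unfolding Sobolev_eq_wspace by (rule wspace_summable)
    show "(norm (?c k))\<^sup>2 \<le> sweight r k * (norm (fourier f k))\<^sup>2" for k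
      using mult_right_mono[OF fweight_le_sweight[OF r, of k], of "(norm (fourier f k))\<^sup>2"]
      unfolding norm_scaleR power_mult_distrib power2_abs
      by (simp only: power2_eq_square[of "fweight (r / 2) k"] fweight_half) simp
  qed simp
  ultimately have "\<exists>g. g \<in> L2 \<and> (\<forall>k. fourier g k = ?c k)"
    using Riesz_Fischer by blast
  from someI_ex[OF this] show "frac_stokes (r / 2) f \<in> L2" "fourier (frac_stokes (r / 2) f) k = ?c k"
    unfolding frac_stokes_def by blast+
qed

lemma frac_stokes_Hspace:
  assumes "0 \<le> r" "f \<in> Sobolev r" "solen f"
  shows "frac_stokes (r / 2) f \<in> Hspace"
  using assms(3) frac_stokes[OF assms(1,2)] by (simp add: Hspace_iff solen_def kdot_scaleR)

lemma l2inner_frac_stokes: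
  assumes "0 \<le> r" "f \<in> Sobolev r" "g \<in> Sobolev r"
  shows "l2inner (frac_stokes (r / 2) f) (frac_stokes (r / 2) g) = wform (fweight r) f g"
  unfolding Parseval(2)[OF frac_stokes(1)[OF assms(1,2)] frac_stokes(1)[OF assms(1,3)]]
    frac_stokes(2)[OF assms(1,2)] frac_stokes(2)[OF assms(1,3)] wform_def
  by (simp add: fweight_half mult.assoc[symmetric])

lemma l2inner_zero_left [simp]: "l2inner (\<lambda>_. 0) h = 0"
  by (simp add: l2inner_def)

lemma l2inner_sum_scaleR_left:
  assumes "\<And>i. i \<in> I \<Longrightarrow> f i \<in> L2" "h \<in> L2"
  shows "l2inner (\<lambda>x. \<Sum>i\<in>I. a i *\<^sub>R f i x) h = (\<Sum>i\<in>I. a i * l2inner (f i) h)"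
  using assms
proof (induction I rule: infinite_finite_induct)
  case (insert i I)
  have "l2inner (\<lambda>x. a i *\<^sub>R f i x + 1 *\<^sub>R (\<Sum>i\<in>I. a i *\<^sub>R f i x)) h
      = a i * l2inner (f i) h + 1 * l2inner (\<lambda>x. \<Sum>i\<in>I. a i *\<^sub>R f i x) h"
    using insert.prems by (intro l2inner_lincomb_left L2_sum L2_scale) auto
  then show ?case using insert by simp
qed simp_all

section \<open>Comparison with a given eigenbasis of the Stokes operator\<close>

context
  fixes \<phi> :: "nat \<Rightarrow> field" and lam :: "nat \<Rightarrow> real"
  assumes basis: "stokes_eigenbasis \<phi> lam"
begin

lemma eigenfield: "\<phi> n \<in> Sobolev 2" "\<phi> n \<in> Hspace" "\<phi> n \<in> L2" "0 < lam n"
  using basis Hspace_L2 unfolding stokes_eigenbasis_def by blast+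

text \<open>The Laplacian of an eigenfield is itself solenoidal, so the Leray projection leaves it
  alone and the eigenvalue equation becomes (lam n - \<open>freq k\<close>) c_k = 0 on
  coefficients.\<close>

lemma eigenfield_support:
  assumes "fourier (\<phi> n) k \<noteq> 0"
  shows "freq k = lam n"
proof -
  let ?l = "laplacian (\<phi> n)"
  note l = laplacian_Sobolev[OF eigenfield(1)[of n]]
  have "solen (\<phi> n)" using eigenfield(2) by (simp add: Hspace_iff)
  then have "?l \<in> Hspace"
    unfolding Hspace_iff solen_def l(2) using l(1) by (simp add: kdot_scaleR del: scaleR_minus_left)
  from leray_self[OF this] have "AE x in torus. lam n *\<^sub>R \<phi> n x = (-1) *\<^sub>R ?l x"
  proof -
    have "AE x in torus. stokes (\<phi> n) x = lam n *\<^sub>R \<phi> n x"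
      using basis unfolding stokes_eigenbasis_def by blast
    with leray_self[OF \<open>?l \<in> Hspace\<close>] show ?thesis
      by eventually_elim (simp add: stokes_def)
  qed
  then have "fourier (\<lambda>x. lam n *\<^sub>R \<phi> n x) k = fourier (\<lambda>x. (-1) *\<^sub>R ?l x) k"
    by (intro fourier_cong_AE L2_scale l(1) eigenfield(3))
  then have "lam n *\<^sub>R fourier (\<phi> n) k = freq k *\<^sub>R fourier (\<phi> n) k"
    using fourier_lincomb[OF eigenfield(3)[of n] eigenfield(3)[of n], of "lam n" 0 k]
      fourier_lincomb[OF l(1) l(1), of "-1" 0 k] l(2) by simp
  then show ?thesis using assms by simp
qed

text \<open>On the frequencies of an eigenfield the symbol is constant, equal to the corresponding
  power of its eigenvalue.\<close>

lemma l2inner_frac_stokes_eigenfield: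
  assumes "0 \<le> r" "f \<in> Sobolev r"
  shows "l2inner (frac_stokes (r / 2) f) (\<phi> n) = lam n powr (r / 2) * l2inner f (\<phi> n)"
proof -
  have "fweight (r / 2) k * (fourier f k \<bullet> fourier (\<phi> n) k) = lam n powr (r / 2) * (fourier f k \<bullet> fourier (\<phi> n) k)" for k
    using eigenfield_support[of n k] by (cases "fourier (\<phi> n) k = 0") (simp_all add: fweight_def)
  then show ?thesis
    unfolding Parseval(2)[OF frac_stokes(1)[OF assms] eigenfield(3)] Parseval(2)[OF Sobolev_L2[OF assms(2)] eigenfield(3)]
      frac_stokes(2)[OF assms] infsum_cmult_right'[symmetric] inner_scaleR_left
    by (simp only:)
qed

lemma eigenbasis_expansion:
  assumes "u \<in> Hspace"
  shows "(\<lambda>n. l2norm (\<lambda>x. (\<Sum>k<n. l2inner u (\<phi> k) *\<^sub>R \<phi> k x) - u x)) \<longlonglongrightarrow> 0"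
  using basis assms unfolding stokes_eigenbasis_def
  by (subst l2norm_minus_commute) blast

lemma eigenbasis_sums:
  assumes u: "u \<in> Hspace" and w: "w \<in> L2"
  shows "(\<lambda>n. l2inner u (\<phi> n) * l2inner (\<phi> n) w) sums l2inner u w"
proof -
  have L: "(\<lambda>x. \<Sum>k<n. l2inner u (\<phi> k) *\<^sub>R \<phi> k x) \<in> L2" for n
    by (intro L2_sum L2_scale eigenfield)
  have "(\<lambda>n. l2inner (\<lambda>x. \<Sum>k<n. l2inner u (\<phi> k) *\<^sub>R \<phi> k x) w) \<longlonglongrightarrow> l2inner u w"
    by (rule l2inner_tendsto[OF L Hspace_L2[OF u] w eigenbasis_expansion[OF u]])
  then show ?thesis
    unfolding sums_def by (simp add: l2inner_sum_scaleR_left eigenfield w)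
qed

text \<open>Splitting lam^r into two half powers turns the defining series into the eigenbasis
  expansion of an L2 product of two half-power images. In particular the value is the same for every
  eigenbasis.\<close>

lemma stokes_pow_dual_eq_wform:
  assumes r: "0 \<le> r" and f: "f \<in> Sobolev r" "solen f" and g: "g \<in> Sobolev r"
  shows "stokes_pow_dual \<phi> lam r f g = wform (fweight r) f g"
proof -
  have "l2inner (frac_stokes (r / 2) f) (\<phi> n) * l2inner (\<phi> n) (frac_stokes (r / 2) g)
      = lam n powr r * l2inner f (\<phi> n) * l2inner (\<phi> n) g" for n
  proof -
    have "lam n powr r = lam n powr (r / 2) * lam n powr (r / 2)"
      by (simp add: powr_add[symmetric])
    then show ?thesis
      by (simp add: l2inner_commute[of "\<phi> n"] l2inner_frac_stokes_eigenfield[OF r] f(1) g)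
  qed
  then have "(\<lambda>n. lam n powr r * l2inner f (\<phi> n) * l2inner (\<phi> n) g) sums
      l2inner (frac_stokes (r / 2) f) (frac_stokes (r / 2) g)"
    using eigenbasis_sums[OF frac_stokes_Hspace[OF r f] frac_stokes(1)[OF r g]] by (simp only:)
  then show ?thesis
    unfolding stokes_pow_dual_def l2inner_frac_stokes[OF r f(1) g] by (simp add: sums_unique[symmetric])
qed

text \<open>\<open>frac_stokes\<close> satisfies the condition under which \<open>stokes_pow\<close>
  is chosen, and two L2 limits of the same partial sums agree almost everywhere.\<close>

lemma stokes_pow_norm:
  assumes r: "0 \<le> r" and f: "f \<in> Sobolev r" "solen f"
  shows "(l2norm (stokes_pow \<phi> lam (r / 2) f))\<^sup>2 = wform (fweight r) f f"
proof -
  let ?P = "\<lambda>n x. \<Sum>k<n. (lam k powr (r / 2) * l2inner f (\<phi> k)) *\<^sub>R \<phi> k x"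
  let ?L = "frac_stokes (r / 2) f"
  let ?Q = "\<lambda>v. v \<in> Hspace \<and> (\<lambda>n. l2norm (\<lambda>x. v x - ?P n x)) \<longlonglongrightarrow> 0"
  have L: "?L \<in> Hspace" by (rule frac_stokes_Hspace[OF r f])
  have "(\<lambda>n. l2norm (\<lambda>x. ?L x - ?P n x)) \<longlonglongrightarrow> 0"
    using eigenbasis_expansion[OF L] unfolding l2inner_frac_stokes_eigenfield[OF r f(1)]
    by (subst (asm) l2norm_minus_commute)
  then have QL: "?Q ?L" using L by blast
  then have Qs: "?Q (stokes_pow \<phi> lam (r / 2) f)"
    unfolding stokes_pow_def by (rule someI[where P = ?Q])
  let ?S = "stokes_pow \<phi> lam (r / 2) f"
  have PL: "?P n \<in> L2" for n by (intro L2_sum L2_scale eigenfield)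
  have SL: "?S \<in> L2" and LL: "?L \<in> L2" using Qs QL Hspace_L2 by blast+
  have "l2norm (\<lambda>x. ?S x - ?L x) \<le> l2norm (\<lambda>x. ?S x - ?P n x) + l2norm (\<lambda>x. ?L x - ?P n x)" for n
    using l2norm_triangle_diff[OF SL PL LL, of n] by (subst l2norm_minus_commute[of ?L])
  moreover have "(\<lambda>n. l2norm (\<lambda>x. ?S x - ?P n x) + l2norm (\<lambda>x. ?L x - ?P n x)) \<longlonglongrightarrow> 0 + 0"
    using Qs QL by (intro tendsto_add) blast+
  ultimately have "l2norm (\<lambda>x. ?S x - ?L x) \<le> 0 + 0"
    by (intro LIMSEQ_le_const) auto
  then have "l2norm (\<lambda>x. ?S x - ?L x) = 0"
    using l2norm_nonneg[of "\<lambda>x. ?S x - ?L x"] by linarith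
  from l2norm_eq_0_AE[OF L2_diff[OF SL LL] this]
  have "AE x in torus. ?S x = ?L x" by eventually_elim simp
  from l2norm_cong_AE[OF SL LL this] show ?thesis
    by (simp add: l2norm_sq l2inner_frac_stokes[OF r f(1) f(1)])
qed

end

subsection \<open>The Sobolev embedding into bounded fields\<close>

text \<open>The power -2/3 is the share of one coordinate in (1 + \<open>freq k\<close>)^(-2); in
  one variable it decays with the summable exponent -4/3.\<close>

lemma sum_powr_int_bounded: "\<exists>B\<ge>0. \<forall>n. (\<Sum>m\<in>{- int n..int n}. (1 + (real_of_int m)\<^sup>2) powr (- (2/3))) \<le> B"
proof -
  let ?a = "\<lambda>m::int. (1 + (real_of_int m)\<^sup>2) powr (- (2/3))"
  have "summable (\<lambda>m. ?a (int m))"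
  proof (rule summable_comparison_test_ev)
    show "summable (\<lambda>m. real m powr (- (4/3)))" by (simp add: summable_real_powr_iff)
    show "eventually (\<lambda>m. norm (?a (int m)) \<le> real m powr (- (4/3))) sequentially"
      using eventually_gt_at_top[of "0::nat"]
    proof eventually_elim
      case (elim m)
      have "?a (int m) \<le> ((real m)\<^sup>2) powr (- (2/3))"
        using elim by (intro powr_mono2') auto
      also have "\<dots> = (real m powr 2) powr (- (2/3))"
        using elim by simp
      also have "\<dots> = real m powr (- (4/3))"
        by (simp only: powr_powr) simp
      finally show ?case by simp
    qed
  qed
  then have *: "(\<Sum>m<n. ?a (int m)) \<le> (\<Sum>m. ?a (int m))" for n
    by (rule sum_le_suminf) simp_all
  have "(\<Sum>m\<in>{- int n..int n}. ?a m) \<le> 2 * (\<Sum>m. ?a (int m))" for n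
  proof -
    let ?A = "int ` {..<Suc n}" and ?B = "(\<lambda>m. - int m) ` {..<Suc n}"
    have "{- int n..int n} \<subseteq> ?A \<union> ?B"
    proof
      fix m assume m: "m \<in> {- int n..int n}"
      show "m \<in> ?A \<union> ?B"
      proof (cases "m \<ge> 0")
        case True
        then have "m = int (nat m)" "nat m < Suc n" using m by auto
        then show ?thesis by blast
      next
        case False
        then have "m = - int (nat (- m))" "nat (- m) < Suc n" using m by auto
        then show ?thesis by blast
      qed
    qed
    then have "(\<Sum>m\<in>{- int n..int n}. ?a m) \<le> (\<Sum>m\<in>?A \<union> ?B. ?a m)"
      by (intro sum_mono2) auto
    also have "\<dots> \<le> (\<Sum>m\<in>?A. ?a m) + (\<Sum>m\<in>?B. ?a m)"
      using sum.union_inter[of ?A ?B ?a] sum_nonneg[of "?A \<inter> ?B" ?a] by simp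
    also have "\<dots> = (\<Sum>m<Suc n. ?a (int m)) + (\<Sum>m<Suc n. ?a (int m))"
    proof (rule arg_cong2[where f = "(+)"])
      show "(\<Sum>m\<in>?A. ?a m) = (\<Sum>m<Suc n. ?a (int m))"
        by (subst sum.reindex) (simp_all add: inj_on_def)
      show "(\<Sum>m\<in>?B. ?a m) = (\<Sum>m<Suc n. ?a (int m))"
        by (subst sum.reindex) (simp_all add: inj_on_def)
    qed
    also have "\<dots> \<le> 2 * (\<Sum>m. ?a (int m))"
      using *[of "Suc n"] by linarith
    finally show ?thesis .
  qed
  moreover have "0 \<le> 2 * (\<Sum>m. ?a (int m))"
    using *[of 0] by simp
  ultimately show ?thesis by blast
qed

text \<open>The power -2 is written as three factors with power -2/3, each weakened to a single
  coordinate, so that the sum over a cube will factor.\<close>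

lemma sweight_le_prod: "sweight (- 2) k \<le> (\<Prod>i\<in>UNIV. (1 + (real_of_int (k $ i))\<^sup>2) powr (- (2/3)))"
proof -
  have p: "1 + freq k > 0" using freq_nonneg[of k] by linarith
  have "sweight (- 2) k = ((1 + freq k) powr (- (2/3))) ^ 3"
    using p by (simp add: powr_power)
  also have "\<dots> = (\<Prod>i\<in>(UNIV :: 3 set). (1 + freq k) powr (- (2/3)))"
    by simp
  also have "\<dots> \<le> (\<Prod>i\<in>UNIV. (1 + (real_of_int (k $ i))\<^sup>2) powr (- (2/3)))"
  proof (intro prod_mono conjI powr_mono2')
    fix i
    have "1 \<le> (2 * pi)\<^sup>2"
      using pi_gt3 by (intro one_le_power) simp
    then have "(real_of_int (k $ i))\<^sup>2 \<le> (2 * pi)\<^sup>2 * (real_of_int (k $ i))\<^sup>2"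
      by (simp add: mult_le_cancel_right1)
    also have "\<dots> \<le> freq k"
      using dcoef_freq_le[of k i] by (simp only: power_mult_distrib)
    finally show "1 + (real_of_int (k $ i))\<^sup>2 \<le> 1 + freq k" by simp
    show "0 < 1 + (real_of_int (k $ i))\<^sup>2"
      using zero_le_power2[of "real_of_int (k $ i)"] by linarith
  qed simp_all
  finally show ?thesis .
qed

lemma sum_sweight_bounded: "\<exists>C\<ge>0. \<forall>n. (\<Sum>k\<in>cube n. sweight (- 2) k) \<le> C"
proof -
  let ?a = "\<lambda>m::int. (1 + (real_of_int m)\<^sup>2) powr (- (2/3))"
  obtain B where B: "B \<ge> 0" "\<And>n. (\<Sum>m\<in>{- int n..int n}. ?a m) \<le> B"
    using sum_powr_int_bounded by blast
  have "(\<Sum>k\<in>cube n. sweight (- 2) k) \<le> B ^ 3" for n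
  proof -
    let ?P = "(UNIV :: 3 set) \<rightarrow>\<^sub>E {- int n..int n}"
    have bij: "bij_betw (\<lambda>k i. k $ i) (cube n) ?P"
    proof (rule bij_betwI)
      show "(\<lambda>k i. k $ i) \<in> cube n \<rightarrow> ?P"
        by (auto simp: cube_def PiE_UNIV_domain abs_le_iff minus_le_iff)
      show "(\<lambda>f. \<chi> i. f i) \<in> ?P \<rightarrow> cube n"
        by (auto simp: cube_def PiE_UNIV_domain abs_le_iff Pi_iff minus_le_iff)
    qed simp_all
    have "(\<Sum>k\<in>cube n. sweight (- 2) k) \<le> (\<Sum>k\<in>cube n. \<Prod>i\<in>UNIV. ?a (k $ i))"
      by (rule sum_mono) (rule sweight_le_prod)
    also have "\<dots> = (\<Sum>g\<in>?P. \<Prod>i\<in>UNIV. ?a (g i))"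
      by (rule sum.reindex_bij_betw[OF bij, of "\<lambda>g. \<Prod>i\<in>UNIV. ?a (g i)"])
    also have "\<dots> = (\<Prod>i\<in>(UNIV :: 3 set). \<Sum>m\<in>{- int n..int n}. ?a m)"
      by (rule prod_sum_PiE[symmetric]) simp_all
    also have "\<dots> = (\<Sum>m\<in>{- int n..int n}. ?a m) ^ 3" by simp
    also have "\<dots> \<le> B ^ 3"
      by (intro power_mono B(2) sum_nonneg) simp
    finally show ?thesis .
  qed
  moreover have "0 \<le> B ^ 3" using B(1) by simp
  ultimately show ?thesis by blast
qed

lemma norm_synth_le: "norm (synth K c x) \<le> (\<Sum>k\<in>K. norm (c k))"
proof -
  have "synth K c x = (\<Sum>k\<in>K. (\<chi> i. Re (c k $ i * expo k x)))"
    unfolding vec_eq_iff sum_component vec_lambda_beta synth_nth by simp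
  moreover have "norm (\<chi> i. Re (c k $ i * expo k x) :: real^3) \<le> norm (c k)" for k
    unfolding norm_vec_def vec_lambda_beta
  proof (rule L2_set_mono)
    fix i
    have "\<bar>Re (c k $ i * expo k x)\<bar> \<le> norm (c k $ i * expo k x)" by (rule abs_Re_le_cmod)
    then show "norm (Re (c k $ i * expo k x)) \<le> norm (c k $ i)"
      unfolding norm_mult norm_expo real_norm_def by simp
  qed simp
  then have "(\<Sum>k\<in>K. norm (\<chi> i. Re (c k $ i * expo k x) :: real^3)) \<le> (\<Sum>k\<in>K. norm (c k))"
    by (rule sum_mono)
  ultimately show ?thesis
    using norm_sum[of "\<lambda>k. (\<chi> i. Re (c k $ i * expo k x)) :: real^3" K] by simp
qed

text \<open>Cauchy-Schwarz with the weights of order -1 and 1; the squared weight of order -2 is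
  summable in dimension three.\<close>

lemma fourier_l1_bound:
  "\<exists>C\<ge>0. \<forall>f\<in>Sobolev 2. \<forall>n. (\<Sum>k\<in>cube n. norm (fourier f k)) \<le> C * hsnorm 2 f"
proof -
  obtain C where C: "C \<ge> 0" "\<And>n. (\<Sum>k\<in>cube n. sweight (- 2) k) \<le> C"
    using sum_sweight_bounded by blast
  have "(\<Sum>k\<in>cube n. norm (fourier f k)) \<le> sqrt C * hsnorm 2 f" if f: "f \<in> Sobolev 2" for f n
  proof (rule power2_le_imp_le)
    have p: "1 + freq k > 0" for k using freq_nonneg[of k] by linarith
    have "(\<Sum>k\<in>cube n. norm (fourier f k)) = (\<Sum>k\<in>cube n. sweight (- 1) k * (sweight 1 k * norm (fourier f k)))"
    proof (rule sum.cong[OF refl])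
      fix k
      have "sweight (- 1) k * sweight 1 k = 1"
        using p[of k] by (simp only: powr_add[symmetric]) simp
      then show "norm (fourier f k) = sweight (- 1) k * (sweight 1 k * norm (fourier f k))"
        by (simp only: mult.assoc[symmetric] mult_1_left)
    qed
    then have "(\<Sum>k\<in>cube n. norm (fourier f k))\<^sup>2
        \<le> (\<Sum>k\<in>cube n. (sweight (- 1) k)\<^sup>2) * (\<Sum>k\<in>cube n. (sweight 1 k * norm (fourier f k))\<^sup>2)"
      by (simp only: Cauchy_Schwarz_ineq_sum)
    also have "\<dots> = (\<Sum>k\<in>cube n. sweight (- 2) k) * (\<Sum>k\<in>cube n. sweight 2 k * (norm (fourier f k))\<^sup>2)"
    proof -
      have "(sweight a k)\<^sup>2 = sweight (2 * a) k" for a k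
        by (simp only: power2_eq_square powr_add[symmetric]) simp
      then show ?thesis by (simp only: power_mult_distrib) simp
    qed
    also have "\<dots> \<le> C * (hsnorm 2 f)\<^sup>2"
    proof (rule mult_mono[OF C(2)])
      show "(\<Sum>k\<in>cube n. sweight 2 k * (norm (fourier f k))\<^sup>2) \<le> (hsnorm 2 f)\<^sup>2"
        unfolding hsnorm_sq wform_def power2_norm_eq_inner[symmetric]
        by (rule finite_sum_le_infsum) (use wspace_summable f Sobolev_eq_wspace in \<open>auto\<close>)
    qed (use C(1) in \<open>auto intro!: sum_nonneg\<close>)
    also have "\<dots> = (sqrt C * hsnorm 2 f)\<^sup>2"
      using C(1) by (simp add: power_mult_distrib)
    finally show "(\<Sum>k\<in>cube n. norm (fourier f k))\<^sup>2 \<le> (sqrt C * hsnorm 2 f)\<^sup>2" .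
  qed (use C(1) in simp)
  moreover have "0 \<le> sqrt C" using C(1) by simp
  ultimately show ?thesis by blast
qed

text \<open>The excess of |f| over M is dominated pointwise by |trunc n f - f|, whose L2 norm tends
  to 0.\<close>

lemma trunc_bound_imp_AE:
  assumes f: "f \<in> L2" and M: "\<And>n x. norm (trunc n f x) \<le> M"
  shows "AE x in torus. norm (f x) \<le> M"
proof -
  define h where "h x = max 0 (norm (f x) - M)" for x
  have [measurable]: "f \<in> borel_measurable torus" by (rule L2_measurable[OF f])
  have M0: "0 \<le> M" using norm_ge_zero M order_trans by blast
  have hm: "(\<lambda>x. (h x)\<^sup>2) \<in> borel_measurable torus"
    unfolding h_def by measurable
  have hi: "integrable torus (\<lambda>x. (h x)\<^sup>2)"
  proof (rule Bochner_Integration.integrable_bound[OF L2_sq_integrable[OF f] hm])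
    have "(h x)\<^sup>2 \<le> (norm (f x))\<^sup>2" for x
      using M0 by (intro power_mono) (auto simp: h_def)
    then show "AE x in torus. norm ((h x)\<^sup>2) \<le> norm ((norm (f x))\<^sup>2)"
      by (intro AE_I2) simp
  qed
  have le: "(\<integral>x. (h x)\<^sup>2 \<partial>torus) \<le> (l2norm (\<lambda>x. trunc n f x - f x))\<^sup>2" for n
  proof -
    have "(h x)\<^sup>2 \<le> (norm (trunc n f x - f x))\<^sup>2" for x
    proof (rule power_mono)
      have "norm (f x) \<le> norm (trunc n f x) + norm (trunc n f x - f x)"
        by (metis norm_minus_commute norm_triangle_sub)
      then show "h x \<le> norm (trunc n f x - f x)"
        using M[of n x] by (auto simp: h_def)
    qed (simp add: h_def)
    then have "(\<integral>x. (h x)\<^sup>2 \<partial>torus) \<le> (\<integral>x. (norm (trunc n f x - f x))\<^sup>2 \<partial>torus)"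
      by (intro integral_mono hi L2_sq_integrable L2_diff synth_L2 f)
    then show ?thesis by (simp add: l2norm_def)
  qed
  have "(\<lambda>n. (l2norm (\<lambda>x. trunc n f x - f x))\<^sup>2) \<longlonglongrightarrow> 0\<^sup>2"
    by (intro tendsto_power trunc_tendsto_L2 f)
  then have "(\<integral>x. (h x)\<^sup>2 \<partial>torus) \<le> 0\<^sup>2"
    by (rule LIMSEQ_le_const) (use le in blast)
  then have "(\<integral>x. (h x)\<^sup>2 \<partial>torus) = 0"
    by (intro antisym) simp_all
  then have "AE x in torus. (h x)\<^sup>2 = 0"
    using integral_nonneg_eq_0_iff_AE[OF hi] by simp
  then show ?thesis
    by eventually_elim (simp add: h_def)
qed

text \<open>The bound is kept also for all truncations at every point, because truncated gradients
  must be bounded uniformly in n.\<close>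

lemma Sobolev_sup_bound:
  "\<exists>C\<ge>0. \<forall>f\<in>Sobolev 2. (\<forall>n x. norm (trunc n f x) \<le> C * hsnorm 2 f) \<and>
     (AE x in torus. norm (f x) \<le> C * hsnorm 2 f)"
proof -
  obtain C where C: "C \<ge> 0" "\<And>f n. f \<in> Sobolev 2 \<Longrightarrow> (\<Sum>k\<in>cube n. norm (fourier f k)) \<le> C * hsnorm 2 f"
    using fourier_l1_bound by blast
  have 1: "norm (trunc n f x) \<le> C * hsnorm 2 f" if "f \<in> Sobolev 2" for f n x
    by (rule order_trans[OF norm_synth_le C(2)[OF that]])
  have "AE x in torus. norm (f x) \<le> C * hsnorm 2 f" if "f \<in> Sobolev 2" for f
    by (rule trunc_bound_imp_AE[OF Sobolev_L2[OF that] 1[OF that]])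
  with 1 C(1) show ?thesis by blast
qed

subsection \<open>The convection term\<close>

lemma L2_dominated:
  fixes h g :: field
  assumes h: "periodic h" "h \<in> borel_measurable torus" and g: "g \<in> L2"
    and dom: "AE x in torus. norm (h x) \<le> M * norm (g x)" and M: "0 \<le> M"
  shows "h \<in> L2" "l2norm h \<le> M * l2norm g"
proof -
  have dom2: "AE x in torus. (norm (h x))\<^sup>2 \<le> M\<^sup>2 * (norm (g x))\<^sup>2"
    using dom by eventually_elim (metis norm_ge_zero power_mono power_mult_distrib)
  have gi: "integrable torus (\<lambda>x. M\<^sup>2 * (norm (g x))\<^sup>2)"
    by (intro integrable_mult_right L2_sq_integrable g)
  have hm: "(\<lambda>x. (norm (h x))\<^sup>2) \<in> borel_measurable torus"
    using h(2) by measurable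
  have hi: "integrable torus (\<lambda>x. (norm (h x))\<^sup>2)"
    by (rule Bochner_Integration.integrable_bound[OF gi hm]) (use dom2 in \<open>eventually_elim, simp\<close>)
  then show "h \<in> L2" using h by (simp add: L2_def)
  have "(\<integral>x. (norm (h x))\<^sup>2 \<partial>torus) \<le> (\<integral>x. M\<^sup>2 * (norm (g x))\<^sup>2 \<partial>torus)"
    by (rule integral_mono_AE[OF hi gi dom2])
  then have "sqrt (\<integral>x. (norm (h x))\<^sup>2 \<partial>torus) \<le> sqrt (M\<^sup>2 * (\<integral>x. (norm (g x))\<^sup>2 \<partial>torus))"
    by simp
  then show "l2norm h \<le> M * l2norm g"
    using M by (simp add: l2norm_def real_sqrt_mult)
qed

lemma component_scaleR_regular:
  fixes f g :: field
  assumes "f \<in> L2" "g \<in> L2"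
  shows "periodic (\<lambda>x. f x $ j *\<^sub>R g x)" "(\<lambda>x. f x $ j *\<^sub>R g x) \<in> borel_measurable torus"
proof -
  show "periodic (\<lambda>x. f x $ j *\<^sub>R g x)"
    using assms[THEN L2_periodic] by (simp add: periodic_def)
  have "(\<lambda>x. f x $ j) \<in> borel_measurable torus"
    using L2_nth_integrable[OF assms(1)] by (rule borel_measurable_integrable)
  then show "(\<lambda>x. f x $ j *\<^sub>R g x) \<in> borel_measurable torus"
    using L2_measurable[OF assms(2)] by measurable
qed

text \<open>In a convection product either the advecting field is bounded, almost everywhere as
  here, or the gradient is, at every point as in the next lemma.\<close>

lemma component_scaleR_L2_left:
  fixes f g :: field
  assumes f: "f \<in> L2" and g: "g \<in> L2" and M: "AE x in torus. norm (f x) \<le> M" "0 \<le> M"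
  shows "(\<lambda>x. f x $ j *\<^sub>R g x) \<in> L2" "l2norm (\<lambda>x. f x $ j *\<^sub>R g x) \<le> M * l2norm g"
proof -
  have "AE x in torus. norm (f x $ j *\<^sub>R g x) \<le> M * norm (g x)"
    using M(1)
  proof eventually_elim
    case (elim x)
    have "\<bar>f x $ j\<bar> \<le> M" using elim component_le_norm_cart[of "f x" j] by linarith
    then show ?case unfolding norm_scaleR real_norm_def by (rule mult_right_mono) simp
  qed
  from L2_dominated[OF component_scaleR_regular[OF f g] g this M(2)]
  show "(\<lambda>x. f x $ j *\<^sub>R g x) \<in> L2" "l2norm (\<lambda>x. f x $ j *\<^sub>R g x) \<le> M * l2norm g" .
qed

lemma component_scaleR_L2_right:
  fixes f g :: field
  assumes f: "f \<in> L2" and g: "g \<in> L2" and M: "\<And>x. norm (g x) \<le> M" "0 \<le> M"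
  shows "(\<lambda>x. f x $ j *\<^sub>R g x) \<in> L2" "l2norm (\<lambda>x. f x $ j *\<^sub>R g x) \<le> M * l2norm f"
proof -
  have "norm (f x $ j *\<^sub>R g x) \<le> M * norm (f x)" for x
    using mult_mono[OF M(1)[of x] component_le_norm_cart[of "f x" j] M(2)]
    by (simp add: mult.commute)
  then have "AE x in torus. norm (f x $ j *\<^sub>R g x) \<le> M * norm (f x)" by simp
  from L2_dominated[OF component_scaleR_regular[OF f g] f this M(2)]
  show "(\<lambda>x. f x $ j *\<^sub>R g x) \<in> L2" "l2norm (\<lambda>x. f x $ j *\<^sub>R g x) \<le> M * l2norm f" .
qed

lemma bounded_synth: "norm (synth K c x) \<le> (\<Sum>k\<in>K. norm (c k))" "0 \<le> (\<Sum>k\<in>K. norm (c k))"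
  by (rule norm_synth_le) (simp add: sum_nonneg)

text \<open>For trigonometric polynomials weak derivatives are classical, and the projection
  disappears against a solenoidal w.\<close>

lemma convect_trunc:
  assumes u: "u = trunc m f" and v: "v = trunc n g" and w: "w \<in> Hspace"
  shows "l2inner (convect u v) w = (\<Sum>j\<in>UNIV. l2inner (\<lambda>x. u x $ j *\<^sub>R pd j v x) w)"
proof -
  have uL: "u \<in> L2" unfolding u by (rule synth_L2)
  have vS: "v \<in> Sobolev (0 + 1)" unfolding v by (rule trunc_Sobolev)
  have dL: "wderiv j v \<in> L2" for j by (rule Sobolev_L2[OF wderiv_Sobolev(1)[OF order_refl vS]])
  have pL: "pd j v \<in> L2" for j unfolding v pd_synth by (rule synth_L2)
  have tL: "(\<lambda>x. u x $ j *\<^sub>R g x) \<in> L2" if "g \<in> L2" for g :: field and j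
    unfolding u using bounded_synth[where K = "cube m" and c = "fourier f"] that
    by (intro component_scaleR_L2_left(1)[of _ _ "\<Sum>k\<in>cube m. norm (fourier f k)"] synth_L2) simp_all
  have "l2inner (convect u v) w = l2inner (\<lambda>x. \<Sum>j\<in>UNIV. u x $ j *\<^sub>R wderiv j v x) w"
    unfolding convect_def by (intro leray_inner w L2_sum tL dL)
  also have "\<dots> = l2inner (\<lambda>x. \<Sum>j\<in>UNIV. 1 *\<^sub>R (u x $ j *\<^sub>R pd j v x)) w"
  proof (rule l2inner_cong_AE)
    have "AE x in torus. \<forall>j\<in>UNIV. wderiv j v x = pd j v x"
      using wderiv_eq_pd[of v] vS unfolding v
      by (intro AE_finite_allI) (simp_all add: periodic_synth Ck_synth del: Ck.simps One_nat_def)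
    then show "AE x in torus. (\<Sum>j\<in>UNIV. u x $ j *\<^sub>R wderiv j v x) = (\<Sum>j\<in>UNIV. 1 *\<^sub>R (u x $ j *\<^sub>R pd j v x))"
      by eventually_elim simp
  qed (intro L2_sum L2_scale tL dL pL Hspace_L2[OF w])+
  also have "\<dots> = (\<Sum>j\<in>UNIV. 1 * l2inner (\<lambda>x. u x $ j *\<^sub>R pd j v x) w)"
    by (intro l2inner_sum_scaleR_left tL pL Hspace_L2[OF w])
  finally show ?thesis by simp
qed

text \<open>Componentwise, twice the integral of u_j v_i d_j v_i is minus the integral of (d_j u_j)
  v_i^2, which sums to zero over j.\<close>

lemma convection_cancels:
  fixes u v :: field
  assumes u: "periodic u" "Ck 1 u" and v: "periodic v" "Ck 1 v"
    and div: "\<And>x. (\<Sum>j\<in>UNIV. pd j u x $ j) = 0"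
  shows "(\<Sum>j\<in>UNIV. l2inner (\<lambda>x. u x $ j *\<^sub>R pd j v x) v) = 0"
proof -
  have per: "periodic (\<lambda>x. u x $ i)" "periodic (\<lambda>x. v x $ i)" for i
    using u(1) v(1) by (simp_all add: periodic_def)
  have cu: "continuous_on UNIV (\<lambda>x. u x $ i)" "continuous_on UNIV (\<lambda>x. pd j u x $ i)" for i j
    by (intro continuous_on_component Ck_1D[OF u(2)])+
  have cv: "continuous_on UNIV (\<lambda>x. v x $ i)" "continuous_on UNIV (\<lambda>x. pd j v x $ i)" for i j
    by (intro continuous_on_component Ck_1D[OF v(2)])+
  let ?I = "\<lambda>j i. \<integral>x. u x $ j * v x $ i * pd j v x $ i \<partial>torus"
  let ?J = "\<lambda>j i. \<integral>x. pd j u x $ j * (v x $ i * v x $ i) \<partial>torus"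
  have IJ: "2 * ?I j i = - ?J j i" for i j
  proof -
    note nth_u = Ck_1_nth[OF u(2), of j] and nth_v = Ck_1_nth[OF v(2), of i]
    have "(\<integral>x. (u x $ j * v x $ i) * pd j (\<lambda>x. v x $ i) x \<partial>torus)
        = - (\<integral>x. pd j (\<lambda>x. u x $ j * v x $ i) x * v x $ i \<partial>torus)"
      by (intro torus_integral_by_parts periodic_mult per Ck_1_mult nth_u nth_v)
    then have "?I j i = - (\<integral>x. u x $ j * v x $ i * pd j v x $ i + pd j u x $ j * (v x $ i * v x $ i) \<partial>torus)"
      unfolding pd_mult[OF Ck_1D(1)[OF nth_u] Ck_1D(1)[OF nth_v]]
        pd_nth[OF Ck_1D(1)[OF u(2)]] pd_nth[OF Ck_1D(1)[OF v(2)]] by (simp add: algebra_simps)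
    also have "\<dots> = - (?I j i + ?J j i)"
      by (intro arg_cong[where f = uminus] Bochner_Integration.integral_add
          continuous_integrable_torus continuous_on_mult cu cv)
    finally show ?thesis by simp
  qed
  have "(\<Sum>j\<in>UNIV. ?J j i) = 0" for i
  proof -
    have "(\<Sum>j\<in>UNIV. ?J j i) = (\<integral>x. (\<Sum>j\<in>UNIV. pd j u x $ j * (v x $ i * v x $ i)) \<partial>torus)"
      by (intro Bochner_Integration.integral_sum[symmetric] continuous_integrable_torus continuous_on_mult cu cv)
    then show ?thesis
      unfolding sum_distrib_right[symmetric] div by simp
  qed
  then have I0: "(\<Sum>j\<in>UNIV. ?I j i) = 0" for i
  proof -
    have "2 * (\<Sum>j\<in>UNIV. ?I j i) = - (\<Sum>j\<in>UNIV. ?J j i)"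
      unfolding sum_distrib_left IJ sum_negf ..
    then show ?thesis using \<open>(\<Sum>j\<in>UNIV. ?J j i) = 0\<close> by simp
  qed
  have "l2inner (\<lambda>x. u x $ j *\<^sub>R pd j v x) v = (\<Sum>i\<in>UNIV. ?I j i)" for j
  proof -
    have "l2inner (\<lambda>x. u x $ j *\<^sub>R pd j v x) v = (\<integral>x. (\<Sum>i\<in>UNIV. u x $ j * v x $ i * pd j v x $ i) \<partial>torus)"
      unfolding l2inner_def inner_vec_def by (simp add: algebra_simps)
    also have "\<dots> = (\<Sum>i\<in>UNIV. ?I j i)"
      by (intro Bochner_Integration.integral_sum continuous_integrable_torus continuous_on_mult cu cv)
    finally show ?thesis .
  qed
  then have "(\<Sum>j\<in>UNIV. l2inner (\<lambda>x. u x $ j *\<^sub>R pd j v x) v) = (\<Sum>j\<in>UNIV. \<Sum>i\<in>UNIV. ?I j i)"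
    by simp
  also have "\<dots> = (\<Sum>i\<in>UNIV. \<Sum>j\<in>UNIV. ?I j i)" by (rule sum.swap)
  finally show ?thesis using I0 by simp
qed

lemma l2norm_trunc_le:
  assumes "f \<in> L2"
  shows "l2norm (trunc n f) \<le> l2norm f"
proof (rule power2_le_imp_le)
  have "(l2norm (trunc n f))\<^sup>2 = (\<Sum>k\<in>cube n. (norm (fourier f k))\<^sup>2)"
    by (rule l2norm_synth) (simp_all add: hermitian_fourier)
  then show "(l2norm (trunc n f))\<^sup>2 \<le> (l2norm f)\<^sup>2"
    using Bessel[OF assms] by simp
qed simp

lemma pd_trunc:
  assumes "f \<in> Sobolev 1"
  shows "pd j (trunc n f) = trunc n (wderiv j f)"
proof -
  have "fourier (wderiv j f) = dcoef j (fourier f)"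
    using wderiv_Sobolev(2)[of 0 f j] assms by (simp add: fun_eq_iff)
  then show ?thesis by (simp only: pd_synth)
qed

text \<open>The order 2 embedding applied to the first derivatives; truncation commutes with
  differentiation, so one constant serves all n.\<close>

lemma Sobolev_sup_const:
  obtains C where "0 \<le> C"
    "\<And>f n x j. f \<in> Sobolev 3 \<Longrightarrow> norm (pd j (trunc n f) x) \<le> C * hsnorm 3 f"
    "\<And>f. f \<in> Sobolev 3 \<Longrightarrow> AE x in torus. norm (f x) \<le> C * hsnorm 3 f"
proof -
  obtain C where C: "0 \<le> C" "\<And>f n x. f \<in> Sobolev 2 \<Longrightarrow> norm (trunc n f x) \<le> C * hsnorm 2 f"
    "\<And>f. f \<in> Sobolev 2 \<Longrightarrow> AE x in torus. norm (f x) \<le> C * hsnorm 2 f"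
    using Sobolev_sup_bound by blast
  show ?thesis
  proof (rule that[OF C(1)])
    fix f n x j assume f: "f \<in> Sobolev 3"
    have d: "wderiv j f \<in> Sobolev 2" "hsnorm 2 (wderiv j f) \<le> hsnorm 3 f"
      using wderiv_Sobolev(1,3)[of 2 f j] f by simp_all
    have "norm (trunc n (wderiv j f) x) \<le> C * hsnorm 2 (wderiv j f)" by (rule C(2)[OF d(1)])
    also have "\<dots> \<le> C * hsnorm 3 f" by (rule mult_left_mono[OF d(2) C(1)])
    finally show "norm (pd j (trunc n f) x) \<le> C * hsnorm 3 f"
      using pd_trunc[of f j n] Sobolev_mono[of 1 3 f] f by simp
  next
    fix f assume f: "f \<in> Sobolev 3"
    have "f \<in> Sobolev 2" "hsnorm 2 f \<le> hsnorm 3 f"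
      using Sobolev_mono[of 2 3 f] hsnorm_mono[of 2 3 f] f by simp_all
    from C(3)[OF this(1)] show "AE x in torus. norm (f x) \<le> C * hsnorm 3 f"
      by eventually_elim (use mult_left_mono[OF \<open>hsnorm 2 f \<le> hsnorm 3 f\<close> C(1)] in linarith)
  qed
qed

lemma convect_stretching_bound:
  assumes u: "u \<in> L2" and w: "w \<in> L2" and G: "\<And>j x. norm (G j x) \<le> M" "0 \<le> M" "\<And>j. G j \<in> L2"
  shows "\<bar>\<Sum>j\<in>(UNIV :: 3 set). l2inner (\<lambda>x. u x $ j *\<^sub>R G j x) w\<bar> \<le> 3 * M * (l2norm u * l2norm w)"
proof -
  have "\<bar>l2inner (\<lambda>x. u x $ j *\<^sub>R G j x) w\<bar> \<le> M * (l2norm u * l2norm w)" for j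
  proof -
    note t = component_scaleR_L2_right[OF u G(3) G(1,2), of j j]
    have "\<bar>l2inner (\<lambda>x. u x $ j *\<^sub>R G j x) w\<bar> \<le> l2norm (\<lambda>x. u x $ j *\<^sub>R G j x) * l2norm w"
      by (rule l2inner_Cauchy_Schwarz[OF t(1) w])
    also have "\<dots> \<le> M * l2norm u * l2norm w"
      by (rule mult_right_mono[OF t(2)]) simp
    finally show ?thesis by (simp only: mult.assoc)
  qed
  then have "(\<Sum>j\<in>(UNIV :: 3 set). \<bar>l2inner (\<lambda>x. u x $ j *\<^sub>R G j x) w\<bar>) \<le> (\<Sum>j\<in>(UNIV :: 3 set). M * (l2norm u * l2norm w))"
    by (intro sum_mono)
  also have "\<dots> = 3 * M * (l2norm u * l2norm w)" by simp
  finally show ?thesis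
    by (rule order_trans[OF sum_abs])
qed

subsection \<open>The extended convection form\<close>

lemma trunc_solen: "solen f \<Longrightarrow> solen (trunc n f)"
  by (rule smooth_sol_solen[OF trunc_smooth_sol])

lemma convection_summand_L2:
  assumes v: "v \<in> Sobolev 3"
  shows "(\<lambda>x. v x $ j *\<^sub>R wderiv j v x) \<in> L2"
proof -
  obtain C where C: "0 \<le> C" "AE x in torus. norm (v x) \<le> C * hsnorm 3 v"
    using Sobolev_sup_const v by metis
  have "wderiv j v \<in> L2"
    using wderiv_Sobolev(1)[of 2 v j] v by (simp add: Sobolev_L2)
  then show ?thesis
    using C by (intro component_scaleR_L2_left(1)[OF Sobolev_L2[OF v] _ C(2)]) simp_all
qed

lemma convect_Hspace:
  assumes "v \<in> Sobolev 3"
  shows "convect v v \<in> Hspace"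
  unfolding convect_def by (intro leray_Hspace L2_sum convection_summand_L2[OF assms])

lemma convect_eq_sum:
  assumes v: "v \<in> Sobolev 3" and w: "w \<in> Hspace"
  shows "l2inner (convect v v) w = (\<Sum>j\<in>UNIV. l2inner (\<lambda>x. v x $ j *\<^sub>R wderiv j v x) w)"
proof -
  note tL = convection_summand_L2[OF v]
  have "l2inner (convect v v) w = l2inner (\<lambda>x. \<Sum>j\<in>UNIV. v x $ j *\<^sub>R wderiv j v x) w"
    unfolding convect_def by (intro leray_inner w L2_sum tL)
  also have "\<dots> = l2inner (\<lambda>x. \<Sum>j\<in>UNIV. 1 *\<^sub>R (v x $ j *\<^sub>R wderiv j v x)) w"
    by simp
  also have "\<dots> = (\<Sum>j\<in>UNIV. 1 * l2inner (\<lambda>x. v x $ j *\<^sub>R wderiv j v x) w)"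
    by (intro l2inner_sum_scaleR_left tL Hspace_L2[OF w])
  finally show ?thesis by simp
qed

text \<open>The difference of the products splits into two terms, each with one uniformly bounded
  factor and one factor tending to 0 in L2.\<close>

lemma convect_trunc_tendsto:
  assumes v: "v \<in> Sobolev 3" and w: "w \<in> Hspace"
  shows "(\<lambda>n. l2inner (convect (trunc n v) (trunc n v)) w) \<longlonglongrightarrow> l2inner (convect v v) w"
proof -
  obtain C where C: "0 \<le> C"
    "\<And>n x j. norm (pd j (trunc n v) x) \<le> C * hsnorm 3 v"
    "AE x in torus. norm (v x) \<le> C * hsnorm 3 v"
    using Sobolev_sup_const v by metis
  define M where "M = C * hsnorm 3 v"
  have M: "0 \<le> M" "\<And>n x j. norm (pd j (trunc n v) x) \<le> M" "AE x in torus. norm (v x) \<le> M"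
    using C by (simp_all add: M_def)
  note vL = Sobolev_L2[OF v]
  have v1: "v \<in> Sobolev 1" using Sobolev_mono[of 1 3 v] v by simp
  have dL: "wderiv j v \<in> L2" for j
    using wderiv_Sobolev(1)[of 2 v j] v by (simp add: Sobolev_L2)
  have pL: "pd j (trunc n v) \<in> L2" for j n unfolding pd_synth by (rule synth_L2)
  have "(\<lambda>n. l2inner (\<lambda>x. trunc n v x $ j *\<^sub>R pd j (trunc n v) x) w)
      \<longlonglongrightarrow> l2inner (\<lambda>x. v x $ j *\<^sub>R wderiv j v x) w" for j
  proof (rule l2inner_tendsto)
    show 1: "(\<lambda>x. trunc n v x $ j *\<^sub>R pd j (trunc n v) x) \<in> L2" for n
      by (rule component_scaleR_L2_right(1)[OF synth_L2 pL M(2,1)])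
    show 2: "(\<lambda>x. v x $ j *\<^sub>R wderiv j v x) \<in> L2"
      by (rule component_scaleR_L2_left(1)[OF vL dL M(3,1)])
    show "w \<in> L2" by (rule Hspace_L2[OF w])
    have le: "l2norm (\<lambda>x. trunc n v x $ j *\<^sub>R pd j (trunc n v) x - v x $ j *\<^sub>R wderiv j v x)
        \<le> M * l2norm (\<lambda>x. trunc n v x - v x) + M * l2norm (\<lambda>x. trunc n (wderiv j v) x - wderiv j v x)" for n
    proof -
      let ?a = "\<lambda>x. (trunc n v x - v x) $ j *\<^sub>R pd j (trunc n v) x"
      let ?b = "\<lambda>x. v x $ j *\<^sub>R (pd j (trunc n v) x - wderiv j v x)"
      note a = component_scaleR_L2_right[OF L2_diff[OF synth_L2 vL] pL M(2,1)]
      note b = component_scaleR_L2_left[OF vL L2_diff[OF pL dL] M(3,1)]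
      have "(\<lambda>x. trunc n v x $ j *\<^sub>R pd j (trunc n v) x - v x $ j *\<^sub>R wderiv j v x) = (\<lambda>x. ?a x + ?b x)"
        by (rule ext) (simp add: scaleR_diff_left scaleR_diff_right)
      then have "l2norm (\<lambda>x. trunc n v x $ j *\<^sub>R pd j (trunc n v) x - v x $ j *\<^sub>R wderiv j v x) \<le> l2norm ?a + l2norm ?b"
        using l2norm_triangle[OF a(1) b(1)] by simp
      also have "\<dots> \<le> M * l2norm (\<lambda>x. trunc n v x - v x) + M * l2norm (\<lambda>x. pd j (trunc n v) x - wderiv j v x)"
        by (intro add_mono a(2) b(2))
      finally show ?thesis unfolding pd_trunc[OF v1] .
    qed
    have "(\<lambda>n. M * l2norm (\<lambda>x. trunc n v x - v x) + M * l2norm (\<lambda>x. trunc n (wderiv j v) x - wderiv j v x)) \<longlonglongrightarrow> M * 0 + M * 0"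
      by (intro tendsto_add tendsto_mult tendsto_const trunc_tendsto_L2 vL dL)
    then have lim0: "(\<lambda>n. M * l2norm (\<lambda>x. trunc n v x - v x) + M * l2norm (\<lambda>x. trunc n (wderiv j v) x - wderiv j v x)) \<longlonglongrightarrow> 0"
      by simp
    show "(\<lambda>n. l2norm (\<lambda>x. trunc n v x $ j *\<^sub>R pd j (trunc n v) x - v x $ j *\<^sub>R wderiv j v x)) \<longlonglongrightarrow> 0"
      by (rule Lim_null_comparison[OF _ lim0]) (simp add: le)
  qed
  then show ?thesis
    unfolding convect_eq_sum[OF v w] convect_trunc[OF refl refl w]
    by (intro tendsto_sum)
qed

context
  fixes r :: real and b :: "field \<Rightarrow> field \<Rightarrow> field \<Rightarrow> real"
  assumes r: "5 / 6 < r" "r \<le> 1" and b: "convection_extension r b"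
begin

lemma V_iff: "f \<in> Vspace r \<longleftrightarrow> f \<in> Sobolev r \<and> solen f"
  using Vspace_iff[of r f] r by simp

lemma V_Sobolev: "f \<in> Vspace r \<Longrightarrow> f \<in> Sobolev r"
  by (simp add: V_iff)

lemma V_L2: "f \<in> Vspace r \<Longrightarrow> f \<in> L2"
  by (rule Sobolev_L2[OF V_Sobolev])

lemma V_Hspace: "f \<in> Vspace r \<Longrightarrow> f \<in> Hspace"
  using V_L2[of f] V_iff[of f] by (simp add: Hspace_iff)

lemma V_lincomb: "f \<in> Vspace r \<Longrightarrow> g \<in> Vspace r \<Longrightarrow> (\<lambda>x. a *\<^sub>R f x + c *\<^sub>R g x) \<in> Vspace r"
  using Sobolev_L2 by (auto simp: V_iff intro: Sobolev_lincomb solen_lincomb)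

lemma V_diff: "f \<in> Vspace r \<Longrightarrow> g \<in> Vspace r \<Longrightarrow> (\<lambda>x. f x - g x) \<in> Vspace r"
  using V_lincomb[of f g 1 "-1"] by simp

lemma V_trunc: "f \<in> Vspace r \<Longrightarrow> trunc n f \<in> Vspace r"
  by (simp add: V_iff trunc_Sobolev trunc_solen)

lemma b_lincomb:
  assumes "u \<in> Vspace r" "v \<in> Vspace r" "f \<in> Vspace r" "g \<in> Vspace r"
  shows "b u v (\<lambda>x. a *\<^sub>R f x + c *\<^sub>R g x) = a * b u v f + c * b u v g"
    and "b u (\<lambda>x. a *\<^sub>R f x + c *\<^sub>R g x) v = a * b u f v + c * b u g v"
    and "b (\<lambda>x. a *\<^sub>R f x + c *\<^sub>R g x) u v = a * b f u v + c * b g u v"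
proof -
  have "linear_on_V r (b u v)" "linear_on_V r (\<lambda>w. b u w v)" "linear_on_V r (\<lambda>w. b w u v)"
    using b assms unfolding convection_extension_def by blast+
  then show "b u v (\<lambda>x. a *\<^sub>R f x + c *\<^sub>R g x) = a * b u v f + c * b u v g"
    "b u (\<lambda>x. a *\<^sub>R f x + c *\<^sub>R g x) v = a * b u f v + c * b u g v"
    "b (\<lambda>x. a *\<^sub>R f x + c *\<^sub>R g x) u v = a * b f u v + c * b g u v"
    using assms unfolding linear_on_V_def by blast+
qed

lemma b_diff:
  assumes "u \<in> Vspace r" "v \<in> Vspace r" "f \<in> Vspace r" "g \<in> Vspace r"
  shows "b u v (\<lambda>x. f x - g x) = b u v f - b u v g"
    and "b u (\<lambda>x. f x - g x) v = b u f v - b u g v"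
    and "b (\<lambda>x. f x - g x) u v = b f u v - b g u v"
  using b_lincomb[OF assms, of 1 "-1"] by simp_all

lemma b_bound:
  obtains C where "0 \<le> C" "\<And>u v w. u \<in> Vspace r \<Longrightarrow> v \<in> Vspace r \<Longrightarrow> w \<in> Vspace r \<Longrightarrow>
    \<bar>b u v w\<bar> \<le> C * hsnorm r u * hsnorm r v * hsnorm r w"
proof -
  obtain C where C: "\<And>u v w. u \<in> Vspace r \<Longrightarrow> v \<in> Vspace r \<Longrightarrow> w \<in> Vspace r \<Longrightarrow>
    \<bar>b u v w\<bar> \<le> C * hsnorm r u * hsnorm r v * hsnorm r w"
    using b unfolding convection_extension_def by blast
  show ?thesis
  proof (rule that[of "\<bar>C\<bar>"])
    fix u v w assume V: "u \<in> Vspace r" "v \<in> Vspace r" "w \<in> Vspace r"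
    have "C * (hsnorm r u * hsnorm r v * hsnorm r w) \<le> \<bar>C\<bar> * (hsnorm r u * hsnorm r v * hsnorm r w)"
      by (intro mult_right_mono mult_nonneg_nonneg) simp_all
    with C[OF V] show "\<bar>b u v w\<bar> \<le> \<bar>C\<bar> * hsnorm r u * hsnorm r v * hsnorm r w"
      by (simp only: mult.assoc)
  qed simp
qed

text \<open>Telescoping in the three arguments. This is the only way identities reach
  \<open>b\<close>: they are checked on truncations and passed to the limit here.\<close>

lemma b_tendsto:
  assumes F: "\<And>n. F n \<in> Vspace r" "f \<in> Vspace r" "((\<lambda>n. hsnorm r (\<lambda>x. F n x - f x)) \<longlongrightarrow> 0) \<F>"
    and G: "\<And>n. G n \<in> Vspace r" "g \<in> Vspace r" "((\<lambda>n. hsnorm r (\<lambda>x. G n x - g x)) \<longlongrightarrow> 0) \<F>"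
    and W: "\<And>n. W n \<in> Vspace r" "w \<in> Vspace r" "((\<lambda>n. hsnorm r (\<lambda>x. W n x - w x)) \<longlongrightarrow> 0) \<F>"
  shows "((\<lambda>n. b (F n) (G n) (W n)) \<longlongrightarrow> b f g w) \<F>"
proof -
  obtain C where C: "\<And>u v w. u \<in> Vspace r \<Longrightarrow> v \<in> Vspace r \<Longrightarrow> w \<in> Vspace r \<Longrightarrow>
    \<bar>b u v w\<bar> \<le> C * hsnorm r u * hsnorm r v * hsnorm r w"
    using b_bound by metis
  let ?N = "hsnorm r"
  let ?R = "\<lambda>n. C * ?N (\<lambda>x. F n x - f x) * ?N (G n) * ?N (W n) + C * ?N f * ?N (\<lambda>x. G n x - g x) * ?N (W n)
      + C * ?N f * ?N g * ?N (\<lambda>x. W n x - w x)"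
  have nG: "((\<lambda>n. ?N (G n)) \<longlongrightarrow> ?N g) \<F>" and nW: "((\<lambda>n. ?N (W n)) \<longlongrightarrow> ?N w) \<F>"
    by (rule tendsto_hsnorm[OF V_Sobolev[OF G(1)] V_Sobolev[OF G(2)] G(3)],
        rule tendsto_hsnorm[OF V_Sobolev[OF W(1)] V_Sobolev[OF W(2)] W(3)])
  have "(?R \<longlongrightarrow> C * 0 * ?N g * ?N w + C * ?N f * 0 * ?N w + C * ?N f * ?N g * 0) \<F>"
    by (intro tendsto_add tendsto_mult tendsto_const F(3) G(3) W(3) nG nW)
  then have R0: "(?R \<longlongrightarrow> 0) \<F>" by simp
  have "norm (b (F n) (G n) (W n) - b f g w) \<le> ?R n" for n
  proof -
    have "b (F n) (G n) (W n) - b f g w = b (\<lambda>x. F n x - f x) (G n) (W n)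
        + b f (\<lambda>x. G n x - g x) (W n) + b f g (\<lambda>x. W n x - w x)"
      by (simp add: b_diff F G W)
    moreover have "\<bar>b (\<lambda>x. F n x - f x) (G n) (W n)\<bar> \<le> C * ?N (\<lambda>x. F n x - f x) * ?N (G n) * ?N (W n)"
      by (intro C V_diff F G W)
    moreover have "\<bar>b f (\<lambda>x. G n x - g x) (W n)\<bar> \<le> C * ?N f * ?N (\<lambda>x. G n x - g x) * ?N (W n)"
      by (intro C V_diff F G W)
    moreover have "\<bar>b f g (\<lambda>x. W n x - w x)\<bar> \<le> C * ?N f * ?N g * ?N (\<lambda>x. W n x - w x)"
      by (intro C V_diff F G W)
    ultimately show ?thesis unfolding real_norm_def by linarith
  qed
  then have "eventually (\<lambda>n. norm (b (F n) (G n) (W n) - b f g w) \<le> ?R n) \<F>" by simp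
  from LIM_zero_cancel[OF Lim_null_comparison[OF this R0]] show ?thesis .
qed

lemma V_trunc_tendsto: "f \<in> Vspace r \<Longrightarrow> (\<lambda>n. hsnorm r (\<lambda>x. trunc n f x - f x)) \<longlonglongrightarrow> 0"
  by (rule trunc_tendsto_hsnorm[OF V_Sobolev])

lemma V_const_tendsto: "((\<lambda>n. hsnorm r (\<lambda>x. f x - f x)) \<longlongrightarrow> 0) \<F>"
proof -
  have "hsnorm r (\<lambda>x. f x - f x) = 0"
    by (simp add: hsnorm_eq_wform wform_def)
  then show ?thesis by simp
qed

lemma b_trunc:
  assumes "f \<in> Vspace r" "g \<in> Vspace r" "w \<in> Vspace r"
  shows "b (trunc m f) (trunc n g) w = (\<Sum>j\<in>UNIV. l2inner (\<lambda>x. trunc m f x $ j *\<^sub>R pd j (trunc n g) x) w)"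
proof -
  have "trunc m f \<in> smooth_sol" "trunc n g \<in> smooth_sol"
    using assms by (simp_all add: V_iff trunc_smooth_sol)
  then have "b (trunc m f) (trunc n g) w = l2inner (convect (trunc m f) (trunc n g)) w"
    using b assms(3) unfolding convection_extension_def by blast
  then show ?thesis
    by (simp only: convect_trunc[OF refl refl V_Hspace[OF assms(3)]])
qed

lemma b_self_0:
  assumes f: "f \<in> Vspace r" and g: "g \<in> Vspace r"
  shows "b f g g = 0"
proof -
  have "b (trunc n f) (trunc n g) (trunc n g) = 0" for n
  proof -
    have "trunc n f \<in> smooth_sol" using f by (simp add: V_iff trunc_smooth_sol)
    then have "(\<Sum>j\<in>UNIV. pd j (trunc n f) x $ j) = 0" for x
      by (simp add: smooth_sol_def)
    then show ?thesis
      unfolding b_trunc[OF f g V_trunc[OF g]]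
      by (intro convection_cancels periodic_synth Ck_synth)
  qed
  moreover have "(\<lambda>n. b (trunc n f) (trunc n g) (trunc n g)) \<longlonglongrightarrow> b f g g"
    by (intro b_tendsto V_trunc f g V_trunc_tendsto)
  ultimately show ?thesis
    by (simp add: LIMSEQ_const_iff)
qed

text \<open>Polarization of \<open>b_self_0\<close> at v + w.\<close>

lemma b_antisym:
  assumes u: "u \<in> Vspace r" and v: "v \<in> Vspace r" and w: "w \<in> Vspace r"
  shows "b u v w = - b u w v"
proof -
  let ?s = "\<lambda>x. 1 *\<^sub>R v x + 1 *\<^sub>R w x"
  have s: "?s \<in> Vspace r" by (rule V_lincomb[OF v w])
  have "b u ?s ?s = 1 * b u ?s v + 1 * b u ?s w"
    by (rule b_lincomb(1)[OF u s v w])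
  also have "b u ?s v = 1 * b u v v + 1 * b u w v"
    by (rule b_lincomb(2)[OF u v v w])
  also have "b u ?s w = 1 * b u v w + 1 * b u w w"
    by (rule b_lincomb(2)[OF u w v w])
  finally show ?thesis
    using b_self_0[OF u s] b_self_0[OF u v] b_self_0[OF u w] by simp
qed

lemma V_of_Sobolev: "v \<in> Sobolev 3 \<Longrightarrow> solen v \<Longrightarrow> v \<in> Vspace r"
  using Sobolev_mono[of r 3 v] r by (simp add: V_iff)

text \<open>Links the two readings of the nonlinearity: pointwise, as in the Euler equations, and
  through the extension \<open>b\<close>, as in the Voigt equations. Both are limits of the same
  truncated expressions.\<close>

lemma b_eq_convect:
  assumes v: "v \<in> Sobolev 3" "solen v" and w: "w \<in> Vspace r"
  shows "l2inner (convect v v) w = b v v w"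
proof -
  have vV: "v \<in> Vspace r" by (rule V_of_Sobolev[OF v])
  have "(\<lambda>n. b (trunc n v) (trunc n v) w) \<longlonglongrightarrow> b v v w"
    by (intro b_tendsto V_trunc vV w V_trunc_tendsto V_const_tendsto)
  moreover have "b (trunc n v) (trunc n v) w = l2inner (convect (trunc n v) (trunc n v)) w" for n
    unfolding b_trunc[OF vV vV w] convect_trunc[OF refl refl V_Hspace[OF w]] ..
  ultimately show ?thesis
    using LIMSEQ_unique[OF convect_trunc_tendsto[OF v(1) V_Hspace[OF w]]] by simp
qed

text \<open>\<open>b\<close> alone is bounded by V^r norms of w. With the derivative falling on v
  only, the truncated forms are bounded by the L2 norm of w, and this survives the limit.\<close>

lemma b_stretching_bound:
  assumes C: "0 \<le> C" "\<And>n x j. norm (pd j (trunc n v) x) \<le> C"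
    and v: "v \<in> Vspace r" and w: "w \<in> Vspace r"
  shows "\<bar>b w v w\<bar> \<le> 3 * C * (l2norm w)\<^sup>2"
proof -
  note wL = V_L2[OF w]
  have le: "\<bar>b (trunc n w) (trunc n v) (trunc n w)\<bar> \<le> 3 * C * (l2norm w)\<^sup>2" for n
  proof -
    have "\<bar>b (trunc n w) (trunc n v) (trunc n w)\<bar> \<le> 3 * C * (l2norm (trunc n w) * l2norm (trunc n w))"
      unfolding b_trunc[OF w v V_trunc[OF w]]
      by (rule convect_stretching_bound[OF synth_L2 synth_L2 C(2,1)]) (simp only: pd_synth synth_L2)
    also have "\<dots> \<le> 3 * C * (l2norm w * l2norm w)"
      using C(1) l2norm_trunc_le[OF wL, of n] by (intro mult_left_mono mult_mono) simp_all
    finally show ?thesis by (simp only: power2_eq_square)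
  qed
  have "(\<lambda>n. \<bar>b (trunc n w) (trunc n v) (trunc n w)\<bar>) \<longlonglongrightarrow> \<bar>b w v w\<bar>"
    by (intro tendsto_rabs b_tendsto V_trunc v w V_trunc_tendsto)
  then show ?thesis
    by (rule LIMSEQ_le_const2) (use le in blast)
qed

end

subsection \<open>Calculus in time\<close>

text \<open>The function exp(-k s) (F s + c / k) is nonincreasing.\<close>

lemma gronwall_derivative:
  fixes F F' :: "real \<Rightarrow> real"
  assumes k: "0 < k" and c: "0 \<le> c" and t: "t \<in> {0..T}"
    and D: "\<And>t. t \<in> {0..T} \<Longrightarrow> (F has_real_derivative F' t) (at t within {0..T})"
    and le: "\<And>t. t \<in> {0..T} \<Longrightarrow> F' t \<le> k * F t + c" and F0: "F 0 \<le> 0"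
  shows "F t \<le> c / k * exp (k * t)"
proof -
  define g where "g s = exp (- k * s) * (F s + c / k)" for s
  have Dg: "(g has_real_derivative exp (- k * s) * (F' s - k * F s - c)) (at s within {0..T})"
    if "s \<in> {0..T}" for s
    unfolding g_def using k
    by (auto intro!: derivative_eq_intros D[OF that] simp: field_simps)
  have "g 0 \<ge> g t"
  proof (rule DERIV_nonpos_imp_decreasing_open[where f = g and a = 0 and b = t])
    show "0 \<le> t" using t by simp
    have "continuous_on {0..T} g"
      using Dg by (rule DERIV_continuous_on)
    then show "continuous_on {0..t} g"
      by (rule continuous_on_subset) (use t in auto)
    fix s assume s: "0 < s" "s < t"
    then have sT: "s \<in> {0..T}" "s < T" using t by auto
    have "(g has_real_derivative exp (- k * s) * (F' s - k * F s - c)) (at s)"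
      using Dg[OF sT(1)] at_within_Icc_at[OF s(1) sT(2)] by simp
    moreover have "exp (- k * s) * (F' s - k * F s - c) \<le> 0"
      using le[OF sT(1)] by (intro mult_nonneg_nonpos) simp_all
    ultimately show "\<exists>y. (g has_real_derivative y) (at s) \<and> y \<le> 0" by blast
  qed
  also have "g 0 \<le> c / k" using F0 by (simp add: g_def)
  finally have "exp (- k * t) * (F t + c / k) \<le> c / k" by (simp add: g_def)
  then have "exp (k * t) * (exp (- k * t) * (F t + c / k)) \<le> exp (k * t) * (c / k)"
    by (intro mult_left_mono) simp_all
  also have "exp (k * t) * (exp (- k * t) * (F t + c / k)) = F t + c / k"
    by (simp add: mult.assoc[symmetric] exp_add[symmetric])
  finally have "F t + c / k \<le> c / k * exp (k * t)" by (simp add: mult.commute)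
  moreover have "0 \<le> c / k" using k c by simp
  ultimately show ?thesis by linarith
qed

text \<open>A product rule for \<open>t \<mapsto> B t t\<close> that only requires each factor to be differentiable when
  the other one is frozen, together with control of the mixed second difference.\<close>

lemma diagonal_derivative:
  fixes B :: "real \<Rightarrow> real \<Rightarrow> real" and \<epsilon> :: "real \<Rightarrow> real"
  assumes X: "((\<lambda>s. B s t) has_real_derivative X) (at t within S)"
    and Y: "((\<lambda>s. B t s) has_real_derivative Y) (at t within S)"
    and R: "\<And>s. s \<in> S \<Longrightarrow> \<bar>B s s - B s t - B t s + B t t\<bar> \<le> \<bar>s - t\<bar> * \<epsilon> s"
    and e: "(\<epsilon> \<longlongrightarrow> 0) (at t within S)"
  shows "((\<lambda>s. B s s) has_real_derivative X + Y) (at t within S)"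
proof -
  let ?R = "\<lambda>s. B s s - B s t - B t s + B t t"
  have "(?R has_real_derivative 0) (at t within S)"
    unfolding has_field_derivative_iff
  proof (rule Lim_null_comparison[OF _ e])
    have "norm ((?R s - ?R t) / (s - t)) \<le> \<epsilon> s" if "s \<noteq> t" "s \<in> S" for s
      using R[OF that(2)] that(1) by (simp add: pos_divide_le_eq mult.commute)
    then show "eventually (\<lambda>s. norm ((?R s - ?R t) / (s - t)) \<le> \<epsilon> s) (at t within S)"
      by (auto simp: eventually_at_filter)
  qed
  then have "((\<lambda>s. ?R s + B s t + B t s - B t t) has_real_derivative 0 + X + Y - 0) (at t within S)"
    by (intro DERIV_diff DERIV_add X Y DERIV_const)
  then show ?thesis by simp
qed

lemma tendsto_imp_bounded_Icc:
  fixes g :: "real \<Rightarrow> real"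
  assumes "\<And>t. t \<in> {0..T} \<Longrightarrow> (g \<longlongrightarrow> g t) (at t within {0..T})"
  shows "\<exists>M\<ge>0. \<forall>t\<in>{0..T}. \<bar>g t\<bar> \<le> M"
proof -
  have "continuous_on {0..T} g"
    using assms by (simp add: continuous_on_def)
  then have "bounded (g ` {0..T})"
    by (intro compact_imp_bounded compact_continuous_image) simp_all
  then obtain M where "\<forall>t\<in>{0..T}. \<bar>g t\<bar> \<le> M"
    unfolding bounded_iff by auto
  then have "\<forall>t\<in>{0..T}. \<bar>g t\<bar> \<le> max 0 M" by auto
  then show ?thesis by (meson max.cobounded1)
qed

subsection \<open>The Voigt form\<close>

text \<open>The form of I + alpha^(2r) A^r, with \<open>a\<close> standing for alpha^(2r).\<close>

definition voigt_form :: "real \<Rightarrow> real \<Rightarrow> field \<Rightarrow> field \<Rightarrow> real" where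
  "voigt_form a r f g = l2inner f g + a * wform (fweight r) f g"

lemma Sobolev_fweight: "0 \<le> r \<Longrightarrow> f \<in> Sobolev r \<Longrightarrow> f \<in> wspace (fweight r)"
  unfolding Sobolev_eq_wspace by (rule wspace_mono[OF fweight_nonneg fweight_le_sweight])

lemma wform_fweight_le:
  assumes "0 \<le> r" "f \<in> Sobolev r"
  shows "sqrt (wform (fweight r) f f) \<le> hsnorm r f"
  unfolding hsnorm_eq_wform
  using assms(2) unfolding Sobolev_eq_wspace
  by (intro real_sqrt_le_mono wform_mono[OF fweight_nonneg fweight_le_sweight[OF assms(1)]])

lemma voigt_form_commute: "voigt_form a r f g = voigt_form a r g f"
  unfolding voigt_form_def l2inner_commute[of f g] wform_commute[of _ f g] ..

lemma voigt_form_lincomb_left: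
  assumes "0 \<le> r" "f \<in> Sobolev r" "g \<in> Sobolev r" "h \<in> Sobolev r"
  shows "voigt_form a r (\<lambda>x. p *\<^sub>R f x + q *\<^sub>R g x) h = p * voigt_form a r f h + q * voigt_form a r g h"
  unfolding voigt_form_def
    l2inner_lincomb_left[OF Sobolev_L2[OF assms(2)] Sobolev_L2[OF assms(3)] Sobolev_L2[OF assms(4)]]
    wform_lincomb_left[OF fweight_nonneg Sobolev_fweight[OF assms(1,2)] Sobolev_fweight[OF assms(1,3)] Sobolev_fweight[OF assms(1,4)]]
  by (simp add: algebra_simps)

lemma voigt_form_diff_left:
  assumes "0 \<le> r" "f \<in> Sobolev r" "g \<in> Sobolev r" "h \<in> Sobolev r"
  shows "voigt_form a r (\<lambda>x. f x - g x) h = voigt_form a r f h - voigt_form a r g h"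
  using voigt_form_lincomb_left[OF assms, of a 1 "-1"] by simp

lemma voigt_form_diff_right:
  assumes "0 \<le> r" "f \<in> Sobolev r" "g \<in> Sobolev r" "h \<in> Sobolev r"
  shows "voigt_form a r h (\<lambda>x. f x - g x) = voigt_form a r h f - voigt_form a r h g"
  using voigt_form_diff_left[OF assms] by (simp only: voigt_form_commute[of a r h])

lemma voigt_form_bound:
  assumes r: "0 \<le> r" and a: "0 \<le> a" and f: "f \<in> Sobolev r" and g: "g \<in> Sobolev r"
  shows "\<bar>voigt_form a r f g\<bar> \<le> (1 + a) * hsnorm r f * hsnorm r g"
proof -
  have 1: "\<bar>l2inner f g\<bar> \<le> hsnorm r f * hsnorm r g"
    using l2inner_Cauchy_Schwarz[OF Sobolev_L2[OF f] Sobolev_L2[OF g]]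
      mult_mono[OF l2norm_le_hsnorm[OF r f] l2norm_le_hsnorm[OF r g]] by simp
  have 2: "\<bar>wform (fweight r) f g\<bar> \<le> hsnorm r f * hsnorm r g"
    using wform_Cauchy_Schwarz[OF fweight_nonneg Sobolev_fweight[OF r f] Sobolev_fweight[OF r g]]
      mult_mono[OF wform_fweight_le[OF r f] wform_fweight_le[OF r g]]
    by (simp add: wform_self_nonneg[OF fweight_nonneg])
  have "\<bar>voigt_form a r f g\<bar> \<le> \<bar>l2inner f g\<bar> + a * \<bar>wform (fweight r) f g\<bar>"
    unfolding voigt_form_def using abs_triangle_ineq[of "l2inner f g" "a * wform (fweight r) f g"] a
    by (simp add: abs_mult)
  also have "\<dots> \<le> hsnorm r f * hsnorm r g + a * (hsnorm r f * hsnorm r g)"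
    by (intro add_mono 1 mult_left_mono 2 a)
  finally show ?thesis by (simp add: algebra_simps)
qed

text \<open>A bounded linear functional carries strong differentiability of a path to its values.
  \<open>V\<close> and \<open>N\<close> are abstract, linearity being known only on a set of
  functions.\<close>

lemma derivative_of_functional:
  fixes v :: "real \<Rightarrow> field" and \<l> :: "field \<Rightarrow> real"
  assumes V: "\<And>s. v s \<in> V" "v' \<in> V" and closed: "\<And>f g p q. f \<in> V \<Longrightarrow> g \<in> V \<Longrightarrow> (\<lambda>x. p *\<^sub>R f x + q *\<^sub>R g x) \<in> V"
    and lin: "\<And>f g p q. f \<in> V \<Longrightarrow> g \<in> V \<Longrightarrow> \<l> (\<lambda>x. p *\<^sub>R f x + q *\<^sub>R g x) = p * \<l> f + q * \<l> g"
    and bound: "\<And>f. f \<in> V \<Longrightarrow> \<bar>\<l> f\<bar> \<le> c * N f"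
    and d: "((\<lambda>s. N (\<lambda>x. (1 / (s - t)) *\<^sub>R (v s x - v t x) - v' x)) \<longlongrightarrow> 0) (at t within S)"
  shows "((\<lambda>s. \<l> (v s)) has_real_derivative \<l> v') (at t within S)"
  unfolding has_field_derivative_iff
proof (rule LIM_zero_cancel, rule Lim_null_comparison)
  show "((\<lambda>s. c * N (\<lambda>x. (1 / (s - t)) *\<^sub>R (v s x - v t x) - v' x)) \<longlongrightarrow> 0) (at t within S)"
    using tendsto_mult_left[OF d, of c] by simp
  have "norm ((\<l> (v s) - \<l> (v t)) / (s - t) - \<l> v') \<le> c * N (\<lambda>x. (1 / (s - t)) *\<^sub>R (v s x - v t x) - v' x)" for s
  proof -
    \<comment> \<open>No case distinction at s = t: division by zero makes both difference quotients
      vanish there.\<close>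
    let ?q = "\<lambda>x. (1 / (s - t)) *\<^sub>R v s x + (- 1 / (s - t)) *\<^sub>R v t x"
    have q: "?q \<in> V" by (rule closed[OF V(1) V(1)])
    have eq: "(\<lambda>x. (1 / (s - t)) *\<^sub>R (v s x - v t x) - v' x) = (\<lambda>x. 1 *\<^sub>R ?q x + (- 1) *\<^sub>R v' x)"
      by (rule ext) (simp add: scaleR_diff_right)
    have "\<l> (\<lambda>x. 1 *\<^sub>R ?q x + (- 1) *\<^sub>R v' x) = 1 * \<l> ?q + (- 1) * \<l> v'"
      by (rule lin[OF q V(2)])
    also have "\<l> ?q = (1 / (s - t)) * \<l> (v s) + (- 1 / (s - t)) * \<l> (v t)"
      by (rule lin[OF V(1) V(1)])
    finally have "\<l> (\<lambda>x. 1 *\<^sub>R ?q x + (- 1) *\<^sub>R v' x) = (\<l> (v s) - \<l> (v t)) / (s - t) - \<l> v'"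
      by (simp add: diff_divide_distrib)
    then show ?thesis
      using bound[OF closed[OF q V(2), of 1 "- 1"]] unfolding eq by simp
  qed
  then show "eventually (\<lambda>s. norm ((\<l> (v s) - \<l> (v t)) / (s - t) - \<l> v')
      \<le> c * N (\<lambda>x. (1 / (s - t)) *\<^sub>R (v s x - v t x) - v' x)) (at t within S)"
    by simp
qed

subsection \<open>The relative energy estimate\<close>

text \<open>Membership is assumed at all real times, which clamping the paths will provide, while
  limits and equations concern [0, T] only. The datum \<open>ui\<close> is kept apart from
  \<open>u 0\<close> and \<open>v 0\<close>: the equation relates it to \<open>u 0\<close> only
  through the form \<open>L\<close>, and to \<open>v 0\<close> it is tied by Fourier coefficients.
  One bound \<open>A\<close> serves v and its time derivative.\<close>

context
  fixes r T a A K :: real and b :: "field \<Rightarrow> field \<Rightarrow> field \<Rightarrow> real" and ui :: field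
    and u v v' :: "real \<Rightarrow> field"
  assumes r: "5 / 6 < r" "r \<le> 1" and b: "convection_extension r b"
    and a: "0 < a" and A: "0 \<le> A" and K: "0 \<le> K"
    and uV: "\<And>t. u t \<in> Vspace r" and u0V: "ui \<in> Vspace r"
    and uc: "\<And>t. t \<in> {0..T} \<Longrightarrow> ((\<lambda>s. hsnorm r (\<lambda>x. u s x - u t x)) \<longlongrightarrow> 0) (at t within {0..T})"
    and eqn: "\<And>t w. t \<in> {0..T} \<Longrightarrow> w \<in> Vspace r \<Longrightarrow>
      voigt_form a r (u t) w - voigt_form a r ui w = - integral {0..t} (\<lambda>\<tau>. b (u \<tau>) (u \<tau>) w)"
    and vV: "\<And>t. v t \<in> Vspace r" and v'V: "\<And>t. v' t \<in> Vspace r"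
    and vc: "\<And>t. t \<in> {0..T} \<Longrightarrow> ((\<lambda>s. hsnorm r (\<lambda>x. v s x - v t x)) \<longlongrightarrow> 0) (at t within {0..T})"
    and vd: "\<And>t. t \<in> {0..T} \<Longrightarrow>
      ((\<lambda>s. hsnorm r (\<lambda>x. (1 / (s - t)) *\<^sub>R (v s x - v t x) - v' t x)) \<longlongrightarrow> 0) (at t within {0..T})"
    and euler: "\<And>t w. t \<in> {0..T} \<Longrightarrow> w \<in> Vspace r \<Longrightarrow> l2inner (v' t) w = - b (v t) (v t) w"
    and v0: "\<And>k. fourier (v 0) k = fourier ui k"
    and stretch: "\<And>t w. t \<in> {0..T} \<Longrightarrow> w \<in> Vspace r \<Longrightarrow> \<bar>b w (v t) w\<bar> \<le> K * (l2norm w)\<^sup>2"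
    and Av: "\<And>t. t \<in> {0..T} \<Longrightarrow> hsnorm r (v t) \<le> A"
    and Av': "\<And>t. t \<in> {0..T} \<Longrightarrow> hsnorm r (v' t) \<le> A"
begin

lemma r0: "0 \<le> r" using r by simp

abbreviation (input) L where "L \<equiv> voigt_form a r"
abbreviation (input) Q where "Q \<equiv> wform (fweight r)"
abbreviation (input) N where "N \<equiv> hsnorm r"

lemmas VS = V_Sobolev[OF r b]
lemmas L_diff_right = voigt_form_diff_right[OF r0 VS VS VS]

lemma u_form_derivative:
  assumes t: "t \<in> {0..T}" and w: "w \<in> Vspace r"
  shows "((\<lambda>s. L (u s) w) has_real_derivative - b (u t) (u t) w) (at t within {0..T})"
proof -
  have "continuous_on {0..T} (\<lambda>\<tau>. b (u \<tau>) (u \<tau>) w)"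
    unfolding continuous_on_def
    by (intro ballI b_tendsto[OF r b] uV w uc V_const_tendsto[OF r b])
  from integral_has_real_derivative[OF this t]
  have "((\<lambda>s. L ui w - integral {0..s} (\<lambda>\<tau>. b (u \<tau>) (u \<tau>) w)) has_real_derivative 0 - b (u t) (u t) w) (at t within {0..T})"
    by (intro DERIV_diff DERIV_const)
  moreover have "L ui w - integral {0..s} (\<lambda>\<tau>. b (u \<tau>) (u \<tau>) w) = L (u s) w" if "s \<in> {0..T}" for s
    using eqn[OF that w] by simp
  ultimately show ?thesis
    using has_field_derivative_cong_eventually[of "\<lambda>s. L ui w - integral {0..s} (\<lambda>\<tau>. b (u \<tau>) (u \<tau>) w)"
        "\<lambda>s. L (u s) w" t "{0..T}"] t
    by (simp add: eventually_at_filter)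
qed

text \<open>The derivative of L(u s, w) is bounded by a constant times the norm of w, so L(u s, .)
  is Lipschitz into the dual of V^r. This stands in for a time derivative of u.\<close>

lemma u_form_Lipschitz:
  obtains M where "0 \<le> M" "\<And>s t w. s \<in> {0..T} \<Longrightarrow> t \<in> {0..T} \<Longrightarrow> w \<in> Vspace r \<Longrightarrow>
    \<bar>L (u s) w - L (u t) w\<bar> \<le> \<bar>s - t\<bar> * (M * N w)"
proof -
  have "((\<lambda>s. N (u s)) \<longlongrightarrow> N (u t)) (at t within {0..T})" if "t \<in> {0..T}" for t
    by (rule tendsto_hsnorm[OF VS[OF uV] VS[OF uV] uc[OF that]])
  from tendsto_imp_bounded_Icc[OF this]
  obtain B where B: "0 \<le> B" "\<And>t. t \<in> {0..T} \<Longrightarrow> \<bar>N (u t)\<bar> \<le> B" by blast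
  obtain C where C: "0 \<le> C" "\<And>u v w. u \<in> Vspace r \<Longrightarrow> v \<in> Vspace r \<Longrightarrow> w \<in> Vspace r \<Longrightarrow>
    \<bar>b u v w\<bar> \<le> C * N u * N v * N w"
    using b_bound[OF r b] by metis
  show ?thesis
  proof (rule that[of "C * B * B"])
    show "0 \<le> C * B * B" using B C by simp
    fix s t w assume s: "s \<in> {0..T}" and t: "t \<in> {0..T}" and w: "w \<in> Vspace r"
    have bd: "norm (- b (u z) (u z) w) \<le> C * B * B * N w" if "z \<in> {0..T}" for z
    proof -
      have "\<bar>b (u z) (u z) w\<bar> \<le> C * N (u z) * N (u z) * N w" by (intro C(2) uV w)
      also have "\<dots> \<le> C * B * B * N w"
        using B(2)[OF that] B(1) C(1) by (intro mult_right_mono mult_mono) simp_all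
      finally show ?thesis by simp
    qed
    have "norm (L (u s) w - L (u t) w) \<le> C * B * B * N w * norm (s - t)"
      by (rule field_differentiable_bound[where S = "{0..T}", OF _ u_form_derivative[OF _ w] bd s t]) simp
    then show "\<bar>L (u s) w - L (u t) w\<bar> \<le> \<bar>s - t\<bar> * (C * B * B * N w)"
      by (simp add: mult.commute)
  qed
qed

text \<open>The mixed second difference is the functional L(u s, .) - L(u t, .) at y s - y t: the
  first gives |s - t|, and continuity of y makes the second vanish.\<close>

lemma form_diagonal_derivative:
  assumes t: "t \<in> {0..T}" and y: "\<And>s. y s \<in> Vspace r"
    and yc: "((\<lambda>s. N (\<lambda>x. y s x - y t x)) \<longlongrightarrow> 0) (at t within {0..T})"
    and Y: "((\<lambda>s. L (u t) (y s)) has_real_derivative Y) (at t within {0..T})"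
  shows "((\<lambda>s. L (u s) (y s)) has_real_derivative - b (u t) (u t) (y t) + Y) (at t within {0..T})"
proof -
  obtain M where M: "0 \<le> M" "\<And>s t w. s \<in> {0..T} \<Longrightarrow> t \<in> {0..T} \<Longrightarrow> w \<in> Vspace r \<Longrightarrow>
    \<bar>L (u s) w - L (u t) w\<bar> \<le> \<bar>s - t\<bar> * (M * N w)"
    using u_form_Lipschitz by metis
  show ?thesis
  proof (rule diagonal_derivative[where B = "\<lambda>s s'. L (u s) (y s')"])
    show "((\<lambda>s. L (u s) (y t)) has_real_derivative - b (u t) (u t) (y t)) (at t within {0..T})"
      by (rule u_form_derivative[OF t y])
    show "((\<lambda>s. L (u t) (y s)) has_real_derivative Y) (at t within {0..T})" by (rule Y)
    show "((\<lambda>s. M * N (\<lambda>x. y s x - y t x)) \<longlongrightarrow> 0) (at t within {0..T})"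
      using tendsto_mult_left[OF yc, of M] by simp
    fix s assume s: "s \<in> {0..T}"
    have "L (u s) (y s) - L (u s) (y t) - L (u t) (y s) + L (u t) (y t)
        = L (u s) (\<lambda>x. y s x - y t x) - L (u t) (\<lambda>x. y s x - y t x)"
      by (simp add: L_diff_right uV y)
    then show "\<bar>L (u s) (y s) - L (u s) (y t) - L (u t) (y s) + L (u t) (y t)\<bar>
        \<le> \<bar>s - t\<bar> * (M * N (\<lambda>x. y s x - y t x))"
      using M(2)[OF s t V_diff[OF r b y y]] by simp
  qed
qed

lemma energy_derivative:
  assumes t: "t \<in> {0..T}"
  shows "((\<lambda>s. L (u s) (u s)) has_real_derivative 0) (at t within {0..T})"
proof -
  have b0: "b (u t) (u t) (u t) = 0" by (rule b_self_0[OF r b uV uV])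
  have "((\<lambda>s. L (u t) (u s)) has_real_derivative - b (u t) (u t) (u t)) (at t within {0..T})"
    using u_form_derivative[OF t uV[of t]] by (simp only: voigt_form_commute[of a r "u t"])
  from form_diagonal_derivative[OF t uV uc[OF t] this] show ?thesis
    by (simp add: b0)
qed

lemma mixed_derivative:
  assumes t: "t \<in> {0..T}"
  shows "((\<lambda>s. L (u s) (v s)) has_real_derivative - b (u t) (u t) (v t) + L (u t) (v' t)) (at t within {0..T})"
proof (rule form_diagonal_derivative[OF t vV vc[OF t]])
  show "((\<lambda>s. L (u t) (v s)) has_real_derivative L (u t) (v' t)) (at t within {0..T})"
  proof (rule derivative_of_functional[where \<l> = "L (u t)" and V = "Vspace r" and c = "(1 + a) * N (u t)"
        and N = "hsnorm r", OF vV v'V _ _ _ vd[OF t]])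
    fix f g p q assume fg: "f \<in> Vspace r" "g \<in> Vspace r"
    show "(\<lambda>x. p *\<^sub>R f x + q *\<^sub>R g x) \<in> Vspace r" by (rule V_lincomb[OF r b fg])
    show "L (u t) (\<lambda>x. p *\<^sub>R f x + q *\<^sub>R g x) = p * L (u t) f + q * L (u t) g"
      unfolding voigt_form_commute[of a r "u t"]
      by (rule voigt_form_lincomb_left[OF r0 VS[OF fg(1)] VS[OF fg(2)] VS[OF uV]])
  next
    fix f assume "f \<in> Vspace r"
    then show "\<bar>L (u t) f\<bar> \<le> (1 + a) * N (u t) * N f"
      using a by (intro voigt_form_bound r0 VS uV) simp_all
  qed
qed

lemma v_norm_derivative:
  assumes t: "t \<in> {0..T}"
  shows "((\<lambda>s. l2inner (v s) (v s)) has_real_derivative 0) (at t within {0..T})"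
proof -
  let ?q = "\<lambda>s x. (1 / (s - t)) *\<^sub>R (v s x - v t x)"
  have e0: "l2inner (v' t) (v t) = 0"
    using euler[OF t vV[of t]] b_self_0[OF r b vV vV] by simp
  have "((\<lambda>s. l2inner (v t) (v s)) has_real_derivative l2inner (v t) (v' t)) (at t within {0..T})"
  proof (rule derivative_of_functional[where \<l> = "l2inner (v t)" and V = "Vspace r" and c = "N (v t)"
        and N = "hsnorm r", OF vV v'V _ _ _ vd[OF t]])
    fix f g p q assume fg: "f \<in> Vspace r" "g \<in> Vspace r"
    show "(\<lambda>x. p *\<^sub>R f x + q *\<^sub>R g x) \<in> Vspace r" by (rule V_lincomb[OF r b fg])
    show "l2inner (v t) (\<lambda>x. p *\<^sub>R f x + q *\<^sub>R g x) = p * l2inner (v t) f + q * l2inner (v t) g"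
      unfolding l2inner_commute[of "v t"]
      by (rule l2inner_lincomb_left[OF V_L2[OF r b fg(1)] V_L2[OF r b fg(2)] V_L2[OF r b vV]])
  next
    fix f assume f: "f \<in> Vspace r"
    show "\<bar>l2inner (v t) f\<bar> \<le> N (v t) * N f"
      using l2inner_Cauchy_Schwarz[OF V_L2[OF r b vV] V_L2[OF r b f], of t]
        mult_mono[OF l2norm_le_hsnorm[OF r0 VS[OF vV]] l2norm_le_hsnorm[OF r0 VS[OF f]], of t] by simp
  qed
  then have Y: "((\<lambda>s. l2inner (v t) (v s)) has_real_derivative 0) (at t within {0..T})"
    using e0 by (simp add: l2inner_commute)
  have "((\<lambda>s. l2inner (v s) (v s)) has_real_derivative 0 + 0) (at t within {0..T})"
  proof (rule diagonal_derivative[where B = "\<lambda>s s'. l2inner (v s) (v s')", OF _ Y])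
    show "((\<lambda>s. l2inner (v s) (v t)) has_real_derivative 0) (at t within {0..T})"
      using Y by (simp only: l2inner_commute[of "v t"])
    \<comment> \<open>Here the second difference is the squared norm of v s - v t: one factor
      supplies |s - t| through the difference quotient, the other tends to 0.\<close>
    let ?e = "\<lambda>s. (N (\<lambda>x. ?q s x - v' t x) + N (v' t)) * N (\<lambda>x. v s x - v t x)"
    have "(?e \<longlongrightarrow> (0 + N (v' t)) * 0) (at t within {0..T})"
      by (intro tendsto_mult tendsto_add tendsto_const vd[OF t] vc[OF t])
    then show "(?e \<longlongrightarrow> 0) (at t within {0..T})" by simp
    fix s assume s: "s \<in> {0..T}"
    let ?d = "\<lambda>x. v s x - v t x"
    have dV: "?d \<in> Vspace r" by (rule V_diff[OF r b vV vV])
    have qV: "?q s \<in> Vspace r"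
      using V_lincomb[OF r b dV dV, of "1 / (s - t)" 0] by simp
    have "l2inner (v s) (v s) - l2inner (v s) (v t) - l2inner (v t) (v s) + l2inner (v t) (v t) = l2inner ?d ?d"
      using V_L2[OF r b vV] V_L2[OF r b dV]
      by (simp add: l2inner_diff_left l2inner_diff_right)
    then have eq: "\<bar>l2inner (v s) (v s) - l2inner (v s) (v t) - l2inner (v t) (v s) + l2inner (v t) (v t)\<bar> = (l2norm ?d)\<^sup>2"
      by (simp add: l2norm_sq l2inner_self_nonneg)
    have d_le: "N ?d \<le> \<bar>s - t\<bar> * (N (\<lambda>x. ?q s x - v' t x) + N (v' t))"
    proof (cases "s = t")
      case True
      then show ?thesis by (simp add: hsnorm_eq_wform wform_def)
    next
      case False
      then have "?d = (\<lambda>x. (s - t) *\<^sub>R ?q s x)" by simp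
      then have "N ?d = \<bar>s - t\<bar> * N (?q s)"
        using hsnorm_scale[OF VS[OF qV], of "s - t"] by simp
      also have "N (?q s) \<le> N (\<lambda>x. ?q s x - v' t x) + N (v' t)"
        using hsnorm_triangle[OF VS[OF V_diff[OF r b qV v'V[of t]]] VS[OF v'V[of t]]] by simp
      finally show ?thesis by (simp add: mult_left_mono)
    qed
    have "(l2norm ?d)\<^sup>2 \<le> N ?d * N ?d"
      unfolding power2_eq_square by (intro mult_mono l2norm_le_hsnorm r0 VS[OF dV]) simp_all
    also have "\<dots> \<le> \<bar>s - t\<bar> * (N (\<lambda>x. ?q s x - v' t x) + N (v' t)) * N ?d"
      by (rule mult_right_mono[OF d_le]) simp
    finally show "\<bar>l2inner (v s) (v s) - l2inner (v s) (v t) - l2inner (v t) (v s) + l2inner (v t) (v t)\<bar>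
        \<le> \<bar>s - t\<bar> * ?e s"
      unfolding eq by (simp only: mult.assoc)
  qed
  then show ?thesis by simp
qed

text \<open>By antisymmetry and b(f - g, g, g) = 0 only a term with its derivative on g is left; g
  will be the Euler solution, whose gradient is bounded.\<close>

lemma convection_difference:
  assumes f: "f \<in> Vspace r" and g: "g \<in> Vspace r"
  shows "b f f g + b g g f = - b (\<lambda>x. f x - g x) g (\<lambda>x. f x - g x)"
proof -
  note d = V_diff[OF r b f g]
  have "b (\<lambda>x. f x - g x) g (\<lambda>x. f x - g x) = b (\<lambda>x. f x - g x) g f - b (\<lambda>x. f x - g x) g g"
    by (rule b_diff(1)[OF r b d g f g])
  also have "b (\<lambda>x. f x - g x) g g = 0" by (rule b_self_0[OF r b d g])
  also have "b (\<lambda>x. f x - g x) g f = b f g f - b g g f"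
    by (rule b_diff(3)[OF r b g f f g])
  also have "b f g f = - b f f g" by (rule b_antisym[OF r b f g f])
  finally show ?thesis by simp
qed

text \<open>Young's inequality with two weights: the first handles the term with v' in F', the
  second leaves only half of \<open>a * Q f f\<close>, to be absorbed by D.\<close>

lemma Q_bound:
  assumes f: "f \<in> Vspace r" and g: "g \<in> Vspace r" "N g \<le> A"
  shows "2 * a * \<bar>Q f g\<bar> \<le> a * Q f f + a * A\<^sup>2" "2 * a * \<bar>Q f g\<bar> \<le> a * Q f f / 2 + 2 * a * A\<^sup>2"
proof -
  define q where "q = sqrt (Q f f)"
  have Qn: "0 \<le> Q f f" by (rule wform_self_nonneg[OF fweight_nonneg])
  then have qq: "q\<^sup>2 = Q f f" "0 \<le> q" by (simp_all add: q_def)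
  have "\<bar>Q f g\<bar> \<le> q * sqrt (Q g g)"
    unfolding q_def
    by (rule wform_Cauchy_Schwarz[OF fweight_nonneg Sobolev_fweight[OF r0 VS[OF f]] Sobolev_fweight[OF r0 VS[OF g(1)]]])
  also have "\<dots> \<le> q * A"
    using wform_fweight_le[OF r0 VS[OF g(1)]] g(2) qq(2) by (intro mult_left_mono) simp_all
  finally have le: "\<bar>Q f g\<bar> \<le> q * A" .
  have "2 * (q * A) \<le> q\<^sup>2 + A\<^sup>2"
    using sum_squares_bound[of q A] by (simp add: mult.assoc)
  with le have "2 * \<bar>Q f g\<bar> \<le> Q f f + A\<^sup>2" unfolding qq(1) by linarith
  from mult_left_mono[OF this less_imp_le[OF a]]
  show "2 * a * \<bar>Q f g\<bar> \<le> a * Q f f + a * A\<^sup>2" by (simp add: algebra_simps)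
  have "2 * (q * A) \<le> q\<^sup>2 / 2 + 2 * A\<^sup>2"
    using zero_le_power2[of "q - 2 * A"] by (simp add: power2_diff power_mult_distrib algebra_simps)
  with le have "2 * \<bar>Q f g\<bar> \<le> Q f f / 2 + 2 * A\<^sup>2" unfolding qq(1) by linarith
  from mult_left_mono[OF this less_imp_le[OF a]]
  show "2 * a * \<bar>Q f g\<bar> \<le> a * Q f f / 2 + 2 * a * A\<^sup>2" by (simp add: algebra_simps)
qed

text \<open>With \<open>F = L(u,u) + |v|\<^sup>2 - 2 L(u,v)\<close> the relative energy \<open>D = |u - v|\<^sup>2 + a Q(u,u)\<close> equals
  \<open>F + 2 a Q(u,v)\<close>, and \<open>F\<close> is differentiable although \<open>D\<close> need not be.\<close>

lemma relative_energy_estimate: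
  assumes t: "t \<in> {0..T}"
  shows "a * Q (u t) (u t) \<le> a * (A\<^sup>2 * (6 * exp ((4 * K + 2) * T) + 4))"
proof -
  define F where "F s = L (u s) (u s) + l2inner (v s) (v s) - 2 * L (u s) (v s)" for s
  define F' where "F' s = - 2 * (- b (u s) (u s) (v s) + L (u s) (v' s))" for s
  define D where "D s = (l2norm (\<lambda>x. u s x - v s x))\<^sup>2 + a * Q (u s) (u s)" for s
  \<comment> \<open>These constants come from F' <= (2 K + 1) D + a A^2 and D <= 2 F + 4 a A^2,
    proved below.\<close>
  define k where "k = 4 * K + 2"
  define c where "c = (2 * k + 1) * (a * A\<^sup>2)"
  have k: "2 \<le> k" using K by (simp add: k_def)
  have aA: "0 \<le> a * A\<^sup>2" using a by simp
  have c0: "0 \<le> c" using k aA by (simp add: c_def)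
  have D_eq: "D s = F s + 2 * a * Q (u s) (v s)" for s
  proof -
    have "(l2norm (\<lambda>x. u s x - v s x))\<^sup>2 = l2inner (u s) (u s) - 2 * l2inner (u s) (v s) + l2inner (v s) (v s)"
      using l2inner_quadratic[OF V_L2[OF r b uV] V_L2[OF r b vV], of 1 s "- 1" s] by (simp add: l2norm_sq)
    then show ?thesis by (simp add: D_def F_def voigt_form_def algebra_simps)
  qed
  have Qn: "0 \<le> a * Q (u s) (u s)" for s
    using a wform_self_nonneg[OF fweight_nonneg] by simp
  \<comment> \<open>Absorption: D <= F + D / 2 + 2 a A^2.\<close>
  have D_le: "D s \<le> 2 * F s + 4 * (a * A\<^sup>2)" if "s \<in> {0..T}" for s
  proof -
    have "2 * a * Q (u s) (v s) \<le> 2 * a * \<bar>Q (u s) (v s)\<bar>" using a by (intro mult_left_mono) simp_all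
    also have "\<dots> \<le> a * Q (u s) (u s) / 2 + 2 * a * A\<^sup>2" by (rule Q_bound(2)[OF uV vV Av[OF that]])
    also have "a * Q (u s) (u s) \<le> D s" by (simp add: D_def)
    finally have "2 * a * Q (u s) (v s) \<le> D s / 2 + 2 * (a * A\<^sup>2)" by (simp add: mult.assoc)
    then show ?thesis using D_eq[of s] by linarith
  qed
  have F'_le: "F' s \<le> k * F s + c" if s: "s \<in> {0..T}" for s
  proof -
    have "L (u s) (v' s) = - b (v s) (v s) (u s) + a * Q (u s) (v' s)"
      using euler[OF s uV[of s]] by (simp add: voigt_form_def l2inner_commute)
    then have "F' s = 2 * (b (u s) (u s) (v s) + b (v s) (v s) (u s)) - 2 * a * Q (u s) (v' s)"
      by (simp add: F'_def algebra_simps)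
    also have "\<dots> = - 2 * b (\<lambda>x. u s x - v s x) (v s) (\<lambda>x. u s x - v s x) - 2 * a * Q (u s) (v' s)"
      unfolding convection_difference[OF uV vV] by simp
    also have "\<dots> \<le> 2 * (K * (l2norm (\<lambda>x. u s x - v s x))\<^sup>2) + (a * Q (u s) (u s) + a * A\<^sup>2)"
    proof -
      have "- (2 * a * Q (u s) (v' s)) \<le> 2 * a * \<bar>Q (u s) (v' s)\<bar>"
        using a by (simp add: abs_ge_minus_self mult.assoc) (metis abs_ge_minus_self mult_left_mono mult_minus_right less_imp_le)
      then show ?thesis
        using stretch[OF s V_diff[OF r b uV vV], of s s] Q_bound(1)[OF uV v'V Av'[OF s], of s] by linarith
    qed
    also have "\<dots> \<le> (2 * K + 1) * D s + a * A\<^sup>2"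
      unfolding D_def using K Qn[of s] mult_nonneg_nonneg[OF K Qn[of s]]
      by (simp add: algebra_simps)
    also have "\<dots> \<le> (2 * K + 1) * (2 * F s + 4 * (a * A\<^sup>2)) + a * A\<^sup>2"
      using K D_le[OF s] by (intro add_right_mono mult_left_mono) simp_all
    also have "\<dots> = k * F s + c" by (simp add: k_def c_def algebra_simps)
    finally show ?thesis .
  qed
  have F_deriv: "(F has_real_derivative F' s) (at s within {0..T})" if s: "s \<in> {0..T}" for s
  proof -
    have "((\<lambda>s. L (u s) (u s) + l2inner (v s) (v s) - 2 * L (u s) (v s)) has_real_derivative
        0 + 0 - 2 * (- b (u s) (u s) (v s) + L (u s) (v' s))) (at s within {0..T})"
      by (intro DERIV_diff DERIV_add DERIV_cmult energy_derivative[OF s] v_norm_derivative[OF s] mixed_derivative[OF s])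
    then show ?thesis unfolding F_def F'_def by simp
  qed
  have T0: "0 \<in> {0..T}" using t by simp
  \<comment> \<open>At time 0 the integral in the equation vanishes, which identifies u 0 with the
    datum under \<open>L\<close>.\<close>
  have Lu: "L (u 0) w = L ui w" if "w \<in> Vspace r" for w
    using eqn[OF T0 that] by simp
  have L_v0: "L w (v 0) = L w ui" if "w \<in> Vspace r" for w
  proof -
    have "l2inner w (v 0) = l2inner w ui"
      unfolding Parseval(2)[OF V_L2[OF r b that] V_L2[OF r b vV]] Parseval(2)[OF V_L2[OF r b that] V_L2[OF r b u0V]] v0 ..
    then show ?thesis by (simp add: voigt_form_def wform_def v0)
  qed
  have vv: "l2inner (v 0) (v 0) = l2inner ui ui"
    unfolding Parseval(2)[OF V_L2[OF r b vV] V_L2[OF r b vV]] Parseval(2)[OF V_L2[OF r b u0V] V_L2[OF r b u0V]] v0 ..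
  \<comment> \<open>This value is -a Q(ui, ui); the relative energy itself starts at a Q(ui, ui), so
    F is the better quantity at time 0 as well.\<close>
  have "F 0 = L ui ui + l2inner ui ui - 2 * L ui ui"
    unfolding F_def vv L_v0[OF uV] Lu[OF uV] Lu[OF u0V] voigt_form_commute[of a r ui "u 0"] ..
  then have F0: "F 0 \<le> 0"
    using a wform_self_nonneg[of "fweight r" ui, OF fweight_nonneg] by (simp add: voigt_form_def)
  have "F t \<le> c / k * exp (k * t)"
    using k by (intro gronwall_derivative[OF _ c0 t F_deriv F'_le F0]) simp_all
  also have "\<dots> \<le> 3 * (a * A\<^sup>2) * exp (k * T)"
  proof (rule mult_mono)
    \<comment> \<open>(2 k + 1) / k <= 3; doubling in D <= 2 F + 4 a A^2 gives the 6 and the 4 of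
      the conclusion.\<close>
    have "c \<le> 3 * (a * A\<^sup>2) * k"
      using mult_right_mono[OF k aA] aA unfolding c_def by (simp add: algebra_simps)
    then show "c / k \<le> 3 * (a * A\<^sup>2)" using k by (simp add: pos_divide_le_eq)
    show "exp (k * t) \<le> exp (k * T)" using t k by simp
  qed (use aA in simp_all)
  finally have "D t \<le> 6 * (a * A\<^sup>2) * exp (k * T) + 4 * (a * A\<^sup>2)"
    using D_le[OF t] by simp
  moreover have "a * Q (u t) (u t) \<le> D t" by (simp add: D_def)
  ultimately show ?thesis by (simp add: k_def algebra_simps)
qed

end

section \<open>From the given solutions to the setting of the estimate\<close>

lemma hsnorm_tendsto_weaken:
  assumes "r \<le> q" "\<And>\<tau>. \<tau> \<in> S \<Longrightarrow> f \<tau> \<in> Sobolev q"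
    "((\<lambda>\<tau>. hsnorm q (f \<tau>)) \<longlongrightarrow> 0) (at t within S)"
  shows "((\<lambda>\<tau>. hsnorm r (f \<tau>)) \<longlongrightarrow> 0) (at t within S)"
proof (rule Lim_null_comparison[OF _ assms(3)])
  have "norm (hsnorm r (f \<tau>)) \<le> hsnorm q (f \<tau>)" if "\<tau> \<in> S" for \<tau>
    using hsnorm_mono[OF assms(1) assms(2)[OF that]] by simp
  then show "eventually (\<lambda>\<tau>. norm (hsnorm r (f \<tau>)) \<le> hsnorm q (f \<tau>)) (at t within S)"
    by (auto simp: eventually_at_filter)
qed

text \<open>Composing with this freezes a path outside [0, T], so membership holds at all times
  while limits within [0, T] are unchanged.\<close>

definition clamp_time :: "real \<Rightarrow> real \<Rightarrow> real" where
  "clamp_time T t = max 0 (min T t)"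

lemma clamp_time_id: "t \<in> {0..T} \<Longrightarrow> clamp_time T t = t"
  by (simp add: clamp_time_def)

lemma clamp_time_in: "0 < T \<Longrightarrow> clamp_time T t \<in> {0..T}"
  by (simp add: clamp_time_def)

lemma tendsto_clamp_time:
  assumes "((\<lambda>\<tau>. P (f \<tau>) \<tau>) \<longlongrightarrow> l) (at t within {0..T})"
  shows "((\<lambda>\<tau>. P (f (clamp_time T \<tau>)) \<tau>) \<longlongrightarrow> l) (at t within {0..T})"
  by (rule Lim_cong_within[THEN iffD1, OF refl refl refl _ assms]) (simp add: clamp_time_id)

lemma continuous_into_bounded:
  assumes T: "0 < T" and c: "continuous_into X (hsnorm q) T f" and X: "X \<subseteq> Sobolev q"
  shows "\<exists>M\<ge>0. \<forall>t\<in>{0..T}. hsnorm q (f t) \<le> M"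
proof -
  let ?f = "\<lambda>\<tau>. f (clamp_time T \<tau>)"
  have S: "?f \<tau> \<in> Sobolev q" for \<tau>
    using c X clamp_time_in[OF T] unfolding continuous_into_def by blast
  have "((\<lambda>\<tau>. hsnorm q (?f \<tau>)) \<longlongrightarrow> hsnorm q (?f t)) (at t within {0..T})" if t: "t \<in> {0..T}" for t
  proof (rule tendsto_hsnorm[OF S S])
    have "((\<lambda>\<tau>. hsnorm q (\<lambda>x. f \<tau> x - f t x)) \<longlongrightarrow> 0) (at t within {0..T})"
      using c t unfolding continuous_into_def by blast
    from tendsto_clamp_time[where P = "\<lambda>g \<tau>. hsnorm q (\<lambda>x. g x - f t x)", OF this]
    show "((\<lambda>\<tau>. hsnorm q (\<lambda>x. ?f \<tau> x - ?f t x)) \<longlongrightarrow> 0) (at t within {0..T})"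
      by (simp only: clamp_time_id[OF t])
  qed
  from tendsto_imp_bounded_Icc[OF this]
  obtain M where M: "0 \<le> M" "\<And>t. t \<in> {0..T} \<Longrightarrow> \<bar>hsnorm q (?f t)\<bar> \<le> M" by blast
  have "hsnorm q (f t) \<le> M" if "t \<in> {0..T}" for t
    using M(2)[OF that] by (simp add: clamp_time_id[OF that])
  with M(1) show ?thesis by blast
qed

lemma Sobolev_sol_iff: "f \<in> Sobolev_sol q \<Longrightarrow> f \<in> Sobolev q \<and> solen f"
  unfolding Sobolev_sol_def using div_free_imp_solen Sobolev_L2 by blast

text \<open>The constant is quantified before alpha and u: it is built from T, the embedding
  constant and bounds on the Euler solution, whereas the form b is obtained separately for each
  alpha.\<close>

lemma voigt_energy_bound:
  assumes basis: "stokes_eigenbasis \<phi> lam"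
    and s: "s \<ge> 3" and u0: "u0 \<in> Sobolev s" "div_free u0" "mean_free u0"
    and r: "5 / 6 < r" "r \<le> 1" and T: "0 < T"
    and reg: "euler_regular_solution s u0 T v"
  shows "\<exists>C. \<forall>\<alpha>>0. \<forall>u. euler_voigt_solution \<phi> lam \<alpha> r u0 T u \<longrightarrow>
    (\<forall>t\<in>{0..T}. \<alpha> powr (2 * r) * (l2norm (stokes_pow \<phi> lam (r / 2) (u t)))\<^sup>2 \<le> \<alpha> powr (2 * r) * C)"
proof -
  let ?S = "{0..T}"
  have r0: "0 \<le> r" using r by simp
  have Viff: "f \<in> Vspace r \<longleftrightarrow> f \<in> Sobolev r \<and> solen f" for f by (rule Vspace_iff[OF r0 r(2)])
  obtain v' where vc: "continuous_into (Sobolev_sol s) (hsnorm s) T v"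
    and v'c: "continuous_into (Sobolev_sol (s - 1)) (hsnorm (s - 1)) T v'"
    and vd: "\<And>t. t \<in> ?S \<Longrightarrow> ((\<lambda>\<tau>. hsnorm (s - 1) (\<lambda>x. (1 / (\<tau> - t)) *\<^sub>R (v \<tau> x - v t x) - v' t x)) \<longlongrightarrow> 0) (at t within ?S)"
    and veq: "\<And>t. t \<in> ?S \<Longrightarrow> AE x in torus. v' t x + convect (v t) (v t) x = 0"
    and v0: "AE x in torus. v 0 x = u0 x"
    using reg unfolding euler_regular_solution_def by blast
  have v: "v t \<in> Sobolev s" "solen (v t)" if "t \<in> ?S" for t
    using vc that Sobolev_sol_iff unfolding continuous_into_def by blast+
  have v': "v' t \<in> Sobolev (s - 1)" "solen (v' t)" if "t \<in> ?S" for t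
    using v'c that Sobolev_sol_iff unfolding continuous_into_def by blast+
  have v3: "v t \<in> Sobolev 3" if "t \<in> ?S" for t using Sobolev_mono[OF s v(1)[OF that]] .
  have vs1: "v t \<in> Sobolev (s - 1)" if "t \<in> ?S" for t
    using Sobolev_mono[of "s - 1" s] v(1)[OF that] by simp
  have rs: "r \<le> s" "r \<le> s - 1" using s r by simp_all
  have vV: "v t \<in> Vspace r" if "t \<in> ?S" for t
    using Sobolev_mono[OF rs(1) v(1)[OF that]] v(2)[OF that] by (simp add: Viff)
  have v'V: "v' t \<in> Vspace r" if "t \<in> ?S" for t
    using Sobolev_mono[OF rs(2) v'(1)[OF that]] v'(2)[OF that] by (simp add: Viff)
  have u0V: "u0 \<in> Vspace r"
    using Sobolev_mono[OF rs(1) u0(1)] div_free_imp_solen[OF Sobolev_L2[OF u0(1)] u0(2,3)] by (simp add: Viff)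
  obtain M where M: "0 \<le> M" "\<And>t. t \<in> ?S \<Longrightarrow> hsnorm s (v t) \<le> M"
    using continuous_into_bounded[OF T vc] Sobolev_sol_iff by blast
  obtain M' where M': "0 \<le> M'" "\<And>t. t \<in> ?S \<Longrightarrow> hsnorm (s - 1) (v' t) \<le> M'"
    using continuous_into_bounded[OF T v'c] Sobolev_sol_iff by blast
  obtain C where C: "0 \<le> C" "\<And>f n x j. f \<in> Sobolev 3 \<Longrightarrow> norm (pd j (trunc n f) x) \<le> C * hsnorm 3 f"
    using Sobolev_sup_const by metis
  have pdM: "norm (pd j (trunc n (v t)) x) \<le> C * M" if "t \<in> ?S" for t n x j
  proof -
    have "hsnorm 3 (v t) \<le> M" using hsnorm_mono[OF s v(1)[OF that]] M(2)[OF that] by simp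
    then show ?thesis
      using C(2)[OF v3[OF that], of j n x] mult_left_mono[OF _ C(1)] by (meson order_trans)
  qed
  have CM: "0 \<le> C * M" using C(1) M(1) by simp
  \<comment> \<open>One bound for v and its time derivative; Z below is the constant that
    \<open>relative_energy_estimate\<close> yields for it.\<close>
  define A where "A = max M M'"
  define Z where "Z = A\<^sup>2 * (6 * exp ((4 * (3 * (C * M)) + 2) * T) + 4)"
  have fv0: "fourier (v 0) k = fourier u0 k" for k
    using T by (intro fourier_cong_AE[OF Sobolev_L2[OF v(1)] Sobolev_L2[OF u0(1)] v0]) simp
  have "\<alpha> powr (2 * r) * (l2norm (stokes_pow \<phi> lam (r / 2) (u t)))\<^sup>2 \<le> \<alpha> powr (2 * r) * Z"
    if \<alpha>: "\<alpha> > 0" and sol: "euler_voigt_solution \<phi> lam \<alpha> r u0 T u" and t: "t \<in> ?S" for \<alpha> u t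
  proof -
    define a where "a = \<alpha> powr (2 * r)"
    have a: "0 < a" using \<alpha> by (simp add: a_def)
    obtain b where b: "convection_extension r b"
      and eqn: "\<And>t w. t \<in> ?S \<Longrightarrow> w \<in> Vspace r \<Longrightarrow>
          l2inner (u t) w + a * stokes_pow_dual \<phi> lam r (u t) w - l2inner u0 w - a * stokes_pow_dual \<phi> lam r u0 w
          = - integral {0..t} (\<lambda>\<tau>. b (u \<tau>) (u \<tau>) w)"
      and uc: "continuous_into (Vspace r) (hsnorm r) T u"
      using sol unfolding euler_voigt_solution_def a_def by blast
    have uV: "u t \<in> Vspace r" if "t \<in> ?S" for t
      using uc that unfolding continuous_into_def by blast
    let ?c = "clamp_time T"
    note cin = clamp_time_in[OF T] and cid = clamp_time_id
    have dual: "stokes_pow_dual \<phi> lam r f w = wform (fweight r) f w" if "f \<in> Vspace r" "w \<in> Vspace r" for f w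
      using stokes_pow_dual_eq_wform[OF basis r0] that by (simp add: Viff)
    have "a * wform (fweight r) (u (?c t)) (u (?c t)) \<le> a * Z"
      unfolding Z_def
    \<comment> \<open>C M bounds each partial derivative of every truncation of v, and the factor 3
      in K counts the directions.\<close>
    proof (rule relative_energy_estimate[OF r b a, where K = "3 * (C * M)" and ui = u0
          and v = "\<lambda>\<tau>. v (?c \<tau>)" and v' = "\<lambda>\<tau>. v' (?c \<tau>)" and u = "\<lambda>\<tau>. u (?c \<tau>)" and t = t and T = T])
      show "0 \<le> A" using M(1) by (simp add: A_def)
      show "0 \<le> 3 * (C * M)" using CM by simp
      show "u (?c t) \<in> Vspace r" for t by (rule uV[OF cin])
      show "v (?c t) \<in> Vspace r" for t by (rule vV[OF cin])
      show "v' (?c t) \<in> Vspace r" for t by (rule v'V[OF cin])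
      show "u0 \<in> Vspace r" by (rule u0V)
      show "t \<in> ?S" by (rule t)
      show "fourier (v (?c 0)) k = fourier u0 k" for k
        using T fv0 by (simp add: cid)
    next
      fix t assume t: "t \<in> ?S"
      have "((\<lambda>\<tau>. hsnorm r (\<lambda>x. u \<tau> x - u t x)) \<longlongrightarrow> 0) (at t within ?S)"
        using uc t unfolding continuous_into_def by blast
      from tendsto_clamp_time[where P = "\<lambda>g \<tau>. hsnorm r (\<lambda>x. g x - u t x)", OF this]
      show "((\<lambda>\<tau>. hsnorm r (\<lambda>x. u (?c \<tau>) x - u (?c t) x)) \<longlongrightarrow> 0) (at t within ?S)"
        by (simp only: cid[OF t])
      have "((\<lambda>\<tau>. hsnorm s (\<lambda>x. v \<tau> x - v t x)) \<longlongrightarrow> 0) (at t within ?S)"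
        using vc t unfolding continuous_into_def by blast
      from hsnorm_tendsto_weaken[where f = "\<lambda>\<tau> x. v \<tau> x - v t x", OF rs(1) Sobolev_diff[OF v(1) v(1)[OF t]] this]
      have "((\<lambda>\<tau>. hsnorm r (\<lambda>x. v \<tau> x - v t x)) \<longlongrightarrow> 0) (at t within ?S)" .
      from tendsto_clamp_time[where P = "\<lambda>g \<tau>. hsnorm r (\<lambda>x. g x - v t x)", OF this]
      show "((\<lambda>\<tau>. hsnorm r (\<lambda>x. v (?c \<tau>) x - v (?c t) x)) \<longlongrightarrow> 0) (at t within ?S)"
        by (simp only: cid[OF t])
      have q: "(\<lambda>x. (1 / (\<tau> - t)) *\<^sub>R (v \<tau> x - v t x) - v' t x) \<in> Sobolev (s - 1)" if "\<tau> \<in> ?S" for \<tau>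
      proof -
        have d: "(\<lambda>x. v \<tau> x - v t x) \<in> Sobolev (s - 1)" by (rule Sobolev_diff[OF vs1[OF that] vs1[OF t]])
        show ?thesis
          using Sobolev_lincomb[OF d v'(1)[OF t], of "1 / (\<tau> - t)" "- 1"] by simp
      qed
      from hsnorm_tendsto_weaken[where f = "\<lambda>\<tau> x. (1 / (\<tau> - t)) *\<^sub>R (v \<tau> x - v t x) - v' t x", OF rs(2) q vd[OF t]]
      have "((\<lambda>\<tau>. hsnorm r (\<lambda>x. (1 / (\<tau> - t)) *\<^sub>R (v \<tau> x - v t x) - v' t x)) \<longlongrightarrow> 0) (at t within ?S)" .
      from tendsto_clamp_time[where P = "\<lambda>g \<tau>. hsnorm r (\<lambda>x. (1 / (\<tau> - t)) *\<^sub>R (g x - v t x) - v' t x)", OF this]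
      show "((\<lambda>\<tau>. hsnorm r (\<lambda>x. (1 / (\<tau> - t)) *\<^sub>R (v (?c \<tau>) x - v (?c t) x) - v' (?c t) x)) \<longlongrightarrow> 0) (at t within ?S)"
        by (simp only: cid[OF t])
      show "hsnorm r (v (?c t)) \<le> A"
        using hsnorm_mono[OF rs(1) v(1)[OF t]] M(2)[OF t] by (simp add: cid[OF t] A_def)
      show "hsnorm r (v' (?c t)) \<le> A"
        using hsnorm_mono[OF rs(2) v'(1)[OF t]] M'(2)[OF t] by (simp add: cid[OF t] A_def)
    next
      fix t w assume t: "t \<in> ?S" and w: "w \<in> Vspace r"
      have "integral {0..t} (\<lambda>\<tau>. b (u (?c \<tau>)) (u (?c \<tau>)) w) = integral {0..t} (\<lambda>\<tau>. b (u \<tau>) (u \<tau>) w)"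
        by (intro integral_cong) (use t cid in auto)
      then show "voigt_form a r (u (?c t)) w - voigt_form a r u0 w = - integral {0..t} (\<lambda>\<tau>. b (u (?c \<tau>)) (u (?c \<tau>)) w)"
        using eqn[OF t w] by (simp add: cid[OF t] voigt_form_def dual uV[OF t] u0V w)
      have cL: "convect (v t) (v t) \<in> Hspace" by (rule convect_Hspace[OF v3[OF t]])
      have "AE x in torus. v' t x = (- 1) *\<^sub>R convect (v t) (v t) x"
        using veq[OF t] by eventually_elim (simp add: eq_neg_iff_add_eq_0)
      then have "l2inner (v' t) w = l2inner (\<lambda>x. (- 1) *\<^sub>R convect (v t) (v t) x) w"
        by (intro l2inner_cong_AE L2_scale Hspace_L2[OF cL] Sobolev_L2[OF v'(1)[OF t]] V_L2[OF r b w])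
      also have "\<dots> = - l2inner (convect (v t) (v t)) w"
        by (simp add: l2inner_def)
      also have "\<dots> = - b (v t) (v t) w"
        by (simp only: b_eq_convect[OF r b v3[OF t] v(2)[OF t] w])
      finally show "l2inner (v' (?c t)) w = - b (v (?c t)) (v (?c t)) w"
        by (simp only: cid[OF t])
      show "\<bar>b w (v (?c t)) w\<bar> \<le> 3 * (C * M) * (l2norm w)\<^sup>2"
        unfolding cid[OF t] by (rule b_stretching_bound[OF r b CM pdM[OF t] vV[OF t] w])
    qed
    then show ?thesis
      using stokes_pow_norm[OF basis r0, of "u t"] uV[OF t] by (simp add: a_def cid[OF t] Viff)
  qed
  then show ?thesis by blast
qed

theorem theorem6p1:
  fixes \<phi> :: "nat \<Rightarrow> field" and lam :: "nat \<Rightarrow> real"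
    and s r T :: real and u0 :: field
    and u :: "real \<Rightarrow> real \<Rightarrow> field"
  assumes "stokes_eigenbasis \<phi> lam"
    and "s \<ge> 3" and "u0 \<in> Sobolev s" and "div_free u0" and "mean_free u0"
    and "5 / 6 < r" and "r \<le> 1"
    and "\<And>\<alpha> T'. \<alpha> > 0 \<Longrightarrow> T' > 0 \<Longrightarrow> euler_voigt_solution \<phi> lam \<alpha> r u0 T' (u \<alpha>)"
    and "T > 0"
    and "(SUP t\<in>{0..<T}. Limsup (at_right 0)
            (\<lambda>\<alpha>. ereal (\<alpha> powr (2 * r) * (l2norm (stokes_pow \<phi> lam (r / 2) (u \<alpha> t)))\<^sup>2))) > 0"
  shows "euler_develops_singularity s u0 T"
proof (rule ccontr)
  assume "\<not> euler_develops_singularity s u0 T"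
  then obtain v where "euler_regular_solution s u0 T v"
    unfolding euler_develops_singularity_def by blast
  from voigt_energy_bound[OF assms(1-7,9) this]
  obtain C where C: "\<And>\<alpha> t. \<alpha> > 0 \<Longrightarrow> t \<in> {0..T} \<Longrightarrow>
      \<alpha> powr (2 * r) * (l2norm (stokes_pow \<phi> lam (r / 2) (u \<alpha> t)))\<^sup>2 \<le> \<alpha> powr (2 * r) * C"
    using assms(8)[OF _ assms(9)] by blast
  \<comment> \<open>The majorant C alpha^(2r) tends to 0 for any real C, so each upper limit is at
    most 0, and so is their supremum.\<close>
  have "Limsup (at_right 0) (\<lambda>\<alpha>. ereal (\<alpha> powr (2 * r) * (l2norm (stokes_pow \<phi> lam (r / 2) (u \<alpha> t)))\<^sup>2)) \<le> 0"
    if t: "t \<in> {0..<T}" for t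
  proof -
    have "((\<lambda>\<alpha>. \<alpha> powr (2 * r)) \<longlongrightarrow> 0) (at_right (0::real))"
      using assms(6) by (intro tendsto_zero_powrI[where b = "2 * r"]) (auto simp: eventually_at_filter)
    then have "((\<lambda>\<alpha>. \<alpha> powr (2 * r) * C) \<longlongrightarrow> 0) (at_right 0)"
      using tendsto_mult_right[of _ 0 "at_right 0" C] by simp
    then have "((\<lambda>\<alpha>. ereal (\<alpha> powr (2 * r) * C)) \<longlongrightarrow> ereal 0) (at_right 0)"
      by (rule tendsto_ereal)
    then have lim: "Limsup (at_right 0) (\<lambda>\<alpha>. ereal (\<alpha> powr (2 * r) * C)) = ereal 0"
      by (rule lim_imp_Limsup[rotated]) simp
    have "Limsup (at_right 0) (\<lambda>\<alpha>. ereal (\<alpha> powr (2 * r) * (l2norm (stokes_pow \<phi> lam (r / 2) (u \<alpha> t)))\<^sup>2))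
        \<le> Limsup (at_right 0) (\<lambda>\<alpha>. ereal (\<alpha> powr (2 * r) * C))"
      using C t by (intro Limsup_mono) (auto simp: eventually_at_filter)
    then show ?thesis unfolding lim by (simp only: zero_ereal_def)
  qed
  then have "(SUP t\<in>{0..<T}. Limsup (at_right 0)
      (\<lambda>\<alpha>. ereal (\<alpha> powr (2 * r) * (l2norm (stokes_pow \<phi> lam (r / 2) (u \<alpha> t)))\<^sup>2))) \<le> 0"
    by (rule SUP_least)
  with assms(10) show False by simp
qed

end
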